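(* Let $\mathcal C$ be an exact Goursat category. There is a bijection between the Birkhoff subcategories of $\mathcal C$ and the Birkhoff closure operators on (effective) equivalence relations in $\mathcal C$, obtained by restricting the following bijection between the epireflective subcategories of $\mathcal C$ and the effective closure operators. To an epireflective subcategory $\mathcal L$ with inclusion $\iota$, reflector $\lambda$ and unit $\eta$ corresponds the closure operator sending an equivalence relation $S$ on $X$, with quotient $q\colon X\to X/S$, to the kernel pair $\overline S=R[\eta_{X/S}\circ q]$ of $\eta_{X/S}\circ q\colon X\to\iota\lambda(X/S)$. To an effective closure operator $\overline{(\,\,)}$ corresponds the full replete subcategory of those objects $X$ such that $\overline{\Delta_X}=\Delta_X$.
   Context: An exact category is a finitely complete regular category in which every equivalence relation is effective, i.e. is a kernel pair. An exact Goursat category is an exact category in which any two equivalence relations $R,S$ on the same object satisfy $R\circ S\circ R=S\circ R\circ S$, where $\circ$ is relational composition. In such a category the regular image $f(S)$ of an equivalence relation $S$ on $X$ along a regular epimorphism $f\colon X\to Y$ (the regular image of $S\to X\times X\xrightarrow{f\times f}Y\times Y$) is an equivalence relation on $Y$. An epireflective subcategory $\mathcal L$ of $\mathcal C$ is a full replete reflective subcategory, with inclusion $\iota$ and left adjoint $\lambda$, such that every component $\eta_A\colon A\to\iota\lambda(A)$ of the unit is a regular epimorphism. It is a Birkhoff subcategory if it is closed under regular quotients: if $f\colon X\to Y$ is a regular epimorphism and $X\in\mathcal L$, then $Y\in\mathcal L$. $R[f]$ is the kernel pair of $f$; $\Delta_X$ is the discrete (diagonal) equivalence relation on $X$; for an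 equivalence relation $S$ on $X$, $q\colon X\to X/S$ is the coequaliser of its projections; $f^{-1}(S)$ is the inverse image of $S$ along $f$, i.e. the pullback of $S\to X\times X$ along $f\times f$. Relations are regarded as subobjects of $X\times X$, and equality and inclusion are those of subobjects. An effective closure operator assigns to every (effective) equivalence relation $S$ on any object $X$ an (effective) equivalence relation $\overline S$ on $X$ such that, for all equivalence relations $S,T$ on $X$ and every $f\colon Y\to X$ in $\mathcal C$: (1) $S\subseteq\overline S$; (2) $S\subseteq T$ implies $\overline S\subseteq\overline T$; (3) $\overline{f^{-1}(S)}\subseteq f^{-1}(\overline S)$; (4) $\overline{\overline S}=\overline S$; (5) $\overline{f^{-1}(S)}=f^{-1}(\overline S)$ whenever $f$ is a regular epimorphism. It is a Birkhoff closure operator if moreover (6) $\overline{f(S)}=f(\overline S)$ for every regular epimorphism $f\colon X\to Y$ and every equivalence relation $S$ on $X$. *)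

theory Defs
  imports Main "HOL-Library.FuncSet"
begin

section \<open>Categories\<close>

record ('o, 'a) precategory =
  Obj :: "'o set"
  Arr :: "'a set"
  Dom :: "'a \<Rightarrow> 'o"
  Cod :: "'a \<Rightarrow> 'o"
  Ide :: "'o \<Rightarrow> 'a"
  Comp :: "'a \<Rightarrow> 'a \<Rightarrow> 'a" (infixr "\<cdot>\<index>" 70)

text \<open>Composition is written in applicative order: \<open>g \<cdot>\<^bsub>C\<^esub> f\<close> is ``\<open>g\<close> after \<open>f\<close>'' and is
  meaningful only if \<open>Cod f = Dom g\<close>.\<close>

definition Hom :: "('o, 'a) precategory \<Rightarrow> 'o \<Rightarrow> 'o \<Rightarrow> 'a set" where
  "Hom C X Y = {f \<in> Arr C. Dom C f = X \<and> Cod C f = Y}"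

locale category =
  fixes C :: "('o, 'a) precategory"
  assumes Dom_in: "f \<in> Arr C \<Longrightarrow> Dom C f \<in> Obj C"
    and Cod_in: "f \<in> Arr C \<Longrightarrow> Cod C f \<in> Obj C"
    and Ide_in: "X \<in> Obj C \<Longrightarrow> Ide C X \<in> Hom C X X"
    and Comp_in: "f \<in> Hom C X Y \<Longrightarrow> g \<in> Hom C Y Z \<Longrightarrow> g \<cdot>\<^bsub>C\<^esub> f \<in> Hom C X Z"
    and Comp_Ide: "f \<in> Hom C X Y \<Longrightarrow> f \<cdot>\<^bsub>C\<^esub> Ide C X = f"
    and Ide_Comp: "f \<in> Hom C X Y \<Longrightarrow> Ide C Y \<cdot>\<^bsub>C\<^esub> f = f"
    and Comp_assoc: "f \<in> Hom C W X \<Longrightarrow> g \<in> Hom C X Y \<Longrightarrow> h \<in> Hom C Y Z \<Longrightarrow>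
      (h \<cdot>\<^bsub>C\<^esub> g) \<cdot>\<^bsub>C\<^esub> f = h \<cdot>\<^bsub>C\<^esub> (g \<cdot>\<^bsub>C\<^esub> f)"

definition is_iso :: "('o, 'a) precategory \<Rightarrow> 'a \<Rightarrow> bool" where
  "is_iso C f \<longleftrightarrow> f \<in> Arr C \<and> (\<exists>g \<in> Hom C (Cod C f) (Dom C f).
     g \<cdot>\<^bsub>C\<^esub> f = Ide C (Dom C f) \<and> f \<cdot>\<^bsub>C\<^esub> g = Ide C (Cod C f))"

definition is_mono :: "('o, 'a) precategory \<Rightarrow> 'a \<Rightarrow> bool" where
  "is_mono C m \<longleftrightarrow> m \<in> Arr C \<and>
     (\<forall>Z. \<forall>f \<in> Hom C Z (Dom C m). \<forall>g \<in> Hom C Z (Dom C m). m \<cdot>\<^bsub>C\<^esub> f = m \<cdot>\<^bsub>C\<^esub> g \<longrightarrow> f = g)"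

definition is_functor ::
  "('o, 'a) precategory \<Rightarrow> ('p, 'b) precategory \<Rightarrow> ('o \<Rightarrow> 'p) \<Rightarrow> ('a \<Rightarrow> 'b) \<Rightarrow> bool" where
  "is_functor C D Fo Fa \<longleftrightarrow>
     (\<forall>X \<in> Obj C. Fo X \<in> Obj D \<and> Fa (Ide C X) = Ide D (Fo X)) \<and>
     (\<forall>f \<in> Arr C. Fa f \<in> Hom D (Fo (Dom C f)) (Fo (Cod C f))) \<and>
     (\<forall>f \<in> Arr C. \<forall>g \<in> Arr C. Cod C f = Dom C g \<longrightarrow> Fa (g \<cdot>\<^bsub>C\<^esub> f) = Fa g \<cdot>\<^bsub>D\<^esub> Fa f)"


section \<open>Limits and coequalisers\<close>

definition is_cone ::
  "('j, 'u) precategory \<Rightarrow> ('o, 'a) precategory \<Rightarrow> ('j \<Rightarrow> 'o) \<Rightarrow> ('u \<Rightarrow> 'a) \<Rightarrow> 'o \<Rightarrow> ('j \<Rightarrow> 'a) \<Rightarrow> bool"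
where
  "is_cone J C Fo Fa L \<pi> \<longleftrightarrow> L \<in> Obj C \<and>
     (\<forall>j \<in> Obj J. \<pi> j \<in> Hom C L (Fo j)) \<and>
     (\<forall>u \<in> Arr J. Fa u \<cdot>\<^bsub>C\<^esub> \<pi> (Dom J u) = \<pi> (Cod J u))"

definition is_limit ::
  "('j, 'u) precategory \<Rightarrow> ('o, 'a) precategory \<Rightarrow> ('j \<Rightarrow> 'o) \<Rightarrow> ('u \<Rightarrow> 'a) \<Rightarrow> 'o \<Rightarrow> ('j \<Rightarrow> 'a) \<Rightarrow> bool"
where
  "is_limit J C Fo Fa L \<pi> \<longleftrightarrow> is_cone J C Fo Fa L \<pi> \<and>
     (\<forall>M \<mu>. is_cone J C Fo Fa M \<mu> \<longrightarrow>
        (\<exists>!h. h \<in> Hom C M L \<and> (\<forall>j \<in> Obj J. \<pi> j \<cdot>\<^bsub>C\<^esub> h = \<mu> j)))"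

text \<open>Every finite category is isomorphic to one whose objects and arrows are natural numbers, so
  the index types below are no restriction.\<close>

definition finitely_complete :: "('o, 'a) precategory \<Rightarrow> bool" where
  "finitely_complete C \<longleftrightarrow>
     (\<forall>(J :: (nat, nat) precategory) Fo Fa.
        category J \<and> finite (Obj J) \<and> finite (Arr J) \<and> is_functor J C Fo Fa \<longrightarrow>
        (\<exists>L \<pi>. is_limit J C Fo Fa L \<pi>))"

definition is_coequaliser :: "('o, 'a) precategory \<Rightarrow> 'a \<Rightarrow> 'a \<Rightarrow> 'a \<Rightarrow> bool" where
  "is_coequaliser C f g q \<longleftrightarrow>
     f \<in> Arr C \<and> g \<in> Arr C \<and> q \<in> Arr C \<and> Dom C f = Dom C g \<and> Cod C f = Cod C g \<and>
     Dom C q = Cod C f \<and> q \<cdot>\<^bsub>C\<^esub> f = q \<cdot>\<^bsub>C\<^esub> g \<and>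
     (\<forall>h \<in> Arr C. Dom C h = Cod C f \<and> h \<cdot>\<^bsub>C\<^esub> f = h \<cdot>\<^bsub>C\<^esub> g \<longrightarrow>
        (\<exists>!k. k \<in> Hom C (Cod C q) (Cod C h) \<and> k \<cdot>\<^bsub>C\<^esub> q = h))"

definition is_regular_epi :: "('o, 'a) precategory \<Rightarrow> 'a \<Rightarrow> bool" where
  "is_regular_epi C q \<longleftrightarrow> (\<exists>f g. is_coequaliser C f g q)"

text \<open>\<open>is_pullback C f g p q\<close>: the square \<open>f \<cdot> p = g \<cdot> q\<close> is a pullback.\<close>

definition is_pullback :: "('o, 'a) precategory \<Rightarrow> 'a \<Rightarrow> 'a \<Rightarrow> 'a \<Rightarrow> 'a \<Rightarrow> bool" where
  "is_pullback C f g p q \<longleftrightarrow>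
     f \<in> Arr C \<and> g \<in> Arr C \<and> p \<in> Arr C \<and> q \<in> Arr C \<and>
     Cod C f = Cod C g \<and> Dom C p = Dom C q \<and> Cod C p = Dom C f \<and> Cod C q = Dom C g \<and>
     f \<cdot>\<^bsub>C\<^esub> p = g \<cdot>\<^bsub>C\<^esub> q \<and>
     (\<forall>Z. \<forall>a \<in> Hom C Z (Dom C f). \<forall>b \<in> Hom C Z (Dom C g). f \<cdot>\<^bsub>C\<^esub> a = g \<cdot>\<^bsub>C\<^esub> b \<longrightarrow>
        (\<exists>!h. h \<in> Hom C Z (Dom C p) \<and> p \<cdot>\<^bsub>C\<^esub> h = a \<and> q \<cdot>\<^bsub>C\<^esub> h = b))"

definition is_product :: "('o, 'a) precategory \<Rightarrow> 'o \<Rightarrow> 'o \<Rightarrow> 'a \<Rightarrow> 'a \<Rightarrow> bool" where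
  "is_product C X Y p q \<longleftrightarrow>
     p \<in> Hom C (Dom C p) X \<and> q \<in> Hom C (Dom C p) Y \<and>
     (\<forall>Z. \<forall>a \<in> Hom C Z X. \<forall>b \<in> Hom C Z Y.
        (\<exists>!h. h \<in> Hom C Z (Dom C p) \<and> p \<cdot>\<^bsub>C\<^esub> h = a \<and> q \<cdot>\<^bsub>C\<^esub> h = b))"

text \<open>A binary product is chosen once and for all for each pair of objects, so that ``subobject of
  \<open>X \<times> X\<close>'' is meaningful.\<close>

definition chosen_product :: "('o, 'a) precategory \<Rightarrow> 'o \<Rightarrow> 'o \<Rightarrow> 'a \<times> 'a" where
  "chosen_product C X Y = (SOME (p, q). is_product C X Y p q)"

definition pr1 :: "('o, 'a) precategory \<Rightarrow> 'o \<Rightarrow> 'o \<Rightarrow> 'a" where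
  "pr1 C X Y = fst (chosen_product C X Y)"

definition pr2 :: "('o, 'a) precategory \<Rightarrow> 'o \<Rightarrow> 'o \<Rightarrow> 'a" where
  "pr2 C X Y = snd (chosen_product C X Y)"

definition prod_obj :: "('o, 'a) precategory \<Rightarrow> 'o \<Rightarrow> 'o \<Rightarrow> 'o" where
  "prod_obj C X Y = Dom C (pr1 C X Y)"

definition tuple :: "('o, 'a) precategory \<Rightarrow> 'a \<Rightarrow> 'a \<Rightarrow> 'a" where
  "tuple C a b = (THE h. h \<in> Hom C (Dom C a) (prod_obj C (Cod C a) (Cod C b)) \<and>
     pr1 C (Cod C a) (Cod C b) \<cdot>\<^bsub>C\<^esub> h = a \<and> pr2 C (Cod C a) (Cod C b) \<cdot>\<^bsub>C\<^esub> h = b)"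

definition prod_map :: "('o, 'a) precategory \<Rightarrow> 'a \<Rightarrow> 'a \<Rightarrow> 'a" where
  "prod_map C f g = tuple C (f \<cdot>\<^bsub>C\<^esub> pr1 C (Dom C f) (Dom C g)) (g \<cdot>\<^bsub>C\<^esub> pr2 C (Dom C f) (Dom C g))"


section \<open>Subobjects and relations\<close>

text \<open>A subobject is a full equivalence class of monomorphisms with a common codomain, so equality
  of subobjects is equality of sets.\<close>

definition factors_through :: "('o, 'a) precategory \<Rightarrow> 'a \<Rightarrow> 'a \<Rightarrow> bool" where
  "factors_through C m n \<longleftrightarrow> (\<exists>h \<in> Hom C (Dom C m) (Dom C n). n \<cdot>\<^bsub>C\<^esub> h = m)"

definition subobject_of :: "('o, 'a) precategory \<Rightarrow> 'a \<Rightarrow> 'a set" where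
  "subobject_of C m = {n. is_mono C n \<and> Cod C n = Cod C m \<and>
     factors_through C n m \<and> factors_through C m n}"

definition subobjects :: "('o, 'a) precategory \<Rightarrow> 'o \<Rightarrow> 'a set set" where
  "subobjects C A = {subobject_of C m | m. is_mono C m \<and> Cod C m = A}"

definition sub_le :: "('o, 'a) precategory \<Rightarrow> 'a set \<Rightarrow> 'a set \<Rightarrow> bool" where
  "sub_le C S T \<longleftrightarrow> (\<exists>s \<in> S. \<exists>t \<in> T. factors_through C s t)"

text \<open>The regular image of an arrow, as a subobject: the monic parts of its factorisations as a
  regular epimorphism followed by a monomorphism.\<close>

definition regular_image :: "('o, 'a) precategory \<Rightarrow> 'a \<Rightarrow> 'a set" where
  "regular_image C f = {m. is_mono C m \<and> (\<exists>e. is_regular_epi C e \<and> Cod C e = Dom C m \<and> m \<cdot>\<^bsub>C\<^esub> e = f)}"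

definition relations :: "('o, 'a) precategory \<Rightarrow> 'o \<Rightarrow> 'a set set" where
  "relations C X = subobjects C (prod_obj C X X)"

definition discrete_rel :: "('o, 'a) precategory \<Rightarrow> 'o \<Rightarrow> 'a set" where
  "discrete_rel C X = subobject_of C (tuple C (Ide C X) (Ide C X))"

definition converse_rel :: "('o, 'a) precategory \<Rightarrow> 'o \<Rightarrow> 'a set \<Rightarrow> 'a set" where
  "converse_rel C X S = (\<Union>s \<in> S. subobject_of C (tuple C (pr2 C X X \<cdot>\<^bsub>C\<^esub> s) (pr1 C X X \<cdot>\<^bsub>C\<^esub> s)))"

text \<open>\<open>comp_rel C X S T\<close> is \<open>S \<circ> T\<close> (first \<open>T\<close>, then \<open>S\<close>). Here, as in \<open>converse_rel\<close>,
  \<open>image_rel\<close> and \<open>inverse_image_rel\<close> below, letting the representing monomorphisms and the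
  pullbacks range over all possibilities produces one complete equivalence class.\<close>

definition comp_rel :: "('o, 'a) precategory \<Rightarrow> 'o \<Rightarrow> 'a set \<Rightarrow> 'a set \<Rightarrow> 'a set" where
  "comp_rel C X S T = {m. \<exists>s \<in> S. \<exists>t \<in> T. \<exists>p q.
     is_pullback C (pr2 C X X \<cdot>\<^bsub>C\<^esub> t) (pr1 C X X \<cdot>\<^bsub>C\<^esub> s) p q \<and>
     m \<in> regular_image C (tuple C (pr1 C X X \<cdot>\<^bsub>C\<^esub> (t \<cdot>\<^bsub>C\<^esub> p)) (pr2 C X X \<cdot>\<^bsub>C\<^esub> (s \<cdot>\<^bsub>C\<^esub> q)))}"

definition equiv_rels :: "('o, 'a) precategory \<Rightarrow> 'o \<Rightarrow> 'a set set" where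
  "equiv_rels C X = {S \<in> relations C X.
     sub_le C (discrete_rel C X) S \<and> sub_le C (converse_rel C X S) S \<and> sub_le C (comp_rel C X S S) S}"

definition kernel_pair :: "('o, 'a) precategory \<Rightarrow> 'a \<Rightarrow> 'a set" where
  "kernel_pair C f = {r \<in> Arr C. Cod C r = prod_obj C (Dom C f) (Dom C f) \<and>
     is_pullback C f f (pr1 C (Dom C f) (Dom C f) \<cdot>\<^bsub>C\<^esub> r) (pr2 C (Dom C f) (Dom C f) \<cdot>\<^bsub>C\<^esub> r)}"

definition is_quotient :: "('o, 'a) precategory \<Rightarrow> 'o \<Rightarrow> 'a set \<Rightarrow> 'a \<Rightarrow> bool" where
  "is_quotient C X S q \<longleftrightarrow> (\<exists>s \<in> S. is_coequaliser C (pr1 C X X \<cdot>\<^bsub>C\<^esub> s) (pr2 C X X \<cdot>\<^bsub>C\<^esub> s) q)"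

definition image_rel :: "('o, 'a) precategory \<Rightarrow> 'a \<Rightarrow> 'a set \<Rightarrow> 'a set" where
  "image_rel C f S = (\<Union>s \<in> S. regular_image C (prod_map C f f \<cdot>\<^bsub>C\<^esub> s))"

definition inverse_image_rel :: "('o, 'a) precategory \<Rightarrow> 'a \<Rightarrow> 'a set \<Rightarrow> 'a set" where
  "inverse_image_rel C f S = {n. \<exists>s \<in> S. \<exists>g. is_pullback C (prod_map C f f) s n g}"


section \<open>Exact Goursat categories\<close>

definition regular_category :: "('o, 'a) precategory \<Rightarrow> bool" where
  "regular_category C \<longleftrightarrow> category C \<and> finitely_complete C \<and>
     (\<forall>f p q. is_pullback C f f p q \<longrightarrow> (\<exists>c. is_coequaliser C p q c)) \<and>
     (\<forall>f g p q. is_pullback C f g p q \<and> is_regular_epi C f \<longrightarrow> is_regular_epi C q)"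

definition exact_category :: "('o, 'a) precategory \<Rightarrow> bool" where
  "exact_category C \<longleftrightarrow> regular_category C \<and>
     (\<forall>X \<in> Obj C. \<forall>S \<in> equiv_rels C X. \<exists>f \<in> Arr C. Dom C f = X \<and> S = kernel_pair C f)"

definition exact_goursat_category :: "('o, 'a) precategory \<Rightarrow> bool" where
  "exact_goursat_category C \<longleftrightarrow> exact_category C \<and>
     (\<forall>X \<in> Obj C. \<forall>R \<in> equiv_rels C X. \<forall>S \<in> equiv_rels C X.
        comp_rel C X R (comp_rel C X S R) = comp_rel C X S (comp_rel C X R S))"


section \<open>Epireflective and Birkhoff subcategories\<close>

text \<open>A full subcategory is identified with its class of objects.\<close>

definition full_subcategory :: "('o, 'a) precategory \<Rightarrow> 'o set \<Rightarrow> ('o, 'a) precategory" where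
  "full_subcategory C L = C\<lparr>Obj := L, Arr := {f \<in> Arr C. Dom C f \<in> L \<and> Cod C f \<in> L}\<rparr>"

definition replete :: "('o, 'a) precategory \<Rightarrow> 'o set \<Rightarrow> bool" where
  "replete C L \<longleftrightarrow> L \<subseteq> Obj C \<and> (\<forall>f. is_iso C f \<and> Dom C f \<in> L \<longrightarrow> Cod C f \<in> L)"

text \<open>The functor with object part \<open>lo\<close> and arrow part \<open>la\<close> is left adjoint to the inclusion of the
  full subcategory on \<open>L\<close>, with unit \<open>\<eta>\<close>.\<close>

definition is_reflection ::
  "('o, 'a) precategory \<Rightarrow> 'o set \<Rightarrow> ('o \<Rightarrow> 'o) \<Rightarrow> ('a \<Rightarrow> 'a) \<Rightarrow> ('o \<Rightarrow> 'a) \<Rightarrow> bool" where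
  "is_reflection C L lo la \<eta> \<longleftrightarrow>
     is_functor C (full_subcategory C L) lo la \<and>
     (\<forall>A \<in> Obj C. \<eta> A \<in> Hom C A (lo A)) \<and>
     (\<forall>f \<in> Arr C. la f \<cdot>\<^bsub>C\<^esub> \<eta> (Dom C f) = \<eta> (Cod C f) \<cdot>\<^bsub>C\<^esub> f) \<and>
     (\<forall>A \<in> Obj C. \<forall>B \<in> L. \<forall>f \<in> Hom C A B. \<exists>!g. g \<in> Hom C (lo A) B \<and> g \<cdot>\<^bsub>C\<^esub> \<eta> A = f)"

definition epireflective_subcategories :: "('o, 'a) precategory \<Rightarrow> 'o set set" where
  "epireflective_subcategories C = {L. replete C L \<and>
     (\<exists>lo la \<eta>. is_reflection C L lo la \<eta> \<and> (\<forall>A \<in> Obj C. is_regular_epi C (\<eta> A)))}"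

definition birkhoff_subcategories :: "('o, 'a) precategory \<Rightarrow> 'o set set" where
  "birkhoff_subcategories C = {L \<in> epireflective_subcategories C.
     \<forall>f. is_regular_epi C f \<and> Dom C f \<in> L \<longrightarrow> Cod C f \<in> L}"


section \<open>Closure operators\<close>

text \<open>An operator takes an object together with an equivalence relation on it. It is required to be
  \<open>undefined\<close> on all other arguments, so that equality of operators is pointwise equality on
  equivalence relations.\<close>

definition effective_closure_operators ::
  "('o, 'a) precategory \<Rightarrow> ('o \<times> 'a set \<Rightarrow> 'a set) set" where
  "effective_closure_operators C = {cl \<in> extensional (Sigma (Obj C) (equiv_rels C)).
     (\<forall>X \<in> Obj C. \<forall>S \<in> equiv_rels C X. cl (X, S) \<in> equiv_rels C X) \<and>
     (\<forall>X \<in> Obj C. \<forall>S \<in> equiv_rels C X. sub_le C S (cl (X, S))) \<and>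
     (\<forall>X \<in> Obj C. \<forall>S \<in> equiv_rels C X. \<forall>T \<in> equiv_rels C X.
        sub_le C S T \<longrightarrow> sub_le C (cl (X, S)) (cl (X, T))) \<and>
     (\<forall>X \<in> Obj C. \<forall>Y \<in> Obj C. \<forall>f \<in> Hom C Y X. \<forall>S \<in> equiv_rels C X.
        sub_le C (cl (Y, inverse_image_rel C f S)) (inverse_image_rel C f (cl (X, S)))) \<and>
     (\<forall>X \<in> Obj C. \<forall>S \<in> equiv_rels C X. cl (X, cl (X, S)) = cl (X, S)) \<and>
     (\<forall>X \<in> Obj C. \<forall>Y \<in> Obj C. \<forall>f \<in> Hom C Y X. \<forall>S \<in> equiv_rels C X. is_regular_epi C f \<longrightarrow>
        cl (Y, inverse_image_rel C f S) = inverse_image_rel C f (cl (X, S)))}"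

definition birkhoff_closure_operators ::
  "('o, 'a) precategory \<Rightarrow> ('o \<times> 'a set \<Rightarrow> 'a set) set" where
  "birkhoff_closure_operators C = {cl \<in> effective_closure_operators C.
     \<forall>X \<in> Obj C. \<forall>Y \<in> Obj C. \<forall>f \<in> Hom C X Y. \<forall>S \<in> equiv_rels C X. is_regular_epi C f \<longrightarrow>
       cl (Y, image_rel C f S) = image_rel C f (cl (X, S))}"

definition separated_objects ::
  "('o, 'a) precategory \<Rightarrow> ('o \<times> 'a set \<Rightarrow> 'a set) \<Rightarrow> 'o set" where
  "separated_objects C cl = {X \<in> Obj C. cl (X, discrete_rel C X) = discrete_rel C X}"

end

theory Submission
  imports Defs
begin

text \<open>In an exact category an equivalence relation on \<open>X\<close> is the kernel pair \<open>R[q]\<close> of its quotient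
  \<open>q\<close>, and \<open>R[q] \<subseteq> R[f]\<close> holds exactly if \<open>f\<close> factors through the regular epimorphism \<open>q\<close>.
  Hence, for an epireflective subcategory \<open>L\<close> and \<open>S = R[q]\<close>, the composite of \<open>q\<close> with the unit is
  universal among the arrows from \<open>X\<close> into \<open>L\<close> whose kernel pair contains \<open>S\<close>, and its kernel pair is
  the least kernel pair of an arrow from \<open>X\<close> into \<open>L\<close> that contains \<open>S\<close>
  (\<open>reflection_kernel_pair_least\<close>). This description of the closure mentions neither the quotient nor
  the reflector, and the axioms follow from it: the first four are formal, and the one about regular
  epimorphisms \<open>f\<close> holds because an arrow whose kernel pair contains \<open>f\<^sup>-\<^sup>1(S)\<close> identifies all that \<open>f\<close>
  identifies and so factors through \<open>f\<close> (\<open>reflective_closure_inverse_image\<close>).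

  In the other direction, let a closure operator be given. Pulling back along a regular epimorphism
  \<open>q\<close> is injective on relations and takes the diagonal to \<open>R[q]\<close>, so the codomain of \<open>q\<close> is separated
  exactly if \<open>R[q]\<close> is closed. Therefore the quotient of \<open>X\<close> by the closure of \<open>S\<close> is universal
  among the arrows into separated objects whose kernel pair contains \<open>S\<close>
  (\<open>closure_is_least_separated\<close>). With \<open>S\<close> the diagonal this is a reflection into the separated objects;
  for general \<open>S\<close> it says that the operator is recovered from its separated objects.

  The Goursat identity is what makes the image \<open>f(S)\<close> of an equivalence relation transitive
  (\<open>image_equiv_rel\<close>). If \<open>L\<close> is closed under quotients and the closure of \<open>S\<close> is \<open>R[e]\<close> with \<open>e\<close> a
  regular epimorphism into \<open>L\<close>, then \<open>f(R[e]) = R[h]\<close> where \<open>h \<cdot> f\<close> factors through \<open>e\<close>; so the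
  codomain of \<open>h\<close> is a quotient of that of \<open>e\<close>, it lies in \<open>L\<close>, and \<open>f(R[e])\<close> is the closure of \<open>f(S)\<close>.
  Conversely, \<open>f(\<Delta>) = \<Delta>\<close> shows that separated objects are closed under quotients when the operator
  commutes with images.

  Relations are handled through their generalized elements: a pair \<open>a, b : Z \<rightarrow> X\<close> belongs to \<open>S\<close> if
  the induced arrow \<open>Z \<rightarrow> X \<times> X\<close> factors through a representative of \<open>S\<close>. Regular epimorphisms are
  pullback stable and orthogonal to monomorphisms, so membership in an image or a composite amounts to
  the existence of witnesses after precomposition with a regular epimorphism, a cover of \<open>Z\<close>; and
  membership itself may be checked on a cover. In this way the calculus of relations becomes a chase
  of elements.\<close>

section \<open>Arrows, products and pullbacks\<close>

lemma in_Hom_iff [simp]: "f \<in> Hom C X Y \<longleftrightarrow> f \<in> Arr C \<and> Dom C f = X \<and> Cod C f = Y"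
  by (simp add: Hom_def)

context category
begin

lemma Comp_typing [simp]:
  assumes "f \<in> Arr C" "g \<in> Arr C" "Cod C f = Dom C g"
  shows "g \<cdot>\<^bsub>C\<^esub> f \<in> Arr C" "Dom C (g \<cdot>\<^bsub>C\<^esub> f) = Dom C f" "Cod C (g \<cdot>\<^bsub>C\<^esub> f) = Cod C g"
  using Comp_in[of f "Dom C f" "Dom C g" g "Cod C g"] assms by auto

lemma Comp_assoc' [simp]:
  assumes "f \<in> Arr C" "g \<in> Arr C" "h \<in> Arr C" "Cod C f = Dom C g" "Cod C g = Dom C h"
  shows "(h \<cdot>\<^bsub>C\<^esub> g) \<cdot>\<^bsub>C\<^esub> f = h \<cdot>\<^bsub>C\<^esub> (g \<cdot>\<^bsub>C\<^esub> f)"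
  using Comp_assoc[of f "Dom C f" "Dom C g" g "Dom C h" h "Cod C h"] assms by auto

lemma Ide_typing [simp]:
  assumes "X \<in> Obj C"
  shows "Ide C X \<in> Arr C" "Dom C (Ide C X) = X" "Cod C (Ide C X) = X"
  using Ide_in[OF assms] by auto

lemma Dom_Cod_in [simp]: "f \<in> Arr C \<Longrightarrow> Dom C f \<in> Obj C" "f \<in> Arr C \<Longrightarrow> Cod C f \<in> Obj C"
  by (simp_all add: Dom_in Cod_in)

lemma Comp_Ide' [simp]:
  "f \<in> Arr C \<Longrightarrow> Dom C f = X \<Longrightarrow> f \<cdot>\<^bsub>C\<^esub> Ide C X = f"
  "f \<in> Arr C \<Longrightarrow> Cod C f = Y \<Longrightarrow> Ide C Y \<cdot>\<^bsub>C\<^esub> f = f"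
  using Comp_Ide[of f X "Cod C f"] Ide_Comp[of f "Dom C f" Y] by auto

lemma Comp_left:
  assumes "g \<cdot>\<^bsub>C\<^esub> f = k" "f \<in> Arr C" "g \<in> Arr C" "x \<in> Arr C" "Cod C f = Dom C g" "Cod C x = Dom C f"
  shows "g \<cdot>\<^bsub>C\<^esub> (f \<cdot>\<^bsub>C\<^esub> x) = k \<cdot>\<^bsub>C\<^esub> x"
  using assms by (simp flip: assms(1))

lemma Comp_extend:
  assumes "f \<cdot>\<^bsub>C\<^esub> p = g \<cdot>\<^bsub>C\<^esub> q" "f \<in> Arr C" "p \<in> Arr C" "g \<in> Arr C" "q \<in> Arr C" "h \<in> Arr C"
    "Cod C p = Dom C f" "Cod C q = Dom C g" "Cod C h = Dom C p" "Cod C h = Dom C q"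
  shows "f \<cdot>\<^bsub>C\<^esub> (p \<cdot>\<^bsub>C\<^esub> h) = g \<cdot>\<^bsub>C\<^esub> (q \<cdot>\<^bsub>C\<^esub> h)"
  using assms Comp_assoc'[of h p f] Comp_assoc'[of h q g] by simp

end

definition discrete_pair :: "(nat, nat) precategory" where
  "discrete_pair = \<lparr>Obj = {0, 1}, Arr = {0, 1}, Dom = \<lambda>u. u, Cod = \<lambda>u. u, Ide = \<lambda>x. x, Comp = \<lambda>v u. u\<rparr>"

text \<open>The arrows \<open>3 : 0 \<rightarrow> 2\<close> and \<open>4 : 1 \<rightarrow> 2\<close> are the legs; an object is its own identity,
  so one of two composable arrows is always a number below \<open>3\<close>, and it is dropped.\<close>

definition cospan :: "(nat, nat) precategory" where
  "cospan = \<lparr>Obj = {0, 1, 2}, Arr = {0, 1, 2, 3, 4},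
     Dom = \<lambda>u. if u = 3 then 0 else if u = 4 then 1 else u, Cod = \<lambda>u. if u < 3 then u else 2,
     Ide = \<lambda>x. x, Comp = \<lambda>v u. if v < 3 then u else v\<rparr>"

lemma category_discrete_pair: "category discrete_pair"
  by unfold_locales (auto simp: discrete_pair_def)

lemma category_cospan: "category cospan"
  by unfold_locales (auto simp: cospan_def split: if_splits)

lemma product_exists:
  assumes "category C" "finitely_complete C" "X \<in> Obj C" "Y \<in> Obj C"
  shows "\<exists>p q. is_product C X Y p q"
proof -
  interpret category C by fact
  let ?Fo = "\<lambda>n::nat. if n = 0 then X else Y"
  let ?Fa = "\<lambda>n::nat. Ide C (?Fo n)"
  have "is_functor discrete_pair C ?Fo ?Fa"
    using assms by (auto simp: is_functor_def discrete_pair_def)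
  moreover have "finite (Obj discrete_pair)" "finite (Arr discrete_pair)"
    by (auto simp: discrete_pair_def)
  ultimately obtain L \<pi> where lim: "is_limit discrete_pair C ?Fo ?Fa L \<pi>"
    using assms category_discrete_pair unfolding finitely_complete_def by blast
  then have cone: "L \<in> Obj C" "\<pi> 0 \<in> Hom C L X" "\<pi> 1 \<in> Hom C L Y"
    by (auto simp: is_limit_def is_cone_def discrete_pair_def)
  have "\<exists>!h. h \<in> Hom C Z L \<and> \<pi> 0 \<cdot>\<^bsub>C\<^esub> h = a \<and> \<pi> 1 \<cdot>\<^bsub>C\<^esub> h = b"
    if "a \<in> Hom C Z X" "b \<in> Hom C Z Y" for Z a b
  proof -
    have "is_cone discrete_pair C ?Fo ?Fa Z (\<lambda>n. if n = 0 then a else b)"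
      using that by (auto simp: is_cone_def discrete_pair_def)
    then have "\<exists>!h. h \<in> Hom C Z L \<and> (\<forall>j\<in>Obj discrete_pair. \<pi> j \<cdot>\<^bsub>C\<^esub> h = (if j = 0 then a else b))"
      using lim unfolding is_limit_def by blast
    then show ?thesis by (simp add: discrete_pair_def)
  qed
  then have "is_product C X Y (\<pi> 0) (\<pi> 1)"
    unfolding is_product_def using cone by (intro conjI allI ballI) simp_all
  then show ?thesis by blast
qed

lemma pullback_exists:
  assumes "category C" "finitely_complete C" "f \<in> Arr C" "g \<in> Arr C" "Cod C f = Cod C g"
  shows "\<exists>p q. is_pullback C f g p q"
proof -
  interpret category C by fact
  let ?Fo = "\<lambda>n::nat. if n = 0 then Dom C f else if n = 1 then Dom C g else Cod C f"
  let ?Fa = "\<lambda>n::nat. if n = 3 then f else if n = 4 then g else Ide C (?Fo n)"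
  have "is_functor cospan C ?Fo ?Fa"
    using assms(3-5) by (auto simp: is_functor_def cospan_def split: if_splits)
  moreover have "finite (Obj cospan)" "finite (Arr cospan)"
    by (auto simp: cospan_def)
  ultimately obtain L \<pi> where lim: "is_limit cospan C ?Fo ?Fa L \<pi>"
    using assms category_cospan unfolding finitely_complete_def by blast
  then have cone: "L \<in> Obj C" "\<pi> 0 \<in> Hom C L (Dom C f)" "\<pi> 1 \<in> Hom C L (Dom C g)"
      "f \<cdot>\<^bsub>C\<^esub> \<pi> 0 = \<pi> 2" "g \<cdot>\<^bsub>C\<^esub> \<pi> 1 = \<pi> 2"
    by (auto simp: is_limit_def is_cone_def cospan_def)
  have "\<exists>!h. h \<in> Hom C Z L \<and> \<pi> 0 \<cdot>\<^bsub>C\<^esub> h = a \<and> \<pi> 1 \<cdot>\<^bsub>C\<^esub> h = b"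
    if ab: "a \<in> Hom C Z (Dom C f)" "b \<in> Hom C Z (Dom C g)" "f \<cdot>\<^bsub>C\<^esub> a = g \<cdot>\<^bsub>C\<^esub> b" for Z a b
  proof -
    let ?\<mu> = "\<lambda>n::nat. if n = 0 then a else if n = 1 then b else f \<cdot>\<^bsub>C\<^esub> a"
    have "is_cone cospan C ?Fo ?Fa Z ?\<mu>"
      using ab assms(3-5) by (auto simp: is_cone_def cospan_def)
    then have ex: "\<exists>!h. h \<in> Hom C Z L \<and> (\<forall>j\<in>Obj cospan. \<pi> j \<cdot>\<^bsub>C\<^esub> h = ?\<mu> j)"
      using lim unfolding is_limit_def by blast
    have "\<pi> 2 \<cdot>\<^bsub>C\<^esub> h = f \<cdot>\<^bsub>C\<^esub> a" if "h \<in> Hom C Z L" "\<pi> 0 \<cdot>\<^bsub>C\<^esub> h = a" for h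
      using that cone(2) assms(3) by (simp flip: cone(4))
    then have "h \<in> Hom C Z L \<and> (\<forall>j\<in>Obj cospan. \<pi> j \<cdot>\<^bsub>C\<^esub> h = ?\<mu> j)
        \<longleftrightarrow> h \<in> Hom C Z L \<and> \<pi> 0 \<cdot>\<^bsub>C\<^esub> h = a \<and> \<pi> 1 \<cdot>\<^bsub>C\<^esub> h = b" for h
      by (auto simp: cospan_def)
    then show ?thesis using ex by simp
  qed
  then have "is_pullback C f g (\<pi> 0) (\<pi> 1)"
    using cone assms(3-5) unfolding is_pullback_def by (intro conjI allI ballI impI) simp_all
  then show ?thesis by blast
qed

locale regular_cat =
  fixes C :: "('o, 'a) precategory" (structure)
  assumes regular: "regular_category C"
begin

sublocale category C
  using regular by (simp add: regular_category_def)

lemma pullback_obtains: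
  assumes "f \<in> Arr C" "g \<in> Arr C" "Cod C f = Cod C g"
  obtains p q where "is_pullback C f g p q"
  using pullback_exists[OF category_axioms _ assms] regular
  by (auto simp: regular_category_def)

lemma pullbackD:
  assumes "is_pullback C f g p q"
  shows "f \<in> Arr C" "g \<in> Arr C" "p \<in> Arr C" "q \<in> Arr C" "Cod C f = Cod C g" "Dom C p = Dom C q"
    "Cod C p = Dom C f" "Cod C q = Dom C g" "f \<cdot> p = g \<cdot> q"
  using assms unfolding is_pullback_def by blast+

lemma pullback_lift:
  assumes "is_pullback C f g p q" "a \<in> Arr C" "b \<in> Arr C" "Dom C a = Dom C b" "Cod C a = Dom C f"
    "Cod C b = Dom C g" "f \<cdot> a = g \<cdot> b"
  obtains h where "h \<in> Arr C" "Dom C h = Dom C b" "Cod C h = Dom C p" "p \<cdot> h = a" "q \<cdot> h = b"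
proof -
  have "\<forall>Z. \<forall>a\<in>Hom C Z (Dom C f). \<forall>b\<in>Hom C Z (Dom C g). f \<cdot> a = g \<cdot> b \<longrightarrow>
      (\<exists>!h. h \<in> Hom C Z (Dom C p) \<and> p \<cdot> h = a \<and> q \<cdot> h = b)"
    using assms(1) unfolding is_pullback_def by blast
  then have "\<exists>!h. h \<in> Hom C (Dom C b) (Dom C p) \<and> p \<cdot> h = a \<and> q \<cdot> h = b"
    using assms(2-) by simp
  then obtain h where "h \<in> Hom C (Dom C b) (Dom C p)" "p \<cdot> h = a" "q \<cdot> h = b" by blast
  then show ?thesis by (intro that[of h]) simp_all
qed

lemma pullback_ext:
  assumes pb: "is_pullback C f g p q" and x: "x \<in> Arr C" "y \<in> Arr C" "Dom C x = Dom C y"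
    "Cod C x = Dom C p" "Cod C y = Dom C p" and eq: "p \<cdot> x = p \<cdot> y" "q \<cdot> x = q \<cdot> y"
  shows "x = y"
proof -
  have "\<forall>Z. \<forall>a\<in>Hom C Z (Dom C f). \<forall>b\<in>Hom C Z (Dom C g). f \<cdot> a = g \<cdot> b \<longrightarrow>
      (\<exists>!h. h \<in> Hom C Z (Dom C p) \<and> p \<cdot> h = a \<and> q \<cdot> h = b)"
    using pb unfolding is_pullback_def by blast
  moreover have "f \<cdot> (p \<cdot> y) = g \<cdot> (q \<cdot> y)"
    by (rule Comp_extend[OF pullbackD(9)[OF pb]]) (use pullbackD(1-8)[OF pb] x in simp_all)
  moreover have "p \<cdot> y \<in> Hom C (Dom C y) (Dom C f)" "q \<cdot> y \<in> Hom C (Dom C y) (Dom C g)"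
    using pullbackD(1-8)[OF pb] x by simp_all
  ultimately have "\<exists>!h. h \<in> Hom C (Dom C y) (Dom C p) \<and> p \<cdot> h = p \<cdot> y \<and> q \<cdot> h = q \<cdot> y"
    by blast
  moreover have "x \<in> Hom C (Dom C y) (Dom C p)" "y \<in> Hom C (Dom C y) (Dom C p)"
    using x by simp_all
  ultimately show ?thesis using eq by metis
qed

abbreviation prod (infixr "\<times>\<times>" 75) where "X \<times>\<times> Y \<equiv> prod_obj C X Y"

lemma chosen_is_product:
  assumes "X \<in> Obj C" "Y \<in> Obj C"
  shows "is_product C X Y (pr1 C X Y) (pr2 C X Y)"
proof -
  have "\<exists>z. case z of (p, q) \<Rightarrow> is_product C X Y p q"
    using product_exists[OF category_axioms _ assms] regular
    by (auto simp: regular_category_def)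
  then have "case chosen_product C X Y of (p, q) \<Rightarrow> is_product C X Y p q"
    unfolding chosen_product_def by (rule someI_ex)
  then show ?thesis by (simp add: pr1_def pr2_def case_prod_unfold)
qed

lemma projections [simp]:
  assumes "X \<in> Obj C" "Y \<in> Obj C"
  shows "pr1 C X Y \<in> Arr C" "Dom C (pr1 C X Y) = X \<times>\<times> Y" "Cod C (pr1 C X Y) = X"
    "pr2 C X Y \<in> Arr C" "Dom C (pr2 C X Y) = X \<times>\<times> Y" "Cod C (pr2 C X Y) = Y"
    "X \<times>\<times> Y \<in> Obj C"
  using chosen_is_product[OF assms] by (auto simp: is_product_def prod_obj_def)

lemma tuple_unique:
  assumes "a \<in> Arr C" "b \<in> Arr C" "Dom C a = Dom C b"
  shows "\<exists>!h. h \<in> Hom C (Dom C a) (Cod C a \<times>\<times> Cod C b) \<and>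
    pr1 C (Cod C a) (Cod C b) \<cdot> h = a \<and> pr2 C (Cod C a) (Cod C b) \<cdot> h = b"
  using chosen_is_product[of "Cod C a" "Cod C b"] assms
  unfolding is_product_def prod_obj_def by simp

lemma tuple [simp]:
  assumes "a \<in> Arr C" "b \<in> Arr C" "Dom C a = Dom C b" "Cod C a = X" "Cod C b = Y"
  shows "tuple C a b \<in> Arr C" "Dom C (tuple C a b) = Dom C b" "Cod C (tuple C a b) = X \<times>\<times> Y"
    "pr1 C X Y \<cdot> tuple C a b = a" "pr2 C X Y \<cdot> tuple C a b = b"
  using theI'[OF tuple_unique[OF assms(1-3)], folded tuple_def] assms by auto

lemma product_ext:
  assumes "x \<in> Arr C" "y \<in> Arr C" "Dom C x = Dom C y" "Cod C x = X \<times>\<times> Y" "Cod C y = X \<times>\<times> Y"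
    "X \<in> Obj C" "Y \<in> Obj C"
    "pr1 C X Y \<cdot> x = pr1 C X Y \<cdot> y" "pr2 C X Y \<cdot> x = pr2 C X Y \<cdot> y"
  shows "x = y"
  using tuple_unique[of "pr1 C X Y \<cdot> x" "pr2 C X Y \<cdot> x"] assms by auto

lemma tuple_comp:
  assumes "a \<in> Arr C" "b \<in> Arr C" "Dom C a = Dom C b" "h \<in> Arr C" "Cod C h = Dom C a"
  shows "tuple C a b \<cdot> h = tuple C (a \<cdot> h) (b \<cdot> h)"
  by (rule product_ext[where X = "Cod C a" and Y = "Cod C b"])
    (use assms in \<open>simp_all flip: Comp_assoc'\<close>)

lemma tuple_eta:
  assumes "x \<in> Arr C" "Cod C x = X \<times>\<times> Y" "X \<in> Obj C" "Y \<in> Obj C"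
  shows "tuple C (pr1 C X Y \<cdot> x) (pr2 C X Y \<cdot> x) = x"
  by (rule product_ext[where X = X and Y = Y]) (use assms in simp_all)

lemma prod_map [simp]:
  assumes "f \<in> Arr C" "g \<in> Arr C"
  shows "prod_map C f g \<in> Arr C" "Dom C (prod_map C f g) = Dom C f \<times>\<times> Dom C g"
    "Cod C (prod_map C f g) = Cod C f \<times>\<times> Cod C g"
  using assms by (simp_all add: prod_map_def)

lemma prod_map_tuple:
  assumes "f \<in> Arr C" "g \<in> Arr C" "a \<in> Arr C" "b \<in> Arr C" "Dom C a = Dom C b"
    "Cod C a = Dom C f" "Cod C b = Dom C g"
  shows "prod_map C f g \<cdot> tuple C a b = tuple C (f \<cdot> a) (g \<cdot> b)"
  using assms by (simp add: prod_map_def tuple_comp)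

section \<open>Regular epimorphisms and images\<close>

abbreviation regepi where "regepi \<equiv> is_regular_epi C"
abbreviation monic where "monic \<equiv> is_mono C"

lemma regepi_arr [simp]: "regepi e \<Longrightarrow> e \<in> Arr C"
  by (auto simp: is_regular_epi_def is_coequaliser_def)

lemma mono_arr [simp]: "monic e \<Longrightarrow> e \<in> Arr C"
  by (auto simp: is_mono_def)

lemma regepi_coequaliser: "is_coequaliser C f g q \<Longrightarrow> regepi q"
  by (auto simp: is_regular_epi_def)

lemma regepi_cancel:
  assumes "regepi e" "a \<in> Arr C" "b \<in> Arr C" "Dom C a = Cod C e" "Dom C b = Cod C e" "a \<cdot> e = b \<cdot> e"
  shows "a = b"
proof -
  obtain f g where "is_coequaliser C f g e"
    using assms(1) by (auto simp: is_regular_epi_def)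
  then have *: "f \<in> Arr C" "g \<in> Arr C" "e \<in> Arr C" "Dom C f = Dom C g" "Cod C f = Cod C g"
      "Dom C e = Cod C f" "e \<cdot> f = e \<cdot> g"
    and u: "\<And>h. h \<in> Arr C \<Longrightarrow> Dom C h = Cod C f \<Longrightarrow> h \<cdot> f = h \<cdot> g \<Longrightarrow>
        \<exists>!k. k \<in> Hom C (Cod C e) (Cod C h) \<and> k \<cdot> e = h"
    by (simp_all add: is_coequaliser_def)
  have "Cod C a = Cod C b"
    using assms *(3) by (metis Comp_typing(3))
  have "\<exists>!k. k \<in> Hom C (Cod C e) (Cod C (a \<cdot> e)) \<and> k \<cdot> e = a \<cdot> e"
    using assms(2,4) * by (intro u) simp_all
  moreover have "a \<in> Hom C (Cod C e) (Cod C (a \<cdot> e))" "b \<in> Hom C (Cod C e) (Cod C (a \<cdot> e))"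
    using assms(2-5) *(3) \<open>Cod C a = Cod C b\<close> by simp_all
  ultimately show ?thesis
    using assms(6) by metis
qed

lemma mono_cancel:
  assumes "monic m" "a \<in> Arr C" "b \<in> Arr C" "Cod C a = Dom C m" "Cod C b = Dom C m" "Dom C a = Dom C b"
    "m \<cdot> a = m \<cdot> b"
  shows "a = b"
  using assms(1)[unfolded is_mono_def, THEN conjunct2, rule_format, of a "Dom C a" b] assms(2-)
  by simp

text \<open>A regular epimorphism is the coequaliser of its kernel pair, here stated with generalized
  elements: the pair that it coequalises is one instance of the hypothesis.\<close>

lemma factor_through_regepi:
  assumes "regepi e" "h \<in> Arr C" "Dom C h = Dom C e"
    and "\<And>Z a b. a \<in> Hom C Z (Dom C e) \<Longrightarrow> b \<in> Hom C Z (Dom C e) \<Longrightarrow> e \<cdot> a = e \<cdot> b \<Longrightarrow> h \<cdot> a = h \<cdot> b"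
  obtains k where "k \<in> Hom C (Cod C e) (Cod C h)" "k \<cdot> e = h"
proof -
  obtain f g where *: "is_coequaliser C f g e"
    using assms(1) by (auto simp: is_regular_epi_def)
  then have "h \<cdot> f = h \<cdot> g"
    by (intro assms(4)[of f "Dom C f"]) (auto simp: is_coequaliser_def)
  then show ?thesis
    using that * assms(2,3) unfolding is_coequaliser_def by metis
qed

text \<open>Regular epimorphisms are orthogonal to monomorphisms, so membership in a subobject may be
  tested after passing to a cover.\<close>

lemma regepi_mono_lift:
  assumes "regepi e" "monic m" "a \<in> Arr C" "Dom C a = Cod C e" "factors_through C (a \<cdot> e) m"
  shows "factors_through C a m"
proof -
  obtain h where h: "h \<in> Hom C (Dom C e) (Dom C m)" "m \<cdot> h = a \<cdot> e"
    using assms by (auto simp: factors_through_def)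
  have "Cod C a = Cod C m"
    using h assms by (metis Comp_typing(3) in_Hom_iff mono_arr regepi_arr)
  obtain k where k: "k \<in> Hom C (Cod C e) (Cod C h)" "k \<cdot> e = h"
  proof (rule factor_through_regepi[OF assms(1), of h])
    show "h \<cdot> x = h \<cdot> y"
      if "x \<in> Hom C Z (Dom C e)" "y \<in> Hom C Z (Dom C e)" "e \<cdot> x = e \<cdot> y" for Z x y
    proof (rule mono_cancel[OF assms(2)])
      have "m \<cdot> (h \<cdot> x) = a \<cdot> (e \<cdot> x)" "m \<cdot> (h \<cdot> y) = a \<cdot> (e \<cdot> y)"
        by (rule Comp_extend[OF h(2)]; use h that assms in simp)+
      then show "m \<cdot> (h \<cdot> x) = m \<cdot> (h \<cdot> y)" using that by simp
    qed (use that h in auto)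
  qed (use h in auto)
  have "m \<cdot> k = a"
    by (rule regepi_cancel[OF assms(1)]) (use h k assms in auto)
  then show ?thesis using k h assms by (auto simp: factors_through_def)
qed

lemma iso_regepi:
  assumes "f \<in> Hom C X Y" "g \<in> Hom C Y X" "g \<cdot> f = Ide C X" "f \<cdot> g = Ide C Y"
  shows "regepi f"
proof -
  have ty: "f \<in> Arr C" "g \<in> Arr C" "Dom C f = X" "Cod C f = Y" "Dom C g = Y" "Cod C g = X"
    using assms(1,2) by simp_all
  then have X: "X \<in> Obj C" by auto
  have "is_coequaliser C (Ide C X) (Ide C X) f"
    unfolding is_coequaliser_def
  proof (intro conjI ballI impI)
    fix h assume "h \<in> Arr C" "Dom C h = Cod C (Ide C X) \<and> h \<cdot> Ide C X = h \<cdot> Ide C X"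
    then have h: "h \<in> Arr C" "Dom C h = X" using X by simp_all
    show "\<exists>!k. k \<in> Hom C (Cod C f) (Cod C h) \<and> k \<cdot> f = h"
    proof (rule ex1I)
      show "h \<cdot> g \<in> Hom C (Cod C f) (Cod C h) \<and> (h \<cdot> g) \<cdot> f = h"
        using h ty by (simp add: assms(3))
      fix k assume k: "k \<in> Hom C (Cod C f) (Cod C h) \<and> k \<cdot> f = h"
      then have "h \<cdot> g = k \<cdot> (f \<cdot> g)"
        using ty Comp_assoc'[of g f k] by (simp del: Comp_assoc')
      then show "k = h \<cdot> g" using k ty by (simp add: assms(4))
    qed
  qed (use X ty in simp_all)
  then show ?thesis by (auto simp: is_regular_epi_def)
qed

lemma regepi_Ide: "X \<in> Obj C \<Longrightarrow> regepi (Ide C X)"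
  by (rule iso_regepi[of _ X X "Ide C X"]) auto

lemma regepi_mono_iso:
  assumes "regepi e" "monic e"
  shows "is_iso C e"
proof -
  have "factors_through C (Ide C (Cod C e)) e"
  proof (rule regepi_mono_lift[OF assms])
    show "factors_through C (Ide C (Cod C e) \<cdot> e) e"
      unfolding factors_through_def using assms by (intro bexI[of _ "Ide C (Dom C e)"]) simp_all
  qed (use assms in simp_all)
  then obtain g where g: "g \<in> Hom C (Cod C e) (Dom C e)" "e \<cdot> g = Ide C (Cod C e)"
    using assms by (auto simp: factors_through_def)
  have "g \<cdot> e = Ide C (Dom C e)"
  proof (rule mono_cancel[OF assms(2)])
    have "e \<cdot> (g \<cdot> e) = (e \<cdot> g) \<cdot> e" using g(1) assms by simp
    also have "\<dots> = e" using assms unfolding g(2) by simp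
    finally show "e \<cdot> (g \<cdot> e) = e \<cdot> Ide C (Dom C e)" using assms by simp
  qed (use g assms in auto)
  then show ?thesis using g assms by (auto simp: is_iso_def)
qed

text \<open>Along a regular epimorphism elements can be lifted locally, by pullback stability.\<close>

lemma cover_lift:
  assumes "regepi e" "x \<in> Arr C" "Cod C x = Cod C e"
  obtains d y where "regepi d" "Cod C d = Dom C x" "y \<in> Hom C (Dom C d) (Dom C e)" "e \<cdot> y = x \<cdot> d"
proof -
  obtain p q where *: "is_pullback C e x p q"
    using pullback_obtains[of e x] assms by auto
  then have "regepi q"
    using regular assms(1) unfolding regular_category_def by blast
  then show ?thesis using * by (intro that[of q p]) (auto simp: is_pullback_def)
qed

text \<open>The regular epimorphism is the coequaliser of the kernel pair. The comparison \<open>m\<close> is monic: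
  if \<open>m \<cdot> x = m \<cdot> y\<close> then, on a common cover, \<open>x\<close> and \<open>y\<close> lift along the coequaliser to two
  elements that are identified by the given arrow, hence by the coequaliser.\<close>

lemma image_factorization:
  assumes "f \<in> Arr C"
  obtains m e where "monic m" "regepi e" "Cod C e = Dom C m" "m \<cdot> e = f"
proof -
  obtain p q where pb: "is_pullback C f f p q"
    using pullback_obtains[of f f] assms by auto
  then obtain c where co: "is_coequaliser C p q c"
    using regular unfolding regular_category_def by blast
  then have c: "regepi c" by (rule regepi_coequaliser)
  have ty: "p \<in> Arr C" "q \<in> Arr C" "Dom C p = Dom C q" "Cod C p = Dom C f" "Cod C q = Dom C f"
    "Dom C c = Dom C f" "f \<cdot> p = f \<cdot> q" "c \<cdot> p = c \<cdot> q"
    using pullbackD[OF pb] co unfolding is_coequaliser_def by simp_all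
  obtain m where m: "m \<in> Hom C (Cod C c) (Cod C f)" "m \<cdot> c = f"
  proof -
    have "\<exists>!k. k \<in> Hom C (Cod C c) (Cod C f) \<and> k \<cdot> c = f"
      using co ty assms unfolding is_coequaliser_def by simp
    then show ?thesis using that by blast
  qed
  have "x = y" if xy: "x \<in> Hom C Z (Cod C c)" "y \<in> Hom C Z (Cod C c)" "m \<cdot> x = m \<cdot> y" for Z x y
  proof -
    obtain d x' where d: "regepi d" "Cod C d = Z" "x' \<in> Hom C (Dom C d) (Dom C c)" "c \<cdot> x' = x \<cdot> d"
      by (rule cover_lift[OF c, of x]) (use xy in simp_all)
    obtain d' y' where d': "regepi d'" "Cod C d' = Dom C d" "y' \<in> Hom C (Dom C d') (Dom C c)"
        "c \<cdot> y' = (y \<cdot> d) \<cdot> d'"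
      by (rule cover_lift[OF c, of "y \<cdot> d"]) (use xy d(1,2) in simp_all)
    have tys: "m \<in> Arr C" "Dom C m = Cod C c" "c \<in> Arr C" "d \<in> Arr C" "d' \<in> Arr C"
      "x' \<in> Arr C" "Cod C x' = Dom C c" "Dom C x' = Dom C d" "y' \<in> Arr C" "Cod C y' = Dom C c"
      "Dom C y' = Dom C d'" "x \<in> Arr C" "y \<in> Arr C" "Dom C x = Z" "Dom C y = Z"
      "Cod C x = Cod C c" "Cod C y = Cod C c" "Cod C d = Z" "Cod C d' = Dom C d"
      using m(1) c d(1-3) d'(1-3) xy(1,2) by simp_all
    have "f \<cdot> (x' \<cdot> d') = m \<cdot> ((c \<cdot> x') \<cdot> d')"
      using tys by (simp add: Comp_left[OF m(2)])
    also have "\<dots> = (m \<cdot> x) \<cdot> (d \<cdot> d')"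
      unfolding d(4) using tys by simp
    also have "\<dots> = m \<cdot> (c \<cdot> y')"
      unfolding d'(4) xy(3) using tys by simp
    also have "\<dots> = f \<cdot> y'"
      using tys by (simp add: Comp_left[OF m(2)])
    finally have eq: "f \<cdot> (x' \<cdot> d') = f \<cdot> y'" .
    obtain h where h0: "h \<in> Arr C" "Dom C h = Dom C y'" "Cod C h = Dom C p"
      and h: "p \<cdot> h = x' \<cdot> d'" "q \<cdot> h = y'"
      by (rule pullback_lift[OF pb _ _ _ _ _ eq]) (use tys ty(6) in simp_all)
    have "c \<cdot> (p \<cdot> h) = c \<cdot> (q \<cdot> h)"
      by (rule Comp_extend[OF ty(8)]) (use h0 ty(1-6) c in simp_all)
    then have "(c \<cdot> x') \<cdot> d' = c \<cdot> y'"
      unfolding h using tys by simp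
    then have eq: "(x \<cdot> d) \<cdot> d' = (y \<cdot> d) \<cdot> d'"
      unfolding d(4) d'(4) .
    have "x \<cdot> d = y \<cdot> d"
      by (rule regepi_cancel[OF d'(1) _ _ _ _ eq]) (use tys in simp_all)
    then show "x = y"
      by (rule regepi_cancel[OF d(1), rotated -1]) (use tys in simp_all)
  qed
  then have "monic m" using m(1) unfolding is_mono_def by simp
  then show ?thesis using m c by (intro that[of m c]) simp_all
qed

lemma iso_comp_regepi:
  assumes "regepi e" "is_iso C i" "Dom C i = Cod C e"
  shows "regepi (i \<cdot> e)"
proof -
  obtain f g where co: "is_coequaliser C f g e"
    using assms(1) unfolding is_regular_epi_def by blast
  then have ty: "f \<in> Arr C" "g \<in> Arr C" "e \<in> Arr C" "Dom C f = Dom C g" "Cod C f = Cod C g"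
      "Dom C e = Cod C g" "e \<cdot> f = e \<cdot> g"
    by (simp_all add: is_coequaliser_def)
  obtain j where "i \<in> Arr C" "j \<in> Hom C (Cod C i) (Dom C i)"
    and j: "j \<cdot> i = Ide C (Dom C i)" "i \<cdot> j = Ide C (Cod C i)"
    using assms(2) unfolding is_iso_def by blast
  then have tj: "i \<in> Arr C" "j \<in> Arr C" "Dom C i = Cod C e" "Dom C j = Cod C i" "Cod C j = Cod C e"
    using assms(3) by simp_all
  have "is_coequaliser C f g (i \<cdot> e)"
    unfolding is_coequaliser_def
  proof (intro conjI ballI impI)
    fix h assume h: "h \<in> Arr C" "Dom C h = Cod C f \<and> h \<cdot> f = h \<cdot> g"
    have "\<exists>!k. k \<in> Hom C (Cod C e) (Cod C h) \<and> k \<cdot> e = h"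
      using co h unfolding is_coequaliser_def by blast
    then obtain k where k: "k \<in> Hom C (Cod C e) (Cod C h)" "k \<cdot> e = h" by blast
    show "\<exists>!k. k \<in> Hom C (Cod C (i \<cdot> e)) (Cod C h) \<and> k \<cdot> (i \<cdot> e) = h"
    proof (rule ex1I)
      have "(k \<cdot> j) \<cdot> (i \<cdot> e) = k \<cdot> ((j \<cdot> i) \<cdot> e)"
        using k(1) ty tj by simp
      also have "\<dots> = h"
        unfolding j using k ty tj by simp
      finally show "k \<cdot> j \<in> Hom C (Cod C (i \<cdot> e)) (Cod C h) \<and> (k \<cdot> j) \<cdot> (i \<cdot> e) = h"
        using k(1) ty tj by simp
      fix k' assume "k' \<in> Hom C (Cod C (i \<cdot> e)) (Cod C h) \<and> k' \<cdot> (i \<cdot> e) = h"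
      then have k': "k' \<in> Arr C" "Dom C k' = Cod C i" "k' \<cdot> (i \<cdot> e) = h"
        using ty(3) tj(1,3) by simp_all
      then have eq: "(k' \<cdot> i) \<cdot> e = k \<cdot> e"
        unfolding k(2) using ty(3) tj(1,3) by simp
      have "k' \<cdot> i = k"
        by (rule regepi_cancel[OF assms(1) _ _ _ _ eq]) (use k(1) k'(1,2) tj(1,3) in simp_all)
      then have "k \<cdot> j = (k' \<cdot> i) \<cdot> j" by simp
      also have "\<dots> = k'"
        using k'(1,2) tj by (simp add: j)
      finally show "k' = k \<cdot> j" ..
    qed
  qed (use ty tj in simp_all)
  then show ?thesis by (rule regepi_coequaliser)
qed

text \<open>If every subobject through which \<open>f\<close> factors is the whole codomain, then the monic part of the
  image factorization of \<open>f\<close> is invertible. This reduces closure and cancellation properties of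
  regular epimorphisms to orthogonality.\<close>

lemma regepiI:
  assumes "f \<in> Arr C"
    and "\<And>m. monic m \<Longrightarrow> Cod C m = Cod C f \<Longrightarrow> factors_through C f m \<Longrightarrow> factors_through C (Ide C (Cod C f)) m"
  shows "regepi f"
proof -
  obtain m e where me: "monic m" "regepi e" "Cod C e = Dom C m" "m \<cdot> e = f"
    using image_factorization[OF assms(1)] .
  have c: "Cod C m = Cod C f" "Dom C f = Dom C e"
    using me by auto
  have "factors_through C f m"
    unfolding factors_through_def using me c(2) by (intro bexI[of _ e]) simp_all
  then have "factors_through C (Ide C (Cod C f)) m"
    using me c by (intro assms(2)) simp_all
  then obtain g where "g \<in> Hom C (Cod C f) (Dom C m)" and g: "m \<cdot> g = Ide C (Cod C f)"
    unfolding factors_through_def using assms(1) by auto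
  then have tg: "g \<in> Arr C" "Dom C g = Cod C m" "Cod C g = Dom C m"
    using c(1) by simp_all
  have "g \<cdot> m = Ide C (Dom C m)"
  proof (rule mono_cancel[OF me(1)])
    have "m \<cdot> (g \<cdot> m) = (m \<cdot> g) \<cdot> m" using tg me(1) by simp
    also have "\<dots> = m" unfolding g using me(1) c(1) by simp
    finally show "m \<cdot> (g \<cdot> m) = m \<cdot> Ide C (Dom C m)" using me(1) by simp
  qed (use tg me(1) in simp_all)
  then have "is_iso C m"
    unfolding is_iso_def using g tg me(1) c(1) by (intro conjI bexI[of _ g]) simp_all
  then show ?thesis using iso_comp_regepi[of e m] me by simp
qed

lemma factors_through_comp:
  assumes "factors_through C g m" "g \<in> Arr C" "f \<in> Arr C" "m \<in> Arr C" "Cod C f = Dom C g"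
  shows "factors_through C (g \<cdot> f) m"
proof -
  obtain h where h: "h \<in> Hom C (Dom C g) (Dom C m)" "m \<cdot> h = g"
    using assms(1) unfolding factors_through_def by blast
  have "m \<cdot> (h \<cdot> f) = g \<cdot> f"
    by (rule Comp_left[OF h(2)]) (use h(1) assms(2-) in simp_all)
  moreover have "h \<cdot> f \<in> Hom C (Dom C (g \<cdot> f)) (Dom C m)"
    using h(1) assms(2-) by simp
  ultimately show ?thesis
    unfolding factors_through_def by blast
qed

lemma regepi_comp:
  assumes "regepi f" "regepi g" "Cod C f = Dom C g"
  shows "regepi (g \<cdot> f)"
proof (rule regepiI)
  fix m assume m: "monic m" "Cod C m = Cod C (g \<cdot> f)" "factors_through C (g \<cdot> f) m"
  have "factors_through C g m"
    by (rule regepi_mono_lift[of f]) (use assms m in simp_all)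
  then show "factors_through C (Ide C (Cod C (g \<cdot> f))) m"
    by - (rule regepi_mono_lift[of g], use assms m in simp_all)
qed (use assms in simp_all)

lemma regepi_right_factor:
  assumes "regepi (g \<cdot> f)" "f \<in> Arr C" "g \<in> Arr C" "Cod C f = Dom C g"
  shows "regepi g"
proof (rule regepiI)
  fix m assume m: "monic m" "Cod C m = Cod C g" "factors_through C g m"
  have "factors_through C (g \<cdot> f) m"
    by (rule factors_through_comp) (use assms m in simp_all)
  then show "factors_through C (Ide C (Cod C g)) m"
    by - (rule regepi_mono_lift[of "g \<cdot> f"], use assms m in simp_all)
qed fact

end

section \<open>Subobjects as sets of generalized elements\<close>

definition member :: "('o, 'a) precategory \<Rightarrow> 'a set \<Rightarrow> 'a \<Rightarrow> bool" where
  "member C S x \<longleftrightarrow> (\<exists>s \<in> S. factors_through C x s)"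

context regular_cat begin

lemma factors_throughI:
  assumes "n \<cdot> h = m" "h \<in> Arr C" "n \<in> Arr C" "Cod C h = Dom C n"
  shows "factors_through C m n"
  using assms(2-) unfolding factors_through_def assms(1)[symmetric] by (intro bexI[of _ h]) simp_all

lemma factors_throughE:
  assumes "factors_through C m n"
  obtains h where "h \<in> Arr C" "Dom C h = Dom C m" "Cod C h = Dom C n" "n \<cdot> h = m"
  using assms unfolding factors_through_def by auto

lemma factors_through_refl: "m \<in> Arr C \<Longrightarrow> factors_through C m m"
  by (rule factors_throughI[of _ "Ide C (Dom C m)"]) simp_all

lemma factors_through_trans:
  assumes "factors_through C x m" "factors_through C m n" "n \<in> Arr C"
  shows "factors_through C x n"
proof -
  obtain h where h: "h \<in> Arr C" "Dom C h = Dom C x" "Cod C h = Dom C m" "m \<cdot> h = x"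
    using assms(1) by (rule factors_throughE)
  obtain k where k: "k \<in> Arr C" "Dom C k = Dom C m" "Cod C k = Dom C n" "n \<cdot> k = m"
    using assms(2) by (rule factors_throughE)
  have "n \<cdot> (k \<cdot> h) = x"
    using Comp_left[OF k(4), of h] h k assms(3) by simp
  then show ?thesis
    by (rule factors_throughI) (use h k assms(3) in simp_all)
qed

lemma subobject_of_iff:
  assumes "monic m"
  shows "n \<in> subobject_of C m \<longleftrightarrow> monic n \<and> Cod C n = Cod C m \<and>
    (\<forall>x \<in> Arr C. Cod C x = Cod C m \<longrightarrow> factors_through C x n = factors_through C x m)"
  (is "_ \<longleftrightarrow> ?R")
proof
  assume "n \<in> subobject_of C m"
  then have "monic n" "Cod C n = Cod C m" "factors_through C n m" "factors_through C m n"
    by (simp_all add: subobject_of_def)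
  then show ?R
    using assms factors_through_trans by (meson mono_arr)
next
  assume R: ?R
  then show "n \<in> subobject_of C m"
    using assms factors_through_refl[of n] factors_through_refl[of m]
    by (simp add: subobject_of_def)
qed

text \<open>A subobject is determined by the generalized elements that factor through it. A set of
  monomorphisms defined by such a membership condition is therefore a full equivalence class.\<close>

lemma subobjectsI:
  assumes "m\<^sub>0 \<in> M"
    and M: "\<And>m. m \<in> M \<longleftrightarrow> monic m \<and> Cod C m = B \<and>
      (\<forall>x \<in> Arr C. Cod C x = B \<longrightarrow> factors_through C x m = P x)"
  shows "M \<in> subobjects C B"
    and "x \<in> Arr C \<Longrightarrow> Cod C x = B \<Longrightarrow> member C M x \<longleftrightarrow> P x"
proof -
  have m0: "monic m\<^sub>0" "Cod C m\<^sub>0 = B"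
    "\<And>x. x \<in> Arr C \<Longrightarrow> Cod C x = B \<Longrightarrow> factors_through C x m\<^sub>0 = P x"
    using assms(1) unfolding M by blast+
  have "m \<in> M \<longleftrightarrow> m \<in> subobject_of C m\<^sub>0" for m
    unfolding M subobject_of_iff[OF m0(1)] m0(2) using m0(3) by simp
  then have "M = subobject_of C m\<^sub>0" by blast
  then show "M \<in> subobjects C B"
    using m0 by (auto simp: subobjects_def)
  show "member C M x \<longleftrightarrow> P x" if "x \<in> Arr C" "Cod C x = B"
    using that M assms(1) unfolding member_def by blast
qed

lemma subobject_elements:
  assumes "S \<in> subobjects C B" "s \<in> S"
  shows "monic s" "Cod C s = B" "x \<in> Arr C \<Longrightarrow> Cod C x = B \<Longrightarrow> factors_through C x s \<longleftrightarrow> member C S x"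
proof -
  obtain m where m: "monic m" "Cod C m = B" "S = subobject_of C m"
    using assms(1) by (auto simp: subobjects_def)
  have s: "monic s" "Cod C s = B"
    "\<And>x. x \<in> Arr C \<Longrightarrow> Cod C x = B \<Longrightarrow> factors_through C x s = factors_through C x m"
    using assms(2) m by (simp_all add: subobject_of_iff)
  show "monic s" "Cod C s = B" by fact+
  show "factors_through C x s \<longleftrightarrow> member C S x" if "x \<in> Arr C" "Cod C x = B"
    using that s(3) m assms(2) unfolding member_def by (metis subobject_of_iff)
qed

lemma subobject_nonempty:
  assumes "S \<in> subobjects C B"
  obtains s where "s \<in> S"
proof -
  obtain m where m: "monic m" "S = subobject_of C m"
    using assms by (auto simp: subobjects_def)
  then have "m \<in> S" by (simp add: subobject_of_iff)
  then show ?thesis by (rule that)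
qed

lemma sub_le_iff_member:
  assumes "S \<in> subobjects C B" "T \<in> subobjects C B"
  shows "sub_le C S T \<longleftrightarrow> (\<forall>x \<in> Arr C. Cod C x = B \<longrightarrow> member C S x \<longrightarrow> member C T x)" (is "_ \<longleftrightarrow> ?R")
proof
  assume "sub_le C S T"
  then obtain s t where st: "s \<in> S" "t \<in> T" "factors_through C s t"
    by (auto simp: sub_le_def)
  show ?R
  proof (intro ballI impI)
    fix x assume x: "x \<in> Arr C" "Cod C x = B" "member C S x"
    then have "factors_through C x s"
      using subobject_elements[OF assms(1) st(1)] by blast
    then have "factors_through C x t"
      using st(3) subobject_elements(1)[OF assms(2) st(2)] factors_through_trans mono_arr by blast
    then show "member C T x" using st(2) by (auto simp: member_def)
  qed
next
  assume R: ?R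
  obtain s where s: "s \<in> S" using assms(1) by (rule subobject_nonempty)
  then have "member C T s"
    using R subobject_elements[OF assms(1) s] factors_through_refl mono_arr by blast
  then show "sub_le C S T" using s by (auto simp: sub_le_def member_def)
qed

lemma subobject_eqI:
  assumes "S \<in> subobjects C B" "T \<in> subobjects C B"
    and "\<And>x. x \<in> Arr C \<Longrightarrow> Cod C x = B \<Longrightarrow> member C S x \<longleftrightarrow> member C T x"
  shows "S = T"
proof -
  obtain m n where m: "monic m" "Cod C m = B" "S = subobject_of C m"
    and n: "monic n" "Cod C n = B" "T = subobject_of C n"
    using assms(1,2) by (auto simp: subobjects_def)
  have "m \<in> S" "n \<in> T" using m n by (simp_all add: subobject_of_iff)
  then have "factors_through C x m = factors_through C x n" if "x \<in> Arr C" "Cod C x = B" for x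
    using subobject_elements(3)[OF assms(1)] subobject_elements(3)[OF assms(2)] assms(3) that by blast
  then show ?thesis
    unfolding m(3) n(3) using m(1,2) n(1,2) by (auto simp: subobject_of_iff)
qed

subsection \<open>Regular images and pullbacks of subobjects\<close>

text \<open>This is what it means for an element to lie in the image of \<open>u\<close>: the regular epimorphism \<open>d\<close> is a
  cover of its domain on which a lift along \<open>u\<close> exists.\<close>

definition locally_through :: "'a \<Rightarrow> 'a \<Rightarrow> bool" where
  "locally_through x u \<longleftrightarrow> (\<exists>d. regepi d \<and> Cod C d = Dom C x \<and> factors_through C (x \<cdot> d) u)"

text \<open>Elements of the image lift along the regular epimorphism of the factorization on a cover, and an
  element that lifts on a cover belongs to the image by orthogonality. Two monomorphisms with the
  same elements differ by an isomorphism, which the regular epimorphism absorbs.\<close>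

lemma regular_image_iff:
  assumes "u \<in> Arr C"
  shows "m \<in> regular_image C u \<longleftrightarrow> monic m \<and> Cod C m = Cod C u \<and>
    (\<forall>x \<in> Arr C. Cod C x = Cod C u \<longrightarrow> factors_through C x m = locally_through x u)"
proof -
  have image: "Cod C m = Cod C u \<and>
      (\<forall>x \<in> Arr C. Cod C x = Cod C u \<longrightarrow> factors_through C x m = locally_through x u)"
    if me: "monic m" "regepi e" "Cod C e = Dom C m" "m \<cdot> e = u" for m e
  proof (intro conjI ballI impI iffI)
    show cod: "Cod C m = Cod C u" using me by auto
    fix x assume x: "x \<in> Arr C" "Cod C x = Cod C u"
    show "locally_through x u" if xm: "factors_through C x m"
    proof -
      obtain k where k: "k \<in> Arr C" "Dom C k = Dom C x" "Cod C k = Dom C m" "m \<cdot> k = x"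
        using xm by (rule factors_throughE)
      obtain d y where d: "regepi d" "Cod C d = Dom C k" "y \<in> Hom C (Dom C d) (Dom C e)" "e \<cdot> y = k \<cdot> d"
        by (rule cover_lift[OF me(2), of k]) (use k me in simp_all)
      have "u \<cdot> y = m \<cdot> (e \<cdot> y)"
        using Comp_left[OF me(4), of y] d(3) me(1-3) by simp
      also have "\<dots> = x \<cdot> d"
        unfolding d(4) using Comp_left[OF k(4), of d] d(1,2) k(1-3) me(1) by simp
      finally have "factors_through C (x \<cdot> d) u"
        by (rule factors_throughI) (use d(3) assms me in auto)
      then show ?thesis using d(1,2) k(2) unfolding locally_through_def by auto
    qed
    show "factors_through C x m" if xu: "locally_through x u"
    proof -
      obtain d where d: "regepi d" "Cod C d = Dom C x" "factors_through C (x \<cdot> d) u"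
        using xu unfolding locally_through_def by blast
      have "factors_through C u m"
        by (rule factors_throughI[OF me(4)]) (use me in simp_all)
      with d(3) have "factors_through C (x \<cdot> d) m"
        using me(1) by (blast intro: factors_through_trans mono_arr)
      then show ?thesis
        by (rule regepi_mono_lift[OF d(1) me(1) x(1) d(2)[symmetric]])
    qed
  qed
  show ?thesis (is "_ \<longleftrightarrow> ?R")
  proof
    assume "m \<in> regular_image C u"
    then show ?R using image unfolding regular_image_def by blast
  next
    assume R: ?R
    obtain m' e where me: "monic m'" "regepi e" "Cod C e = Dom C m'" "m' \<cdot> e = u"
      using image_factorization[OF assms] .
    note im = image[OF me]
    have "factors_through C m m'"
      using R im factors_through_refl[of m] mono_arr[of m] by simp
    then obtain i where i: "i \<in> Arr C" "Dom C i = Dom C m" "Cod C i = Dom C m'" "m' \<cdot> i = m"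
      by (rule factors_throughE)
    have "factors_through C m' m"
      using R im factors_through_refl[of m'] mono_arr[OF me(1)] by simp
    then obtain j where j: "j \<in> Arr C" "Dom C j = Dom C m'" "Cod C j = Dom C m" "m \<cdot> j = m'"
      by (rule factors_throughE)
    have mm: "monic m" "m \<in> Arr C" "m' \<in> Arr C" "Cod C m = Cod C u" using R me(1) by simp_all
    have "m \<cdot> (j \<cdot> i) = m \<cdot> Ide C (Dom C m)"
      unfolding Comp_left[OF j(4) j(1) mm(2) i(1) j(3), unfolded i(3) j(2), OF refl] using i(4) mm(2) by simp
    then have ji: "j \<cdot> i = Ide C (Dom C m)"
      by (rule mono_cancel[OF mm(1), rotated -1]) (use i(1-3) j(1-3) mm(2) in simp_all)
    have "m' \<cdot> (i \<cdot> j) = m' \<cdot> Ide C (Dom C m')"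
      unfolding Comp_left[OF i(4) i(1) mm(3) j(1) i(3), unfolded i(2) j(3), OF refl] using j(4) mm(3) by simp
    then have ij: "i \<cdot> j = Ide C (Dom C m')"
      by (rule mono_cancel[OF me(1), rotated -1]) (use i(1-3) j(1-3) mm(3) in simp_all)
    have "is_iso C j"
      unfolding is_iso_def using i(1-3) j(1-3) ij ji by (intro conjI bexI[of _ i]) simp_all
    then have "regepi (j \<cdot> e)"
      using me(2,3) j(2) by (intro iso_comp_regepi) simp_all
    moreover have "m \<cdot> (j \<cdot> e) = u"
      using Comp_left[OF j(4), of e] me(2-4) j(1-3) mm(2) by simp
    ultimately show "m \<in> regular_image C u"
      unfolding regular_image_def using mm(1) me(2,3) j(1-3) by auto
  qed
qed

lemma regular_image_nonempty:
  assumes "u \<in> Arr C"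
  obtains m where "m \<in> regular_image C u"
  using image_factorization[OF assms] unfolding regular_image_def by blast

text \<open>The pullback of a monomorphism along \<open>u\<close> represents the preimage of its set of elements.\<close>

lemma pullback_monic_iff:
  assumes "u \<in> Arr C" "monic s" "Cod C u = Cod C s"
  shows "(\<exists>g. is_pullback C u s n g) \<longleftrightarrow> monic n \<and> Cod C n = Dom C u \<and>
    (\<forall>x \<in> Arr C. Cod C x = Dom C u \<longrightarrow> factors_through C x n = factors_through C (u \<cdot> x) s)"
    (is "_ \<longleftrightarrow> ?R")
proof
  assume "\<exists>g. is_pullback C u s n g"
  then obtain g where pb: "is_pullback C u s n g" ..
  note ty = pullbackD(1-8)[OF pb]
  have "x = y" if xy: "x \<in> Hom C Z (Dom C n)" "y \<in> Hom C Z (Dom C n)" "n \<cdot> x = n \<cdot> y" for x y Z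
  proof (rule pullback_ext[OF pb])
    have "s \<cdot> (g \<cdot> x) = u \<cdot> (n \<cdot> x)" "s \<cdot> (g \<cdot> y) = u \<cdot> (n \<cdot> y)"
      by (rule Comp_extend[OF pullbackD(9)[OF pb, symmetric]]; use ty xy in simp)+
    then have "s \<cdot> (g \<cdot> x) = s \<cdot> (g \<cdot> y)" unfolding xy(3) by simp
    then show "g \<cdot> x = g \<cdot> y"
      by (rule mono_cancel[OF assms(2), rotated -1]) (use ty xy in simp_all)
  qed (use xy in simp_all)
  then have "monic n" using ty unfolding is_mono_def by blast
  moreover have "factors_through C x n = factors_through C (u \<cdot> x) s"
    if x: "x \<in> Arr C" "Cod C x = Dom C u" for x
  proof
    assume "factors_through C x n"
    then obtain h where h: "h \<in> Arr C" "Dom C h = Dom C x" "Cod C h = Dom C n" "n \<cdot> h = x"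
      by (rule factors_throughE)
    have "s \<cdot> (g \<cdot> h) = u \<cdot> (n \<cdot> h)"
      by (rule Comp_extend[OF pullbackD(9)[OF pb, symmetric]]) (use ty h in simp_all)
    then show "factors_through C (u \<cdot> x) s"
      unfolding h(4) by (rule factors_throughI) (use ty h in simp_all)
  next
    assume "factors_through C (u \<cdot> x) s"
    then obtain k where k: "k \<in> Arr C" "Dom C k = Dom C (u \<cdot> x)" "Cod C k = Dom C s" "s \<cdot> k = u \<cdot> x"
      by (rule factors_throughE)
    obtain h where "h \<in> Arr C" "Dom C h = Dom C k" "Cod C h = Dom C n" "n \<cdot> h = x" "g \<cdot> h = k"
      by (rule pullback_lift[OF pb _ _ _ _ _ k(4)[symmetric]]) (use k x ty in simp_all)
    then show "factors_through C x n"
      by (intro factors_throughI) (use ty in simp_all)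
  qed
  ultimately show ?R using ty by simp
next
  assume R: ?R
  then have mn: "monic n" and n: "n \<in> Arr C" "Cod C n = Dom C u" by simp_all
  then have "factors_through C (u \<cdot> n) s"
    using R factors_through_refl[of n] by blast
  then obtain g where g: "g \<in> Arr C" "Dom C g = Dom C (u \<cdot> n)" "Cod C g = Dom C s" "s \<cdot> g = u \<cdot> n"
    by (rule factors_throughE)
  have "is_pullback C u s n g"
    unfolding is_pullback_def
  proof (intro conjI allI ballI impI)
    fix Z a b assume ab: "a \<in> Hom C Z (Dom C u)" "b \<in> Hom C Z (Dom C s)" "u \<cdot> a = s \<cdot> b"
    have "factors_through C (u \<cdot> a) s"
      unfolding ab(3) by (rule factors_throughI[OF refl]) (use ab assms in simp_all)
    then have "factors_through C a n" using R ab(1) unfolding in_Hom_iff by blast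
    then obtain h where h: "h \<in> Arr C" "Dom C h = Dom C a" "Cod C h = Dom C n" "n \<cdot> h = a"
      by (rule factors_throughE)
    have "s \<cdot> (g \<cdot> h) = u \<cdot> (n \<cdot> h)"
      by (rule Comp_extend[OF g(4)]) (use assms g n h in simp_all)
    then have "s \<cdot> (g \<cdot> h) = s \<cdot> b" unfolding h(4) ab(3) .
    then have "g \<cdot> h = b"
      by (rule mono_cancel[OF assms(2), rotated -1]) (use assms g n h ab in simp_all)
    moreover have "h \<in> Hom C Z (Dom C n)" using h(1-3) ab(1) by simp
    moreover have "h' = h" if "h' \<in> Hom C Z (Dom C n)" "n \<cdot> h' = a" for h'
      by (rule mono_cancel[OF mn]) (use h ab(1) that in simp_all)
    ultimately show "\<exists>!h. h \<in> Hom C Z (Dom C n) \<and> n \<cdot> h = a \<and> g \<cdot> h = b"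
      using h(4) by blast
  qed (use assms n g in simp_all)
  then show "\<exists>g. is_pullback C u s n g" ..
qed

end

section \<open>Relations and their calculus of elements\<close>

definition related :: "('o, 'a) precategory \<Rightarrow> 'a set \<Rightarrow> 'a \<Rightarrow> 'a \<Rightarrow> bool" where
  "related C S a b \<longleftrightarrow> member C S (tuple C a b)"

context regular_cat begin

lemma member_iff_related:
  assumes "x \<in> Arr C" "Cod C x = X \<times>\<times> X" "X \<in> Obj C"
  shows "member C S x \<longleftrightarrow> related C S (pr1 C X X \<cdot> x) (pr2 C X X \<cdot> x)"
  using tuple_eta[OF assms(1,2,3,3)] by (simp add: related_def)

lemma sub_le_iff_related:
  assumes "S \<in> relations C X" "T \<in> relations C X" "X \<in> Obj C"
  shows "sub_le C S T \<longleftrightarrow>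
    (\<forall>Z. \<forall>a \<in> Hom C Z X. \<forall>b \<in> Hom C Z X. related C S a b \<longrightarrow> related C T a b)" (is "_ \<longleftrightarrow> ?R")
proof -
  note [simp] = sub_le_iff_member[OF assms(1,2)[unfolded relations_def]]
  show ?thesis
  proof
    assume le: "sub_le C S T"
    show ?R
    proof (intro allI ballI impI)
      fix Z a b assume ab: "a \<in> Hom C Z X" "b \<in> Hom C Z X" "related C S a b"
      then show "related C T a b" using le by (simp add: related_def)
    qed
  next
    assume R: ?R
    have "member C T x" if x: "x \<in> Arr C" "Cod C x = X \<times>\<times> X" "member C S x" for x
    proof -
      have "pr1 C X X \<cdot> x \<in> Hom C (Dom C x) X" "pr2 C X X \<cdot> x \<in> Hom C (Dom C x) X"
        using x(1,2) assms(3) by simp_all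
      then show ?thesis
        using R x(3) unfolding member_iff_related[OF x(1,2) assms(3)] by blast
    qed
    then show "sub_le C S T" by simp
  qed
qed

lemma relation_eqI:
  assumes "S \<in> relations C X" "T \<in> relations C X" "X \<in> Obj C"
    and "\<And>Z a b. a \<in> Hom C Z X \<Longrightarrow> b \<in> Hom C Z X \<Longrightarrow> related C S a b \<longleftrightarrow> related C T a b"
  shows "S = T"
proof (rule subobject_eqI[OF assms(1,2)[unfolded relations_def]])
  fix x assume x: "x \<in> Arr C" "Cod C x = X \<times>\<times> X"
  then have "pr1 C X X \<cdot> x \<in> Hom C (Dom C x) X" "pr2 C X X \<cdot> x \<in> Hom C (Dom C x) X"
    using assms(3) by simp_all
  then show "member C S x \<longleftrightarrow> member C T x"
    unfolding member_iff_related[OF x assms(3)] by (rule assms(4))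
qed

lemma sub_le_antisym:
  assumes "S \<in> relations C X" "T \<in> relations C X" "X \<in> Obj C" "sub_le C S T" "sub_le C T S"
  shows "S = T"
  by (rule relation_eqI[OF assms(1-3)])
    (use assms(4,5) sub_le_iff_related[OF assms(1-3)] sub_le_iff_related[OF assms(2,1,3)] in blast)

lemma sub_le_refl: "S \<in> relations C X \<Longrightarrow> X \<in> Obj C \<Longrightarrow> sub_le C S S"
  using sub_le_iff_related by blast

lemma sub_le_trans:
  assumes "sub_le C R S" "sub_le C S T" "R \<in> relations C X" "S \<in> relations C X" "T \<in> relations C X"
    "X \<in> Obj C"
  shows "sub_le C R T"
  using assms(1,2) unfolding sub_le_iff_related[OF assms(3,4,6)] sub_le_iff_related[OF assms(4,5,6)]
    sub_le_iff_related[OF assms(3,5,6)] by blast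

lemma related_precomp:
  assumes "S \<in> relations C X" "related C S a b" "a \<in> Hom C Z X" "b \<in> Hom C Z X" "h \<in> Hom C W Z"
  shows "related C S (a \<cdot> h) (b \<cdot> h)"
proof -
  obtain s where s: "s \<in> S" "factors_through C (tuple C a b) s"
    using assms(2) unfolding related_def member_def by blast
  have "monic s"
    using assms(1) s(1) unfolding relations_def by (rule subobject_elements)
  then have "factors_through C (tuple C a b \<cdot> h) s"
    by (intro factors_through_comp[OF s(2)]) (use assms(3-5) in simp_all)
  moreover have "tuple C a b \<cdot> h = tuple C (a \<cdot> h) (b \<cdot> h)"
    by (rule tuple_comp) (use assms(3-5) in simp_all)
  ultimately show ?thesis
    using s(1) unfolding related_def member_def by auto
qed

text \<open>Membership is local, which allows witnesses on a cover to be used for statements about \<open>Z\<close>.\<close>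

lemma related_local:
  assumes S: "S \<in> relations C X" and d: "regepi d" and ab: "a \<in> Hom C (Cod C d) X" "b \<in> Hom C (Cod C d) X"
    and rel: "related C S (a \<cdot> d) (b \<cdot> d)"
  shows "related C S a b"
proof -
  obtain s where s: "s \<in> S" "factors_through C (tuple C (a \<cdot> d) (b \<cdot> d)) s"
    using rel unfolding related_def member_def by blast
  have eq: "tuple C (a \<cdot> d) (b \<cdot> d) = tuple C a b \<cdot> d"
    by (rule tuple_comp[symmetric]) (use ab d in simp_all)
  have "factors_through C (tuple C a b) s"
    by (rule regepi_mono_lift[OF d subobject_elements(1)[OF S[unfolded relations_def] s(1)]])
      (use s(2) ab in \<open>simp_all add: eq\<close>)
  then show ?thesis
    using s(1) unfolding related_def member_def by blast
qed

subsection \<open>Discrete relations and kernel pairs\<close>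

text \<open>The arrow \<open>r\<close> is monic because elements of a pullback are determined by their projections.\<close>

lemma kernel_pair_iff:
  assumes "f \<in> Arr C" "Dom C f = X"
  shows "r \<in> kernel_pair C f \<longleftrightarrow> monic r \<and> Cod C r = X \<times>\<times> X \<and>
    (\<forall>x \<in> Arr C. Cod C x = X \<times>\<times> X \<longrightarrow>
      factors_through C x r = (f \<cdot> (pr1 C X X \<cdot> x) = f \<cdot> (pr2 C X X \<cdot> x)))" (is "_ \<longleftrightarrow> ?R")
proof
  have X: "X \<in> Obj C" using assms by auto
  let ?p = "pr1 C X X" and ?q = "pr2 C X X"
  note pq = projections[OF X X]
  {
    assume "r \<in> kernel_pair C f"
    then have r: "r \<in> Arr C" "Cod C r = X \<times>\<times> X" and pb: "is_pullback C f f (?p \<cdot> r) (?q \<cdot> r)"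
      unfolding kernel_pair_def assms(2) by blast+
    have "x = y" if xy: "x \<in> Hom C Z (Dom C r)" "y \<in> Hom C Z (Dom C r)" "r \<cdot> x = r \<cdot> y" for x y Z
    proof (rule pullback_ext[OF pb])
      show "(?p \<cdot> r) \<cdot> x = (?p \<cdot> r) \<cdot> y" "(?q \<cdot> r) \<cdot> x = (?q \<cdot> r) \<cdot> y"
        using xy r pq by simp_all
    qed (use xy r pq in simp_all)
    then have "monic r" using r unfolding is_mono_def by blast
    moreover have "factors_through C x r = (f \<cdot> (?p \<cdot> x) = f \<cdot> (?q \<cdot> x))"
      if x: "x \<in> Arr C" "Cod C x = X \<times>\<times> X" for x
    proof
      assume "factors_through C x r"
      then obtain h where h: "h \<in> Arr C" "Dom C h = Dom C x" "Cod C h = Dom C r" "r \<cdot> h = x"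
        by (rule factors_throughE)
      have "f \<cdot> ((?p \<cdot> r) \<cdot> h) = f \<cdot> ((?q \<cdot> r) \<cdot> h)"
        by (rule Comp_extend[OF pullbackD(9)[OF pb]]) (use r h(1-3) assms pq in simp_all)
      then have "f \<cdot> (?p \<cdot> (r \<cdot> h)) = f \<cdot> (?q \<cdot> (r \<cdot> h))"
        using r h(1-3) assms pq by simp
      then show "f \<cdot> (?p \<cdot> x) = f \<cdot> (?q \<cdot> x)" unfolding h(4) .
    next
      assume eq: "f \<cdot> (?p \<cdot> x) = f \<cdot> (?q \<cdot> x)"
      obtain h where h: "h \<in> Arr C" "Dom C h = Dom C (?q \<cdot> x)" "Cod C h = Dom C (?p \<cdot> r)"
        and e: "(?p \<cdot> r) \<cdot> h = ?p \<cdot> x" "(?q \<cdot> r) \<cdot> h = ?q \<cdot> x"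
        by (rule pullback_lift[OF pb _ _ _ _ _ eq]) (use x assms pq in simp_all)
      have "r \<cdot> h = x"
        by (rule product_ext[OF _ _ _ _ _ X X]) (use e h r x pq in simp_all)
      then show "factors_through C x r"
        by (rule factors_throughI) (use r h pq in simp_all)
    qed
    ultimately show ?R using r by blast
  next
    assume R: ?R
    then have mr: "monic r" and r: "r \<in> Arr C" "Cod C r = X \<times>\<times> X" by simp_all
    have "is_pullback C f f (?p \<cdot> r) (?q \<cdot> r)"
      unfolding is_pullback_def
    proof (intro conjI allI ballI impI)
      show "f \<cdot> (?p \<cdot> r) = f \<cdot> (?q \<cdot> r)"
        using R r factors_through_refl[OF r(1)] by blast
      fix Z a b assume ab: "a \<in> Hom C Z (Dom C f)" "b \<in> Hom C Z (Dom C f)" "f \<cdot> a = f \<cdot> b"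
      have t: "tuple C a b \<in> Arr C" "Cod C (tuple C a b) = X \<times>\<times> X" "Dom C (tuple C a b) = Z"
        "?p \<cdot> tuple C a b = a" "?q \<cdot> tuple C a b = b"
        using ab(1,2) assms(2) by simp_all
      have "factors_through C (tuple C a b) r \<longleftrightarrow> f \<cdot> (?p \<cdot> tuple C a b) = f \<cdot> (?q \<cdot> tuple C a b)"
        using R t(1,2) by blast
      then have "factors_through C (tuple C a b) r"
        unfolding t(4,5) using ab(3) by blast
      then obtain h where h: "h \<in> Arr C" "Dom C h = Dom C (tuple C a b)" "Cod C h = Dom C r" "r \<cdot> h = tuple C a b"
        by (rule factors_throughE)
      show "\<exists>!h. h \<in> Hom C Z (Dom C (?p \<cdot> r)) \<and> (?p \<cdot> r) \<cdot> h = a \<and> (?q \<cdot> r) \<cdot> h = b"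
      proof (intro ex1I[of _ h] conjI)
        show "h \<in> Hom C Z (Dom C (?p \<cdot> r))" using h(1-3) t(3) r pq by simp
        show "(?p \<cdot> r) \<cdot> h = a" "(?q \<cdot> r) \<cdot> h = b" using h t(4,5) r pq by simp_all
        fix k assume k: "k \<in> Hom C Z (Dom C (?p \<cdot> r)) \<and> (?p \<cdot> r) \<cdot> k = a \<and> (?q \<cdot> r) \<cdot> k = b"
        have tk: "k \<in> Arr C" "Dom C k = Z" "Cod C k = Dom C r"
          using k r pq by simp_all
        have "?p \<cdot> (r \<cdot> k) = a" "?q \<cdot> (r \<cdot> k) = b"
          using k Comp_assoc'[of k r ?p] Comp_assoc'[of k r ?q] tk r pq by metis+
        note tk = tk this
        have "r \<cdot> k = r \<cdot> h"
          unfolding h(4) by (rule product_ext[OF _ _ _ _ _ X X]) (use tk t r in simp_all)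
        then show "k = h"
          by (rule mono_cancel[OF mr, rotated -1]) (use tk(1-3) h(1-3) t(3) in simp_all)
      qed
    qed (use assms r pq in simp_all)
    then show "r \<in> kernel_pair C f"
      unfolding kernel_pair_def assms(2) using r by blast
  }
qed

lemma kernel_pair:
  assumes "f \<in> Arr C" "Dom C f = X"
  shows kernel_pair_relation: "kernel_pair C f \<in> relations C X"
    and related_kernel_pair: "\<And>Z a b. a \<in> Hom C Z X \<Longrightarrow> b \<in> Hom C Z X \<Longrightarrow>
      related C (kernel_pair C f) a b \<longleftrightarrow> f \<cdot> a = f \<cdot> b"
proof -
  have X: "X \<in> Obj C" using assms by auto
  let ?P = "\<lambda>x. f \<cdot> (pr1 C X X \<cdot> x) = f \<cdot> (pr2 C X X \<cdot> x)"
  obtain p q where pb: "is_pullback C f f p q"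
    by (rule pullback_obtains[of f f]) (use assms in simp_all)
  note ty = pullbackD(1-8)[OF pb]
  have "tuple C p q \<in> kernel_pair C f"
    unfolding kernel_pair_def using pb ty assms(2) by simp
  note M = subobjectsI[OF this kernel_pair_iff[OF assms]]
  show "kernel_pair C f \<in> relations C X"
    unfolding relations_def by (rule M(1))
  show "related C (kernel_pair C f) a b \<longleftrightarrow> f \<cdot> a = f \<cdot> b"
    if ab: "a \<in> Hom C Z X" "b \<in> Hom C Z X" for Z a b
  proof -
    have "member C (kernel_pair C f) (tuple C a b) \<longleftrightarrow> ?P (tuple C a b)"
      by (rule M(2)) (use ab in simp_all)
    then show ?thesis using ab by (simp add: related_def)
  qed
qed

text \<open>Treating the diagonal as the kernel pair of an identity gives its properties as special cases.\<close>

lemma discrete_eq_kernel_pair: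
  assumes "X \<in> Obj C"
  shows "discrete_rel C X = kernel_pair C (Ide C X)"
proof -
  let ?d = "tuple C (Ide C X) (Ide C X)"
  have pb: "is_pullback C (Ide C X) (Ide C X) (Ide C X) (Ide C X)"
    unfolding is_pullback_def
  proof (intro conjI allI ballI impI)
    fix Z a b assume ab: "a \<in> Hom C Z (Dom C (Ide C X))" "b \<in> Hom C Z (Dom C (Ide C X))"
      "Ide C X \<cdot> a = Ide C X \<cdot> b"
    then have "a \<in> Hom C Z X" "b = a" using assms by simp_all
    then show "\<exists>!h. h \<in> Hom C Z (Dom C (Ide C X)) \<and> Ide C X \<cdot> h = a \<and> Ide C X \<cdot> h = b"
      using assms by (intro ex1I[of _ a]) auto
  qed (use assms in simp_all)
  have d: "?d \<in> kernel_pair C (Ide C X)"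
    unfolding kernel_pair_def using assms pb by simp
  have iff: "r \<in> kernel_pair C (Ide C X) \<longleftrightarrow> monic r \<and> Cod C r = X \<times>\<times> X \<and>
    (\<forall>x \<in> Arr C. Cod C x = X \<times>\<times> X \<longrightarrow>
      factors_through C x r = (Ide C X \<cdot> (pr1 C X X \<cdot> x) = Ide C X \<cdot> (pr2 C X X \<cdot> x)))" for r
    by (rule kernel_pair_iff) (use assms in simp_all)
  have "monic ?d" "Cod C ?d = X \<times>\<times> X" using d unfolding iff by blast+
  have "r \<in> discrete_rel C X \<longleftrightarrow> r \<in> kernel_pair C (Ide C X)" for r
    using d unfolding discrete_rel_def subobject_of_iff[OF \<open>monic ?d\<close>] \<open>Cod C ?d = _\<close> iff by blast
  then show ?thesis by blast
qed

lemma discrete_relation: "X \<in> Obj C \<Longrightarrow> discrete_rel C X \<in> relations C X"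
  unfolding discrete_eq_kernel_pair by (rule kernel_pair_relation) simp_all

lemma related_discrete:
  "X \<in> Obj C \<Longrightarrow> a \<in> Hom C Z X \<Longrightarrow> b \<in> Hom C Z X \<Longrightarrow> related C (discrete_rel C X) a b \<longleftrightarrow> a = b"
  unfolding discrete_eq_kernel_pair using related_kernel_pair[of "Ide C X" X a Z b] by simp

subsection \<open>Inverse images, images, converses and composites\<close>

lemma relation_element:
  assumes "S \<in> relations C X" "s \<in> S"
  shows "monic s" "s \<in> Arr C" "Cod C s = X \<times>\<times> X"
  using subobject_elements(1,2)[OF assms(1)[unfolded relations_def] assms(2)] by simp_all

lemma relatedI:
  assumes "S \<in> relations C X" "s \<in> S" "X \<in> Obj C" "h \<in> Arr C" "Cod C h = Dom C s"
  shows "related C S (pr1 C X X \<cdot> (s \<cdot> h)) (pr2 C X X \<cdot> (s \<cdot> h))"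
proof -
  note s = relation_element[OF assms(1,2)]
  have "factors_through C (s \<cdot> h) s"
    by (rule factors_throughI[OF refl]) (use s assms(4,5) in simp_all)
  then have "member C S (s \<cdot> h)"
    unfolding member_def using assms(2) by blast
  then show ?thesis
    by (subst member_iff_related[symmetric]) (use s assms(3-5) in simp_all)
qed

lemma relatedE:
  assumes "S \<in> relations C X" "s \<in> S" "related C S a b" "a \<in> Hom C Z X" "b \<in> Hom C Z X"
  obtains h where "h \<in> Arr C" "Dom C h = Z" "Cod C h = Dom C s"
    "pr1 C X X \<cdot> (s \<cdot> h) = a" "pr2 C X X \<cdot> (s \<cdot> h) = b"
proof -
  note s = relation_element[OF assms(1,2)]
  have t: "tuple C a b \<in> Arr C" "Cod C (tuple C a b) = X \<times>\<times> X" "Dom C (tuple C a b) = Z"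
    "pr1 C X X \<cdot> tuple C a b = a" "pr2 C X X \<cdot> tuple C a b = b"
    using assms(4,5) by simp_all
  have "factors_through C (tuple C a b) s"
    using assms(3) subobject_elements(3)[OF assms(1)[unfolded relations_def] assms(2) t(1,2)]
    unfolding related_def by blast
  then obtain h where h: "h \<in> Arr C" "Dom C h = Dom C (tuple C a b)" "Cod C h = Dom C s" "s \<cdot> h = tuple C a b"
    by (rule factors_throughE)
  show ?thesis
    by (rule that[of h]) (use h t in simp_all)
qed

lemma prod_map_projections:
  assumes "f \<in> Hom C X Y" "z \<in> Arr C" "Cod C z = X \<times>\<times> X"
  shows "pr1 C Y Y \<cdot> (prod_map C f f \<cdot> z) = f \<cdot> (pr1 C X X \<cdot> z)"
    "pr2 C Y Y \<cdot> (prod_map C f f \<cdot> z) = f \<cdot> (pr2 C X X \<cdot> z)"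
proof -
  have f: "f \<in> Arr C" "Dom C f = X" "Cod C f = Y" using assms(1) by simp_all
  then have XY: "X \<in> Obj C" "Y \<in> Obj C" by auto
  have "prod_map C f f = tuple C (f \<cdot> pr1 C X X) (f \<cdot> pr2 C X X)"
    using f by (simp add: prod_map_def)
  then have "prod_map C f f \<cdot> z = tuple C (f \<cdot> (pr1 C X X \<cdot> z)) (f \<cdot> (pr2 C X X \<cdot> z))"
    using f XY assms(2,3) by (simp add: tuple_comp)
  then show "pr1 C Y Y \<cdot> (prod_map C f f \<cdot> z) = f \<cdot> (pr1 C X X \<cdot> z)"
    "pr2 C Y Y \<cdot> (prod_map C f f \<cdot> z) = f \<cdot> (pr2 C X X \<cdot> z)"
    using f XY assms(2,3) by simp_all
qed

lemma inverse_image: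
  assumes f: "f \<in> Hom C Y X" and S: "S \<in> relations C X"
  shows inverse_image_relation: "inverse_image_rel C f S \<in> relations C Y"
    and related_inverse_image: "\<And>Z a b. a \<in> Hom C Z Y \<Longrightarrow> b \<in> Hom C Z Y \<Longrightarrow>
      related C (inverse_image_rel C f S) a b \<longleftrightarrow> related C S (f \<cdot> a) (f \<cdot> b)"
proof -
  let ?u = "prod_map C f f"
  have u: "?u \<in> Arr C" "Dom C ?u = Y \<times>\<times> Y" "Cod C ?u = X \<times>\<times> X"
    using f by simp_all
  have pb: "(\<exists>g. is_pullback C ?u s n g) \<longleftrightarrow> monic n \<and> Cod C n = Y \<times>\<times> Y \<and>
      (\<forall>x \<in> Arr C. Cod C x = Y \<times>\<times> Y \<longrightarrow> factors_through C x n = member C S (?u \<cdot> x))"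
    if s: "s \<in> S" for s n
  proof -
    note el = subobject_elements[OF S[unfolded relations_def] s]
    have "factors_through C (?u \<cdot> x) s = member C S (?u \<cdot> x)" if "x \<in> Arr C" "Cod C x = Y \<times>\<times> Y" for x
      by (rule el(3)) (use that u in simp_all)
    then show ?thesis
      using pullback_monic_iff[OF u(1) el(1), of n] el(2) u(2,3) by simp
  qed
  obtain s where s: "s \<in> S"
    using S unfolding relations_def by (rule subobject_nonempty)
  have iff: "n \<in> inverse_image_rel C f S \<longleftrightarrow> monic n \<and> Cod C n = Y \<times>\<times> Y \<and>
      (\<forall>x \<in> Arr C. Cod C x = Y \<times>\<times> Y \<longrightarrow> factors_through C x n = member C S (?u \<cdot> x))" for n
    unfolding inverse_image_rel_def using pb s by blast
  obtain n g where "is_pullback C ?u s n g"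
    by (rule pullback_obtains[of ?u s]) (use u relation_element[OF S s] in simp_all)
  then have "n \<in> inverse_image_rel C f S"
    unfolding inverse_image_rel_def using s by blast
  note M = subobjectsI[OF this iff]
  show "inverse_image_rel C f S \<in> relations C Y"
    unfolding relations_def by (rule M(1))
  show "related C (inverse_image_rel C f S) a b \<longleftrightarrow> related C S (f \<cdot> a) (f \<cdot> b)"
    if ab: "a \<in> Hom C Z Y" "b \<in> Hom C Z Y" for Z a b
  proof -
    have "?u \<cdot> tuple C a b = tuple C (f \<cdot> a) (f \<cdot> b)"
      by (rule prod_map_tuple) (use ab f in simp_all)
    moreover have "member C (inverse_image_rel C f S) (tuple C a b) \<longleftrightarrow> member C S (?u \<cdot> tuple C a b)"
      by (rule M(2)) (use ab in simp_all)
    ultimately show ?thesis by (simp add: related_def)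
  qed
qed

text \<open>The right-hand side of the membership condition is the usual existential description of the
  image, with the witnesses \<open>a'\<close> and \<open>b'\<close> living on the cover \<open>d\<close>.\<close>

lemma image:
  assumes f: "f \<in> Hom C X Y" and S: "S \<in> relations C X"
  shows image_relation: "image_rel C f S \<in> relations C Y"
    and related_image: "\<And>Z a b. a \<in> Hom C Z Y \<Longrightarrow> b \<in> Hom C Z Y \<Longrightarrow>
      related C (image_rel C f S) a b \<longleftrightarrow> (\<exists>d a' b'. regepi d \<and> Cod C d = Z \<and>
        a' \<in> Hom C (Dom C d) X \<and> b' \<in> Hom C (Dom C d) X \<and> related C S a' b' \<and>
        f \<cdot> a' = a \<cdot> d \<and> f \<cdot> b' = b \<cdot> d)"
proof -
  let ?u = "prod_map C f f"
  have X: "X \<in> Obj C" and Y: "Y \<in> Obj C" using f by auto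
  have u: "?u \<in> Arr C" "Dom C ?u = X \<times>\<times> X" "Cod C ?u = Y \<times>\<times> Y"
    using f by simp_all
  let ?Q = "\<lambda>y. \<exists>a' b'. a' \<in> Hom C (Dom C y) X \<and> b' \<in> Hom C (Dom C y) X \<and> related C S a' b' \<and>
    f \<cdot> a' = pr1 C Y Y \<cdot> y \<and> f \<cdot> b' = pr2 C Y Y \<cdot> y"
  let ?P = "\<lambda>x. \<exists>d. regepi d \<and> Cod C d = Dom C x \<and> ?Q (x \<cdot> d)"
  have through: "factors_through C y (?u \<cdot> s) \<longleftrightarrow> ?Q y"
    if s: "s \<in> S" and y: "y \<in> Arr C" "Cod C y = Y \<times>\<times> Y" for s y
  proof
    note st = relation_element[OF S s]
    assume "factors_through C y (?u \<cdot> s)"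
    then obtain h where h: "h \<in> Arr C" "Dom C h = Dom C y" "Cod C h = Dom C (?u \<cdot> s)" "(?u \<cdot> s) \<cdot> h = y"
      by (rule factors_throughE)
    have h': "Cod C h = Dom C s" "?u \<cdot> (s \<cdot> h) = y"
      using h st u by simp_all
    have "related C S (pr1 C X X \<cdot> (s \<cdot> h)) (pr2 C X X \<cdot> (s \<cdot> h))"
      by (rule relatedI[OF S s X h(1) h'(1)])
    moreover have "f \<cdot> (pr1 C X X \<cdot> (s \<cdot> h)) = pr1 C Y Y \<cdot> y" "f \<cdot> (pr2 C X X \<cdot> (s \<cdot> h)) = pr2 C Y Y \<cdot> y"
      unfolding h'(2)[symmetric]
      by (rule prod_map_projections[OF f, symmetric]; use h(1) h'(1) st in simp)+
    moreover have "pr1 C X X \<cdot> (s \<cdot> h) \<in> Hom C (Dom C y) X" "pr2 C X X \<cdot> (s \<cdot> h) \<in> Hom C (Dom C y) X"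
      using h(1,2) h'(1) st X by simp_all
    ultimately show "?Q y" by blast
  next
    note st = relation_element[OF S s]
    assume "?Q y"
    then obtain a' b' where ab: "a' \<in> Hom C (Dom C y) X" "b' \<in> Hom C (Dom C y) X" "related C S a' b'"
      and f': "f \<cdot> a' = pr1 C Y Y \<cdot> y" "f \<cdot> b' = pr2 C Y Y \<cdot> y" by blast
    obtain h where h: "h \<in> Arr C" "Dom C h = Dom C y" "Cod C h = Dom C s"
      and e: "pr1 C X X \<cdot> (s \<cdot> h) = a'" "pr2 C X X \<cdot> (s \<cdot> h) = b'"
      using relatedE[OF S s ab(3,1,2)] .
    have sh: "s \<cdot> h \<in> Arr C" "Cod C (s \<cdot> h) = X \<times>\<times> X" "Dom C (s \<cdot> h) = Dom C y"
      using h st by simp_all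
    have "?u \<cdot> (s \<cdot> h) = y"
    proof (rule product_ext[OF _ _ _ _ _ Y Y])
      show "pr1 C Y Y \<cdot> (?u \<cdot> (s \<cdot> h)) = pr1 C Y Y \<cdot> y"
        unfolding prod_map_projections[OF f sh(1,2)] e f' ..
      show "pr2 C Y Y \<cdot> (?u \<cdot> (s \<cdot> h)) = pr2 C Y Y \<cdot> y"
        unfolding prod_map_projections[OF f sh(1,2)] e f' ..
    qed (use u y sh in simp_all)
    then have "(?u \<cdot> s) \<cdot> h = y"
      using u h st by simp
    then show "factors_through C y (?u \<cdot> s)"
      by (rule factors_throughI) (use u h st in simp_all)
  qed
  have im: "n \<in> regular_image C (?u \<cdot> s) \<longleftrightarrow> monic n \<and> Cod C n = Y \<times>\<times> Y \<and>
      (\<forall>x \<in> Arr C. Cod C x = Y \<times>\<times> Y \<longrightarrow> factors_through C x n = ?P x)" if s: "s \<in> S" for s n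
  proof -
    have us: "?u \<cdot> s \<in> Arr C" "Cod C (?u \<cdot> s) = Y \<times>\<times> Y"
      using relation_element[OF S s] u by simp_all
    have "locally_through x (?u \<cdot> s) \<longleftrightarrow> ?P x" if x: "x \<in> Arr C" "Cod C x = Y \<times>\<times> Y" for x
    proof -
      have "factors_through C (x \<cdot> d) (?u \<cdot> s) \<longleftrightarrow> ?Q (x \<cdot> d)" if "regepi d" "Cod C d = Dom C x" for d
        by (rule through[OF s]) (use that x in simp_all)
      then show ?thesis unfolding locally_through_def by blast
    qed
    then show ?thesis
      unfolding regular_image_iff[OF us(1)] us(2) by simp
  qed
  obtain s where s: "s \<in> S"
    using S unfolding relations_def by (rule subobject_nonempty)
  have iff: "n \<in> image_rel C f S \<longleftrightarrow> monic n \<and> Cod C n = Y \<times>\<times> Y \<and>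
      (\<forall>x \<in> Arr C. Cod C x = Y \<times>\<times> Y \<longrightarrow> factors_through C x n = ?P x)" for n
    using im s unfolding image_rel_def by blast
  obtain n where "n \<in> regular_image C (?u \<cdot> s)"
    by (rule regular_image_nonempty[of "?u \<cdot> s"]) (use u relation_element[OF S s] in simp_all)
  then have "n \<in> image_rel C f S"
    unfolding image_rel_def using s by blast
  note M = subobjectsI[OF this iff]
  show "image_rel C f S \<in> relations C Y"
    unfolding relations_def by (rule M(1))
  show "related C (image_rel C f S) a b \<longleftrightarrow> (\<exists>d a' b'. regepi d \<and> Cod C d = Z \<and>
        a' \<in> Hom C (Dom C d) X \<and> b' \<in> Hom C (Dom C d) X \<and> related C S a' b' \<and>
        f \<cdot> a' = a \<cdot> d \<and> f \<cdot> b' = b \<cdot> d)" (is "_ \<longleftrightarrow> ?R")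
    if ab: "a \<in> Hom C Z Y" "b \<in> Hom C Z Y" for Z a b
  proof -
    have t: "tuple C a b \<in> Arr C" "Cod C (tuple C a b) = Y \<times>\<times> Y" "Dom C (tuple C a b) = Z"
      using ab by simp_all
    have td: "Dom C (tuple C a b \<cdot> d) = Dom C d" "pr1 C Y Y \<cdot> (tuple C a b \<cdot> d) = a \<cdot> d"
      "pr2 C Y Y \<cdot> (tuple C a b \<cdot> d) = b \<cdot> d" if d: "regepi d" "Cod C d = Z" for d
    proof -
      have "tuple C a b \<cdot> d = tuple C (a \<cdot> d) (b \<cdot> d)"
        by (rule tuple_comp) (use ab d in simp_all)
      then show "Dom C (tuple C a b \<cdot> d) = Dom C d" "pr1 C Y Y \<cdot> (tuple C a b \<cdot> d) = a \<cdot> d"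
        "pr2 C Y Y \<cdot> (tuple C a b \<cdot> d) = b \<cdot> d"
        using ab d by simp_all
    qed
    have "related C (image_rel C f S) a b \<longleftrightarrow> ?P (tuple C a b)"
      unfolding related_def[of C "image_rel C f S"] by (rule M(2)) (use t in simp_all)
    also have "\<dots> \<longleftrightarrow> ?R"
      unfolding t(3) using td by (metis (no_types, lifting))
    finally show ?thesis .
  qed
qed

lemma converse:
  assumes X: "X \<in> Obj C" and S: "S \<in> relations C X"
  shows converse_relation: "converse_rel C X S \<in> relations C X"
    and related_converse: "\<And>Z a b. a \<in> Hom C Z X \<Longrightarrow> b \<in> Hom C Z X \<Longrightarrow>
      related C (converse_rel C X S) a b \<longleftrightarrow> related C S b a"
proof -
  let ?p = "pr1 C X X" and ?q = "pr2 C X X"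
  note pq = projections[OF X X]
  let ?swap = "\<lambda>s. tuple C (?q \<cdot> s) (?p \<cdot> s)"
  let ?P = "\<lambda>x. related C S (?q \<cdot> x) (?p \<cdot> x)"
  have sw: "monic (?swap s) \<and> Cod C (?swap s) = X \<times>\<times> X \<and>
      (\<forall>x \<in> Arr C. Cod C x = X \<times>\<times> X \<longrightarrow> factors_through C x (?swap s) = ?P x)" if s: "s \<in> S" for s
  proof (intro conjI ballI impI)
    note st = relation_element[OF S s]
    have ty: "?swap s \<in> Arr C" "Dom C (?swap s) = Dom C s" "Cod C (?swap s) = X \<times>\<times> X"
      using st pq by simp_all
    then show "Cod C (?swap s) = X \<times>\<times> X" by blast
    have sw_comp: "?p \<cdot> (?swap s \<cdot> h) = ?q \<cdot> (s \<cdot> h)" "?q \<cdot> (?swap s \<cdot> h) = ?p \<cdot> (s \<cdot> h)"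
      if h: "h \<in> Arr C" "Cod C h = Dom C s" for h
    proof -
      have "?swap s \<cdot> h = tuple C (?q \<cdot> (s \<cdot> h)) (?p \<cdot> (s \<cdot> h))"
        using h st pq by (simp add: tuple_comp)
      then show "?p \<cdot> (?swap s \<cdot> h) = ?q \<cdot> (s \<cdot> h)" "?q \<cdot> (?swap s \<cdot> h) = ?p \<cdot> (s \<cdot> h)"
        using h st pq by simp_all
    qed
    show "monic (?swap s)"
      unfolding is_mono_def ty(2)
    proof (intro conjI allI ballI impI)
      fix Z f g assume fg: "f \<in> Hom C Z (Dom C s)" "g \<in> Hom C Z (Dom C s)" and eq: "?swap s \<cdot> f = ?swap s \<cdot> g"
      then have ft: "f \<in> Arr C" "Cod C f = Dom C s" and gt: "g \<in> Arr C" "Cod C g = Dom C s" by simp_all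
      have "?p \<cdot> (s \<cdot> f) = ?p \<cdot> (s \<cdot> g)" "?q \<cdot> (s \<cdot> f) = ?q \<cdot> (s \<cdot> g)"
        unfolding sw_comp[OF ft, symmetric] sw_comp[OF gt, symmetric] eq by (rule refl)+
      then have "s \<cdot> f = s \<cdot> g"
        by - (rule product_ext[OF _ _ _ _ _ X X], use fg st in simp_all)
      then show "f = g"
        by (rule mono_cancel[OF st(1), rotated -1]) (use fg in simp_all)
    qed (rule ty(1))
    fix x assume x: "x \<in> Arr C" "Cod C x = X \<times>\<times> X"
    show "factors_through C x (?swap s) = ?P x"
    proof
      assume "factors_through C x (?swap s)"
      then obtain h where h: "h \<in> Arr C" "Dom C h = Dom C x" "Cod C h = Dom C (?swap s)" "?swap s \<cdot> h = x"
        by (rule factors_throughE)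
      then have "related C S (?p \<cdot> (s \<cdot> h)) (?q \<cdot> (s \<cdot> h))"
        using ty(2) by (intro relatedI[OF S s X]) simp_all
      then show "?P x"
        using sw_comp[of h] h ty(2) by simp
    next
      assume P: "?P x"
      obtain h where h: "h \<in> Arr C" "Dom C h = Dom C x" "Cod C h = Dom C s"
        and e: "?p \<cdot> (s \<cdot> h) = ?q \<cdot> x" "?q \<cdot> (s \<cdot> h) = ?p \<cdot> x"
        by (rule relatedE[OF S s P, of "Dom C x"]) (use x pq in simp_all)
      have "?swap s \<cdot> h = x"
      proof (rule product_ext[OF _ _ _ _ _ X X])
        show "?p \<cdot> (?swap s \<cdot> h) = ?p \<cdot> x" "?q \<cdot> (?swap s \<cdot> h) = ?q \<cdot> x"
          unfolding sw_comp[OF h(1,3)] e by (rule refl)+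
      qed (use h(1-3) ty x in simp_all)
      then show "factors_through C x (?swap s)"
        by (rule factors_throughI) (use h(1-3) ty in simp_all)
    qed
  qed
  obtain s where s: "s \<in> S"
    using S unfolding relations_def by (rule subobject_nonempty)
  have iff: "n \<in> converse_rel C X S \<longleftrightarrow> monic n \<and> Cod C n = X \<times>\<times> X \<and>
      (\<forall>x \<in> Arr C. Cod C x = X \<times>\<times> X \<longrightarrow> factors_through C x n = ?P x)" for n
  proof -
    have "n \<in> subobject_of C (?swap s) \<longleftrightarrow> monic n \<and> Cod C n = X \<times>\<times> X \<and>
      (\<forall>x \<in> Arr C. Cod C x = X \<times>\<times> X \<longrightarrow> factors_through C x n = ?P x)" if "s \<in> S" for s
      using sw[OF that] subobject_of_iff[of "?swap s" n] by auto
    then show ?thesis unfolding converse_rel_def using s by blast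
  qed
  have "?swap s \<in> converse_rel C X S"
    unfolding iff by (rule sw[OF s])
  note M = subobjectsI[OF this iff]
  show "converse_rel C X S \<in> relations C X"
    unfolding relations_def by (rule M(1))
  show "related C (converse_rel C X S) a b \<longleftrightarrow> related C S b a"
    if ab: "a \<in> Hom C Z X" "b \<in> Hom C Z X" for Z a b
  proof -
    have "related C (converse_rel C X S) a b \<longleftrightarrow> ?P (tuple C a b)"
      unfolding related_def[of C "converse_rel C X S"] by (rule M(2)) (use ab in simp_all)
    then show ?thesis using ab by simp
  qed
qed

text \<open>Before taking the image, an element of the pullback is a pair of elements of \<open>T\<close> and \<open>S\<close> with a
  common middle \<open>c\<close>; the image makes the existence of \<open>c\<close> local.\<close>

lemma composite:
  assumes X: "X \<in> Obj C" and S: "S \<in> relations C X" and T: "T \<in> relations C X"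
  shows comp_relation: "comp_rel C X S T \<in> relations C X"
    and related_composite: "\<And>Z a b. a \<in> Hom C Z X \<Longrightarrow> b \<in> Hom C Z X \<Longrightarrow>
      related C (comp_rel C X S T) a b \<longleftrightarrow> (\<exists>d c. regepi d \<and> Cod C d = Z \<and> c \<in> Hom C (Dom C d) X \<and>
        related C T (a \<cdot> d) c \<and> related C S c (b \<cdot> d))"
proof -
  let ?p = "pr1 C X X" and ?q = "pr2 C X X"
  note pq = projections[OF X X]
  let ?u = "\<lambda>s t p q. tuple C (?p \<cdot> (t \<cdot> p)) (?q \<cdot> (s \<cdot> q))"
  let ?Q = "\<lambda>y. \<exists>c \<in> Hom C (Dom C y) X. related C T (?p \<cdot> y) c \<and> related C S c (?q \<cdot> y)"
  let ?P = "\<lambda>x. \<exists>d. regepi d \<and> Cod C d = Dom C x \<and> ?Q (x \<cdot> d)"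
  have u: "?u s t p q \<in> Arr C" "Dom C (?u s t p q) = Dom C q" "Cod C (?u s t p q) = X \<times>\<times> X"
    "p \<in> Arr C" "q \<in> Arr C" "Cod C p = Dom C t" "Cod C q = Dom C s" "Dom C p = Dom C q"
    if "s \<in> S" "t \<in> T" "is_pullback C (?q \<cdot> t) (?p \<cdot> s) p q" for s t p q
  proof -
    note st = relation_element[OF S that(1)] relation_element[OF T that(2)]
    have *: "p \<in> Arr C" "q \<in> Arr C" "Cod C p = Dom C t" "Cod C q = Dom C s" "Dom C p = Dom C q"
      using pullbackD(3-8)[OF that(3)] st pq by simp_all
    then show "p \<in> Arr C" "q \<in> Arr C" "Cod C p = Dom C t" "Cod C q = Dom C s" "Dom C p = Dom C q"
      by blast+
    show "?u s t p q \<in> Arr C" "Dom C (?u s t p q) = Dom C q" "Cod C (?u s t p q) = X \<times>\<times> X"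
      using * st pq by simp_all
  qed
  have through: "factors_through C y (?u s t p q) \<longleftrightarrow> ?Q y"
    if s: "s \<in> S" and t: "t \<in> T" and pb: "is_pullback C (?q \<cdot> t) (?p \<cdot> s) p q"
      and y: "y \<in> Arr C" "Cod C y = X \<times>\<times> X" for s t p q y
  proof -
    note st = relation_element[OF S s] relation_element[OF T t]
    note uu = u[OF s t pb]
    have comp: "?p \<cdot> (?u s t p q \<cdot> h) = ?p \<cdot> (t \<cdot> (p \<cdot> h))" "?q \<cdot> (?u s t p q \<cdot> h) = ?q \<cdot> (s \<cdot> (q \<cdot> h))"
      if h: "h \<in> Arr C" "Cod C h = Dom C q" for h
    proof -
      have "?u s t p q \<cdot> h = tuple C (?p \<cdot> (t \<cdot> (p \<cdot> h))) (?q \<cdot> (s \<cdot> (q \<cdot> h)))"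
        using h st uu(4-8) pq by (simp add: tuple_comp)
      then show "?p \<cdot> (?u s t p q \<cdot> h) = ?p \<cdot> (t \<cdot> (p \<cdot> h))" "?q \<cdot> (?u s t p q \<cdot> h) = ?q \<cdot> (s \<cdot> (q \<cdot> h))"
        using h st uu(4-8) pq by simp_all
    qed
    show ?thesis
    proof
      assume "factors_through C y (?u s t p q)"
      then obtain h where h: "h \<in> Arr C" "Dom C h = Dom C y" "Cod C h = Dom C (?u s t p q)" "?u s t p q \<cdot> h = y"
        by (rule factors_throughE)
      then have h': "Cod C h = Dom C q" using uu(2) by simp
      have "related C T (?p \<cdot> (t \<cdot> (p \<cdot> h))) (?q \<cdot> (t \<cdot> (p \<cdot> h)))"
        by (rule relatedI[OF T t X]) (use h(1) h' uu in simp_all)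
      moreover have "related C S (?p \<cdot> (s \<cdot> (q \<cdot> h))) (?q \<cdot> (s \<cdot> (q \<cdot> h)))"
        by (rule relatedI[OF S s X]) (use h(1) h' uu in simp_all)
      moreover have "?q \<cdot> (t \<cdot> (p \<cdot> h)) = ?p \<cdot> (s \<cdot> (q \<cdot> h))"
      proof -
        have "(?q \<cdot> t) \<cdot> (p \<cdot> h) = (?p \<cdot> s) \<cdot> (q \<cdot> h)"
          by (rule Comp_extend[OF pullbackD(9)[OF pb]]) (use h(1) h' uu(4-8) st pq in simp_all)
        then show ?thesis using h(1) h' uu(4-8) st pq by simp
      qed
      moreover have "?q \<cdot> (t \<cdot> (p \<cdot> h)) \<in> Hom C (Dom C y) X"
        using h(1,2) h' uu(4-8) st pq by simp
      ultimately show "?Q y"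
        using comp[OF h(1) h'] unfolding h(4) by auto
    next
      assume "?Q y"
      then obtain c where c: "c \<in> Hom C (Dom C y) X" and rel: "related C T (?p \<cdot> y) c" "related C S c (?q \<cdot> y)"
        by blast
      have y': "?p \<cdot> y \<in> Hom C (Dom C y) X" "?q \<cdot> y \<in> Hom C (Dom C y) X"
        using y pq by simp_all
      obtain k where k: "k \<in> Arr C" "Dom C k = Dom C y" "Cod C k = Dom C t"
        and ke: "?p \<cdot> (t \<cdot> k) = ?p \<cdot> y" "?q \<cdot> (t \<cdot> k) = c"
        using relatedE[OF T t rel(1) y'(1) c] .
      obtain l where l: "l \<in> Arr C" "Dom C l = Dom C y" "Cod C l = Dom C s"
        and le: "?p \<cdot> (s \<cdot> l) = c" "?q \<cdot> (s \<cdot> l) = ?q \<cdot> y"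
        using relatedE[OF S s rel(2) c y'(2)] .
      have "(?q \<cdot> t) \<cdot> k = ?q \<cdot> (t \<cdot> k)" "(?p \<cdot> s) \<cdot> l = ?p \<cdot> (s \<cdot> l)"
        using k l st pq by simp_all
      then have eq: "(?q \<cdot> t) \<cdot> k = (?p \<cdot> s) \<cdot> l"
        unfolding ke le by simp
      obtain h where h: "h \<in> Arr C" "Dom C h = Dom C l" "Cod C h = Dom C p"
        and he: "p \<cdot> h = k" "q \<cdot> h = l"
        by (rule pullback_lift[OF pb _ _ _ _ _ eq]) (use k l st pq in simp_all)
      have h': "Cod C h = Dom C q" using h(3) uu(8) by simp
      have "?u s t p q \<cdot> h = y"
      proof (rule product_ext[OF _ _ _ _ _ X X])
        show "?p \<cdot> (?u s t p q \<cdot> h) = ?p \<cdot> y" "?q \<cdot> (?u s t p q \<cdot> h) = ?q \<cdot> y"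
          unfolding comp[OF h(1) h'] he ke le by (rule refl)+
      qed (use h(1,2) h' l(2) uu(1-3) y in simp_all)
      then show "factors_through C y (?u s t p q)"
        by (rule factors_throughI) (use h(1) h' uu(1-3) in simp_all)
    qed
  qed
  have im: "n \<in> regular_image C (?u s t p q) \<longleftrightarrow> monic n \<and> Cod C n = X \<times>\<times> X \<and>
      (\<forall>x \<in> Arr C. Cod C x = X \<times>\<times> X \<longrightarrow> factors_through C x n = ?P x)"
    if st: "s \<in> S" "t \<in> T" "is_pullback C (?q \<cdot> t) (?p \<cdot> s) p q" for s t p q n
  proof -
    have "locally_through x (?u s t p q) \<longleftrightarrow> ?P x" if x: "x \<in> Arr C" "Cod C x = X \<times>\<times> X" for x
    proof -
      have "factors_through C (x \<cdot> d) (?u s t p q) \<longleftrightarrow> ?Q (x \<cdot> d)" if "regepi d" "Cod C d = Dom C x" for d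
        by (rule through[OF st]) (use that x in simp_all)
      then show ?thesis unfolding locally_through_def by blast
    qed
    then show ?thesis
      unfolding regular_image_iff[OF u(1)[OF st]] u(3)[OF st] by simp
  qed
  obtain s where s: "s \<in> S"
    using S unfolding relations_def by (rule subobject_nonempty)
  obtain t where t: "t \<in> T"
    using T unfolding relations_def by (rule subobject_nonempty)
  obtain p q where pb: "is_pullback C (?q \<cdot> t) (?p \<cdot> s) p q"
    by (rule pullback_obtains[of "?q \<cdot> t" "?p \<cdot> s"])
      (use relation_element[OF S s] relation_element[OF T t] pq in simp_all)
  have iff: "n \<in> comp_rel C X S T \<longleftrightarrow> monic n \<and> Cod C n = X \<times>\<times> X \<and>
      (\<forall>x \<in> Arr C. Cod C x = X \<times>\<times> X \<longrightarrow> factors_through C x n = ?P x)" (is "_ \<longleftrightarrow> ?R n") for n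
  proof
    assume "n \<in> comp_rel C X S T"
    then obtain s t p q where st: "s \<in> S" "t \<in> T" "is_pullback C (?q \<cdot> t) (?p \<cdot> s) p q"
      and n: "n \<in> regular_image C (?u s t p q)"
      unfolding comp_rel_def by blast
    show "?R n" using n unfolding im[OF st] .
  next
    assume "?R n"
    then have "n \<in> regular_image C (?u s t p q)" unfolding im[OF s t pb] .
    then show "n \<in> comp_rel C X S T" unfolding comp_rel_def using s t pb by blast
  qed
  obtain n where "n \<in> regular_image C (?u s t p q)"
    by (rule regular_image_nonempty[OF u(1)[OF s t pb]])
  then have "n \<in> comp_rel C X S T"
    unfolding comp_rel_def using s t pb by blast
  note M = subobjectsI[OF this iff]
  show "comp_rel C X S T \<in> relations C X"
    unfolding relations_def by (rule M(1))
  show "related C (comp_rel C X S T) a b \<longleftrightarrow> (\<exists>d c. regepi d \<and> Cod C d = Z \<and> c \<in> Hom C (Dom C d) X \<and>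
        related C T (a \<cdot> d) c \<and> related C S c (b \<cdot> d))" (is "_ \<longleftrightarrow> ?R")
    if ab: "a \<in> Hom C Z X" "b \<in> Hom C Z X" for Z a b
  proof -
    have td: "Dom C (tuple C a b \<cdot> d) = Dom C d" "?p \<cdot> (tuple C a b \<cdot> d) = a \<cdot> d"
      "?q \<cdot> (tuple C a b \<cdot> d) = b \<cdot> d" if d: "regepi d" "Cod C d = Z" for d
    proof -
      have "tuple C a b \<cdot> d = tuple C (a \<cdot> d) (b \<cdot> d)"
        by (rule tuple_comp) (use ab d in simp_all)
      then show "Dom C (tuple C a b \<cdot> d) = Dom C d" "?p \<cdot> (tuple C a b \<cdot> d) = a \<cdot> d"
        "?q \<cdot> (tuple C a b \<cdot> d) = b \<cdot> d"
        using ab d by simp_all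
    qed
    have t: "Dom C (tuple C a b) = Z" using ab by simp
    have "related C (comp_rel C X S T) a b \<longleftrightarrow> ?P (tuple C a b)"
      unfolding related_def[of C "comp_rel C X S T"] by (rule M(2)) (use ab in simp_all)
    also have "\<dots> \<longleftrightarrow> ?R"
      unfolding t using td by (metis (no_types, lifting))
    finally show ?thesis .
  qed
qed

section \<open>Equivalence relations\<close>

text \<open>In terms of elements no cover is left in the transitivity condition, because membership is a
  local condition.\<close>

lemma equiv_rels_iff:
  assumes X: "X \<in> Obj C"
  shows "S \<in> equiv_rels C X \<longleftrightarrow> S \<in> relations C X \<and>
    (\<forall>Z. \<forall>a \<in> Hom C Z X. related C S a a) \<and>
    (\<forall>Z. \<forall>a \<in> Hom C Z X. \<forall>b \<in> Hom C Z X. related C S a b \<longrightarrow> related C S b a) \<and>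
    (\<forall>Z. \<forall>a \<in> Hom C Z X. \<forall>b \<in> Hom C Z X. \<forall>c \<in> Hom C Z X.
      related C S a b \<longrightarrow> related C S b c \<longrightarrow> related C S a c)" (is "_ \<longleftrightarrow> _ \<and> ?r \<and> ?s \<and> ?t")
proof (cases "S \<in> relations C X")
  case S: True
  have "sub_le C (discrete_rel C X) S \<longleftrightarrow> ?r"
    unfolding sub_le_iff_related[OF discrete_relation[OF X] S X]
    using related_discrete[OF X] by blast
  moreover have "sub_le C (converse_rel C X S) S \<longleftrightarrow> ?s"
    unfolding sub_le_iff_related[OF converse_relation[OF X S] S X]
    using related_converse[OF X S] by blast
  moreover have "sub_le C (comp_rel C X S S) S \<longleftrightarrow> ?t"
    unfolding sub_le_iff_related[OF comp_relation[OF X S S] S X]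
  proof (intro iffI allI ballI impI)
    fix Z a b c
    assume le: "\<forall>Z. \<forall>a\<in>Hom C Z X. \<forall>b\<in>Hom C Z X. related C (comp_rel C X S S) a b \<longrightarrow> related C S a b"
      and abc: "a \<in> Hom C Z X" "b \<in> Hom C Z X" "c \<in> Hom C Z X"
      and rel: "related C S a b" "related C S b c"
    have Z: "Z \<in> Obj C" using abc by auto
    have "a \<cdot> Ide C Z = a" "c \<cdot> Ide C Z = c" using abc by simp_all
    then have "related C (comp_rel C X S S) a c"
      unfolding related_composite[OF X S S abc(1,3)]
      using rel abc(2) regepi_Ide[OF Z] Z by (intro exI[of _ "Ide C Z"] exI[of _ b]) simp
    then show "related C S a c" using le abc by blast
  next
    fix Z a b
    assume t: ?t and ab: "a \<in> Hom C Z X" "b \<in> Hom C Z X" and rel: "related C (comp_rel C X S S) a b"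
    obtain d c where d: "regepi d" "Cod C d = Z" and c: "c \<in> Hom C (Dom C d) X"
      and r: "related C S (a \<cdot> d) c" "related C S c (b \<cdot> d)"
      using rel unfolding related_composite[OF X S S ab] by blast
    have "a \<cdot> d \<in> Hom C (Dom C d) X" "b \<cdot> d \<in> Hom C (Dom C d) X" using ab d by simp_all
    then have "related C S (a \<cdot> d) (b \<cdot> d)" using t c r by blast
    then show "related C S a b"
      by (rule related_local[OF S d(1), rotated -1]) (use ab d(2) in simp_all)
  qed
  ultimately show ?thesis unfolding equiv_rels_def using S by blast
qed (simp add: equiv_rels_def)

lemma kernel_pair_equiv_rel:
  assumes "f \<in> Arr C" "Dom C f = X"
  shows "kernel_pair C f \<in> equiv_rels C X"
proof -
  have X: "X \<in> Obj C" using assms by auto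
  note rel = related_kernel_pair[OF assms]
  show ?thesis
    unfolding equiv_rels_iff[OF X] using kernel_pair_relation[OF assms]
  proof (intro conjI allI ballI impI)
    fix Z a b c assume "a \<in> Hom C Z X" "b \<in> Hom C Z X" "c \<in> Hom C Z X"
      and "related C (kernel_pair C f) a b" "related C (kernel_pair C f) b c"
    then show "related C (kernel_pair C f) a c" using rel[of a Z] rel[of b Z] by metis
  qed (use rel in \<open>simp_all del: in_Hom_iff\<close>)
qed

lemma equiv_rel_relation: "S \<in> equiv_rels C X \<Longrightarrow> S \<in> relations C X"
  by (simp add: equiv_rels_def)

lemma discrete_equiv_rel: "X \<in> Obj C \<Longrightarrow> discrete_rel C X \<in> equiv_rels C X"
  unfolding discrete_eq_kernel_pair by (rule kernel_pair_equiv_rel) simp_all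

lemma discrete_le_equiv_rel: "S \<in> equiv_rels C X \<Longrightarrow> sub_le C (discrete_rel C X) S"
  by (simp add: equiv_rels_def)

lemma kernel_pair_monic_comp:
  assumes "monic m" "e \<in> Arr C" "Cod C e = Dom C m"
  shows "kernel_pair C (m \<cdot> e) = kernel_pair C e"
proof (rule relation_eqI[of _ "Dom C e"])
  show "kernel_pair C (m \<cdot> e) \<in> relations C (Dom C e)" "kernel_pair C e \<in> relations C (Dom C e)"
    using assms by (simp_all add: kernel_pair_relation)
  show "related C (kernel_pair C (m \<cdot> e)) a b = related C (kernel_pair C e) a b"
    if ab: "a \<in> Hom C Z (Dom C e)" "b \<in> Hom C Z (Dom C e)" for Z a b
  proof -
    have "(m \<cdot> e) \<cdot> a = (m \<cdot> e) \<cdot> b \<longleftrightarrow> m \<cdot> (e \<cdot> a) = m \<cdot> (e \<cdot> b)"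
      using ab assms by simp
    also have "\<dots> \<longleftrightarrow> e \<cdot> a = e \<cdot> b"
      using mono_cancel[OF assms(1), of "e \<cdot> a" "e \<cdot> b"] ab assms by auto
    finally show ?thesis
      using related_kernel_pair[of "m \<cdot> e" "Dom C e", OF _ _ ab] related_kernel_pair[of e "Dom C e", OF _ _ ab] assms
      by simp
  qed
qed (use assms in simp)

text \<open>Containment of kernel pairs is the order of quotients: \<open>q\<close> is the coequaliser of \<open>R[q]\<close>.\<close>

lemma sub_le_kernel_pairD:
  assumes "regepi q" "f \<in> Arr C" "Dom C f = Dom C q" "sub_le C (kernel_pair C q) (kernel_pair C f)"
  obtains k where "k \<in> Arr C" "Dom C k = Cod C q" "Cod C k = Cod C f" "k \<cdot> q = f"
proof -
  have q: "q \<in> Arr C" using assms(1) by simp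
  have "f \<cdot> a = f \<cdot> b"
    if ab: "a \<in> Hom C Z (Dom C q)" "b \<in> Hom C Z (Dom C q)" and eq: "q \<cdot> a = q \<cdot> b" for Z a b
    using assms(4) ab eq related_kernel_pair[OF q refl ab] related_kernel_pair[OF assms(2,3) ab]
      sub_le_iff_related[OF kernel_pair_relation[OF q refl] kernel_pair_relation[OF assms(2,3)]] q
    by (blast intro: Dom_Cod_in)
  then obtain k where "k \<in> Hom C (Cod C q) (Cod C f)" "k \<cdot> q = f"
    using factor_through_regepi[OF assms(1,2,3)] by blast
  then show ?thesis by (intro that[of k]) simp_all
qed

lemma kernel_pair_le_comp:
  assumes "q \<in> Arr C" "k \<in> Arr C" "Dom C k = Cod C q"
  shows "sub_le C (kernel_pair C q) (kernel_pair C (k \<cdot> q))"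
proof -
  let ?X = "Dom C q"
  have kq: "k \<cdot> q \<in> Arr C" "Dom C (k \<cdot> q) = ?X" and X: "?X \<in> Obj C"
    using assms by simp_all
  show ?thesis
    unfolding sub_le_iff_related[OF kernel_pair_relation[OF assms(1) refl] kernel_pair_relation[OF kq] X]
  proof (intro allI ballI impI)
    fix Z a b assume ab: "a \<in> Hom C Z ?X" "b \<in> Hom C Z ?X" and "related C (kernel_pair C q) a b"
    then have "q \<cdot> a = q \<cdot> b" using related_kernel_pair[OF assms(1) refl ab] by blast
    then show "related C (kernel_pair C (k \<cdot> q)) a b"
      unfolding related_kernel_pair[OF kq ab] using ab assms by simp
  qed
qed

lemma inverse_image_kernel_pair:
  assumes "f \<in> Hom C Y X" "g \<in> Arr C" "Dom C g = X"
  shows "inverse_image_rel C f (kernel_pair C g) = kernel_pair C (g \<cdot> f)"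
proof (rule relation_eqI[of _ Y])
  have g: "kernel_pair C g \<in> relations C X" by (rule kernel_pair_relation[OF assms(2,3)])
  have gf: "g \<cdot> f \<in> Arr C" "Dom C (g \<cdot> f) = Y" using assms by simp_all
  show "inverse_image_rel C f (kernel_pair C g) \<in> relations C Y" "kernel_pair C (g \<cdot> f) \<in> relations C Y"
    by (rule inverse_image_relation[OF assms(1) g], rule kernel_pair_relation[OF gf])
  show "related C (inverse_image_rel C f (kernel_pair C g)) a b = related C (kernel_pair C (g \<cdot> f)) a b"
    if ab: "a \<in> Hom C Z Y" "b \<in> Hom C Z Y" for Z a b
  proof -
    have "f \<cdot> a \<in> Hom C Z X" "f \<cdot> b \<in> Hom C Z X" using ab assms(1) by simp_all
    then show ?thesis
      unfolding related_inverse_image[OF assms(1) g ab] related_kernel_pair[OF gf ab]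
      using related_kernel_pair[OF assms(2,3)] ab assms by simp
  qed
qed (use assms in auto)

lemma inverse_image_discrete:
  assumes "f \<in> Hom C Y X"
  shows "inverse_image_rel C f (discrete_rel C X) = kernel_pair C f"
proof -
  have X: "X \<in> Obj C" using assms by auto
  show ?thesis
    unfolding discrete_eq_kernel_pair[OF X]
    using inverse_image_kernel_pair[OF assms, of "Ide C X"] X assms by simp
qed

lemma inverse_image_mono:
  assumes f: "f \<in> Hom C Y X" and ST: "S \<in> relations C X" "T \<in> relations C X" "sub_le C S T"
  shows "sub_le C (inverse_image_rel C f S) (inverse_image_rel C f T)"
proof -
  have X: "X \<in> Obj C" and Y: "Y \<in> Obj C" using f by auto
  show ?thesis
    unfolding sub_le_iff_related[OF inverse_image_relation[OF f ST(1)] inverse_image_relation[OF f ST(2)] Y]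
  proof (intro allI ballI impI)
    fix Z a b assume ab: "a \<in> Hom C Z Y" "b \<in> Hom C Z Y" "related C (inverse_image_rel C f S) a b"
    have "f \<cdot> a \<in> Hom C Z X" "f \<cdot> b \<in> Hom C Z X" using ab f by simp_all
    then show "related C (inverse_image_rel C f T) a b"
      using ab(3) ST(3) unfolding related_inverse_image[OF f ST(1) ab(1,2)]
        related_inverse_image[OF f ST(2) ab(1,2)] sub_le_iff_related[OF ST(1,2) X] by blast
  qed
qed

text \<open>Elements of the codomain of a regular epimorphism lift on a cover, so nothing is lost by
  pulling back along it.\<close>

lemma inverse_image_reflects_le:
  assumes f: "f \<in> Hom C Y X" "regepi f" and ST: "S \<in> relations C X" "T \<in> relations C X"
    and le: "sub_le C (inverse_image_rel C f S) (inverse_image_rel C f T)"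
  shows "sub_le C S T"
proof -
  have X: "X \<in> Obj C" and Y: "Y \<in> Obj C" using f by auto
  show ?thesis
    unfolding sub_le_iff_related[OF ST X]
  proof (intro allI ballI impI)
    fix Z a b assume ab: "a \<in> Hom C Z X" "b \<in> Hom C Z X" "related C S a b"
    obtain d a' where d: "regepi d" "Cod C d = Dom C a" "a' \<in> Hom C (Dom C d) (Dom C f)" "f \<cdot> a' = a \<cdot> d"
      by (rule cover_lift[OF f(2), of a]) (use ab f in simp_all)
    obtain d' b' where d': "regepi d'" "Cod C d' = Dom C (b \<cdot> d)" "b' \<in> Hom C (Dom C d') (Dom C f)"
      "f \<cdot> b' = (b \<cdot> d) \<cdot> d'"
      by (rule cover_lift[OF f(2), of "b \<cdot> d"]) (use ab f d in simp_all)
    have dd: "d \<cdot> d' \<in> Hom C (Dom C d') Z" "Dom C d = Cod C d'" "Cod C d = Z"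
      using d(1,2) d'(1,2) ab(1,2) by simp_all
    have a'd': "a' \<cdot> d' \<in> Hom C (Dom C d') Y" "b' \<in> Hom C (Dom C d') Y"
      using d(3) d'(1,3) dd(2) f(1) by simp_all
    have fa: "f \<cdot> (a' \<cdot> d') = (a \<cdot> d) \<cdot> d'"
      by (rule Comp_left[OF d(4)]) (use d(3) d'(1) dd(2) f(1) in simp_all)
    have "related C S (a \<cdot> (d \<cdot> d')) (b \<cdot> (d \<cdot> d'))"
      by (rule related_precomp[OF ST(1) ab(3,1,2) dd(1)])
    then have "related C S ((a \<cdot> d) \<cdot> d') ((b \<cdot> d) \<cdot> d')"
      using ab(1,2) d(1,2) d'(1) dd(2) by simp
    then have "related C (inverse_image_rel C f S) (a' \<cdot> d') b'"
      unfolding related_inverse_image[OF f(1) ST(1) a'd'] fa d'(4) .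
    then have "related C (inverse_image_rel C f T) (a' \<cdot> d') b'"
      using le a'd' unfolding sub_le_iff_related[OF inverse_image_relation[OF f(1) ST(1)]
        inverse_image_relation[OF f(1) ST(2)] Y] by blast
    then have T: "related C T ((a \<cdot> d) \<cdot> d') ((b \<cdot> d) \<cdot> d')"
      unfolding related_inverse_image[OF f(1) ST(2) a'd'] fa d'(4) .
    have "related C T (a \<cdot> d) (b \<cdot> d)"
      by (rule related_local[OF ST(2) d'(1) _ _ T]) (use ab(1,2) d(1,2) dd(2) in simp_all)
    then show "related C T a b"
      by (rule related_local[OF ST(2) d(1), rotated -1]) (use ab(1,2) dd(3) in simp_all)
  qed
qed

text \<open>Image and inverse image form a Galois connection. It turns upper bounds of \<open>f(S)\<close> by kernel
  pairs \<open>R[g]\<close> into upper bounds of \<open>S\<close> by \<open>R[g \<cdot> f]\<close>.\<close>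

lemma image_le_iff:
  assumes f: "f \<in> Hom C X Y" and S: "S \<in> relations C X" and T: "T \<in> relations C Y"
  shows "sub_le C (image_rel C f S) T \<longleftrightarrow> sub_le C S (inverse_image_rel C f T)"
proof -
  have X: "X \<in> Obj C" and Y: "Y \<in> Obj C" using f by auto
  show ?thesis
    unfolding sub_le_iff_related[OF image_relation[OF f S] T Y]
      sub_le_iff_related[OF S inverse_image_relation[OF f T] X]
  proof (intro iffI allI ballI impI)
    fix Z a b
    assume le: "\<forall>Z. \<forall>a\<in>Hom C Z Y. \<forall>b\<in>Hom C Z Y. related C (image_rel C f S) a b \<longrightarrow> related C T a b"
      and ab: "a \<in> Hom C Z X" "b \<in> Hom C Z X" "related C S a b"
    have Z: "Z \<in> Obj C" using ab by auto
    have fab: "f \<cdot> a \<in> Hom C Z Y" "f \<cdot> b \<in> Hom C Z Y" using ab f by simp_all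
    then have "f \<cdot> a = (f \<cdot> a) \<cdot> Ide C Z" "f \<cdot> b = (f \<cdot> b) \<cdot> Ide C Z" by simp_all
    moreover have "Dom C (Ide C Z) = Z" "Cod C (Ide C Z) = Z" using Z by simp_all
    ultimately have "related C (image_rel C f S) (f \<cdot> a) (f \<cdot> b)"
      unfolding related_image[OF f S fab] using ab regepi_Ide[OF Z] by metis
    then show "related C (inverse_image_rel C f T) a b"
      unfolding related_inverse_image[OF f T ab(1,2)] using le fab by blast
  next
    fix Z a b
    assume le: "\<forall>Z. \<forall>a\<in>Hom C Z X. \<forall>b\<in>Hom C Z X. related C S a b \<longrightarrow> related C (inverse_image_rel C f T) a b"
      and ab: "a \<in> Hom C Z Y" "b \<in> Hom C Z Y" "related C (image_rel C f S) a b"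
    then obtain d a' b' where d: "regepi d" "Cod C d = Z" and a': "a' \<in> Hom C (Dom C d) X"
      and b': "b' \<in> Hom C (Dom C d) X" and r: "related C S a' b'" and e: "f \<cdot> a' = a \<cdot> d" "f \<cdot> b' = b \<cdot> d"
      unfolding related_image[OF f S ab(1,2)] by blast
    have "related C (inverse_image_rel C f T) a' b'" using le a' b' r by blast
    then have "related C T (a \<cdot> d) (b \<cdot> d)"
      unfolding related_inverse_image[OF f T a' b'] e .
    then show "related C T a b"
      by (rule related_local[OF T d(1), rotated -1]) (use ab(1,2) d(2) in simp_all)
  qed
qed

lemma image_discrete:
  assumes "f \<in> Hom C X Y" "regepi f"
  shows "image_rel C f (discrete_rel C X) = discrete_rel C Y"
proof -
  have X: "X \<in> Obj C" and Y: "Y \<in> Obj C" using assms by auto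
  note dX = discrete_relation[OF X] and dY = discrete_relation[OF Y]
  show ?thesis
  proof (rule sub_le_antisym[OF image_relation[OF assms(1) dX] dY Y])
    have "sub_le C (discrete_rel C X) (inverse_image_rel C f (discrete_rel C Y))"
      unfolding inverse_image_discrete[OF assms(1)]
      by (rule discrete_le_equiv_rel[OF kernel_pair_equiv_rel]) (use assms in simp_all)
    then show "sub_le C (image_rel C f (discrete_rel C X)) (discrete_rel C Y)"
      by (simp only: image_le_iff[OF assms(1) dX dY])
    show "sub_le C (discrete_rel C Y) (image_rel C f (discrete_rel C X))"
      unfolding sub_le_iff_related[OF dY image_relation[OF assms(1) dX] Y]
    proof (intro allI ballI impI)
      fix Z a b assume ab: "a \<in> Hom C Z Y" "b \<in> Hom C Z Y" "related C (discrete_rel C Y) a b"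
      then have "b = a" using related_discrete[OF Y] by blast
      obtain d a' where d: "regepi d" "Cod C d = Dom C a" "a' \<in> Hom C (Dom C d) (Dom C f)" "f \<cdot> a' = a \<cdot> d"
        by (rule cover_lift[OF assms(2), of a]) (use ab assms in simp_all)
      have a': "a' \<in> Hom C (Dom C d) X" "Cod C d = Z" using d(2,3) ab(1) assms(1) by simp_all
      then have "related C (discrete_rel C X) a' a'" using related_discrete[OF X a'(1) a'(1)] by blast
      then show "related C (image_rel C f (discrete_rel C X)) a b"
        unfolding \<open>b = a\<close> related_image[OF assms(1) dX ab(1,1)] using d a' by blast
    qed
  qed
qed

end

locale exact_cat =
  fixes C :: "('o, 'a) precategory" (structure)
  assumes exact: "exact_category C"
begin

sublocale regular_cat C
  using exact by unfold_locales (simp add: exact_category_def)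

text \<open>Effectiveness provides some arrow with kernel pair \<open>S\<close>; the monic part of its image
  factorization does not affect the kernel pair.\<close>

lemma equiv_rel_quotient:
  assumes "X \<in> Obj C" "S \<in> equiv_rels C X"
  obtains q where "regepi q" "Dom C q = X" "S = kernel_pair C q"
proof -
  obtain f where f: "f \<in> Arr C" "Dom C f = X" "S = kernel_pair C f"
    using exact assms unfolding exact_category_def by blast
  obtain m e where me: "monic m" "regepi e" "Cod C e = Dom C m" "m \<cdot> e = f"
    using image_factorization[OF f(1)] .
  have "kernel_pair C f = kernel_pair C e"
    unfolding me(4)[symmetric] by (rule kernel_pair_monic_comp) (use me in simp_all)
  moreover have "Dom C e = X" using me f by auto
  ultimately show ?thesis using that me(2) f(3) by blast
qed

text \<open>Write \<open>S = R[e]\<close>. As \<open>e\<close> identifies the projections of \<open>S\<close>, it factors through their coequaliser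
  \<open>q\<close>, so \<open>R[q]\<close> is contained in \<open>S\<close>; the converse holds because \<open>q\<close> identifies the projections
  of \<open>S\<close>.\<close>

lemma kernel_pair_quotient:
  assumes "X \<in> Obj C" "S \<in> equiv_rels C X" "is_quotient C X S q"
  shows "regepi q" "Dom C q = X" "S = kernel_pair C q"
proof -
  note S = equiv_rel_relation[OF assms(2)]
  let ?p = "pr1 C X X" and ?r = "pr2 C X X"
  note pr = projections[OF assms(1,1)]
  obtain s where s: "s \<in> S" and co: "is_coequaliser C (?p \<cdot> s) (?r \<cdot> s) q"
    using assms(3) unfolding is_quotient_def by blast
  note st = relation_element[OF S s]
  show "regepi q" using co by (rule regepi_coequaliser)
  then have q: "q \<in> Arr C" by simp
  have "Dom C q = Cod C (?p \<cdot> s)" and eq: "q \<cdot> (?p \<cdot> s) = q \<cdot> (?r \<cdot> s)"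
    using co unfolding is_coequaliser_def by blast+
  then show Dq: "Dom C q = X" using st pr by simp
  obtain e where e: "regepi e" "Dom C e = X" "S = kernel_pair C e"
    using equiv_rel_quotient[OF assms(1,2)] .
  have ea: "e \<in> Arr C" using e(1) by simp
  have ps: "?p \<cdot> s \<in> Hom C (Dom C s) X" "?r \<cdot> s \<in> Hom C (Dom C s) X" using st pr by simp_all
  have "related C S (?p \<cdot> (s \<cdot> Ide C (Dom C s))) (?r \<cdot> (s \<cdot> Ide C (Dom C s)))"
    by (rule relatedI[OF S s assms(1)]) (use st in simp_all)
  then have "related C (kernel_pair C e) (?p \<cdot> s) (?r \<cdot> s)"
    using st e(3) by simp
  then have "e \<cdot> (?p \<cdot> s) = e \<cdot> (?r \<cdot> s)"
    unfolding related_kernel_pair[OF ea e(2) ps] .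
  then have "\<exists>!k. k \<in> Hom C (Cod C q) (Cod C e) \<and> k \<cdot> q = e"
    using co ea e(2) ps unfolding is_coequaliser_def by simp
  then obtain k where k: "k \<in> Hom C (Cod C q) (Cod C e)" "k \<cdot> q = e" by blast
  show "S = kernel_pair C q"
  proof (rule sub_le_antisym[OF S kernel_pair_relation[OF q Dq] assms(1)])
    show "sub_le C (kernel_pair C q) S"
      unfolding e(3) k(2)[symmetric] by (rule kernel_pair_le_comp) (use k(1) q in simp_all)
    show "sub_le C S (kernel_pair C q)"
      unfolding sub_le_iff_related[OF S kernel_pair_relation[OF q Dq] assms(1)]
    proof (intro allI ballI impI)
      fix Z a b assume ab: "a \<in> Hom C Z X" "b \<in> Hom C Z X" "related C S a b"
      obtain h where h: "h \<in> Arr C" "Dom C h = Z" "Cod C h = Dom C s"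
        and he: "?p \<cdot> (s \<cdot> h) = a" "?r \<cdot> (s \<cdot> h) = b"
        using relatedE[OF S s ab(3,1,2)] .
      have "q \<cdot> ((?p \<cdot> s) \<cdot> h) = q \<cdot> ((?r \<cdot> s) \<cdot> h)"
        by (rule Comp_extend[OF eq]) (use q Dq h ps in simp_all)
      moreover have "(?p \<cdot> s) \<cdot> h = a" "(?r \<cdot> s) \<cdot> h = b"
        unfolding he[symmetric] using h st pr by simp_all
      ultimately show "related C (kernel_pair C q) a b"
        unfolding related_kernel_pair[OF q Dq ab(1,2)] by simp
    qed
  qed
qed

lemma inverse_image_equiv_rel:
  assumes "f \<in> Hom C Y X" "S \<in> equiv_rels C X"
  shows "inverse_image_rel C f S \<in> equiv_rels C Y"
proof -
  have "X \<in> Obj C" using assms(1) by auto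
  then obtain q where q: "regepi q" "Dom C q = X" "S = kernel_pair C q"
    using equiv_rel_quotient[OF _ assms(2)] by blast
  then have "inverse_image_rel C f S = kernel_pair C (q \<cdot> f)"
    using inverse_image_kernel_pair[OF assms(1)] by simp
  moreover have "kernel_pair C (q \<cdot> f) \<in> equiv_rels C Y"
    by (rule kernel_pair_equiv_rel) (use q assms(1) in simp_all)
  ultimately show ?thesis by simp
qed

text \<open>Reflexivity and symmetry are inherited by any image. If \<open>(a, b)\<close> and \<open>(b, c)\<close> lie in the
  image of \<open>S\<close>, choose lifts \<open>(a\<^sub>1, b\<^sub>1)\<close> and \<open>(b\<^sub>2, c\<^sub>2)\<close> in \<open>S\<close> on a common cover. With \<open>R\<close> the
  kernel pair of \<open>f\<close>, the pair \<open>(a\<^sub>1, c\<^sub>2)\<close> lies in \<open>S \<circ> R \<circ> S\<close>, which the Goursat identity turns into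
  \<open>R \<circ> S \<circ> R\<close>: so \<open>a\<^sub>1\<close> and \<open>c\<^sub>2\<close> can be changed, without changing their images, into an
  \<open>S\<close>-related pair.\<close>

lemma image_equiv_rel:
  assumes goursat: "exact_goursat_category C"
    and f: "f \<in> Hom C X Y" "regepi f" and S: "S \<in> equiv_rels C X"
  shows "image_rel C f S \<in> equiv_rels C Y"
proof -
  have X: "X \<in> Obj C" and Y: "Y \<in> Obj C" using f by auto
  note Sr = equiv_rel_relation[OF S]
  note ri = related_image[OF f(1) Sr]
  let ?R = "kernel_pair C f"
  have fa: "f \<in> Arr C" "Dom C f = X" using f(1) by simp_all
  note rk = related_kernel_pair[OF fa]
  have R: "?R \<in> relations C X" by (rule kernel_pair_relation[OF fa])
  have Seq: "related C S a a" "related C S a b \<Longrightarrow> related C S b a"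
    if "a \<in> Hom C Z X" "b \<in> Hom C Z X" for Z a b
    using S that unfolding equiv_rels_iff[OF X] by blast+
  have perm: "comp_rel C X ?R (comp_rel C X S ?R) = comp_rel C X S (comp_rel C X ?R S)"
    using goursat X S kernel_pair_equiv_rel[OF fa] unfolding exact_goursat_category_def by blast
  note SR = comp_relation[OF X Sr R] and RS = comp_relation[OF X R Sr]
  show ?thesis
    unfolding equiv_rels_iff[OF Y]
  proof (intro conjI allI ballI impI)
    show "image_rel C f S \<in> relations C Y" by (rule image_relation[OF f(1) Sr])
  next
    have "sub_le C (image_rel C f (discrete_rel C X)) (image_rel C f S)"
      unfolding image_le_iff[OF f(1) discrete_relation[OF X] image_relation[OF f(1) Sr]]
      by (rule sub_le_trans[OF discrete_le_equiv_rel[OF S] _ discrete_relation[OF X] Sr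
          inverse_image_relation[OF f(1) image_relation[OF f(1) Sr]] X])
        (simp add: image_le_iff[OF f(1) Sr image_relation[OF f(1) Sr], symmetric]
          sub_le_refl[OF image_relation[OF f(1) Sr] Y])
    then have "sub_le C (discrete_rel C Y) (image_rel C f S)"
      unfolding image_discrete[OF f] .
    then show "related C (image_rel C f S) a a" if "a \<in> Hom C Z Y" for Z a
      using related_discrete[OF Y that that] that
      unfolding sub_le_iff_related[OF discrete_relation[OF Y] image_relation[OF f(1) Sr] Y] by blast
  next
    fix Z a b assume ab: "a \<in> Hom C Z Y" "b \<in> Hom C Z Y" "related C (image_rel C f S) a b"
    then show "related C (image_rel C f S) b a"
      unfolding ri[OF ab(1,2)] ri[OF ab(2,1)] using Seq(2) by blast
  next
    fix Z a b c assume a: "a \<in> Hom C Z Y" and b: "b \<in> Hom C Z Y" and c: "c \<in> Hom C Z Y"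
      and "related C (image_rel C f S) a b" "related C (image_rel C f S) b c"
    then obtain d a1 b1 d' b2 c2 where d: "regepi d" "Cod C d = Z" and d': "regepi d'" "Cod C d' = Z"
      and a1: "a1 \<in> Hom C (Dom C d) X" "f \<cdot> a1 = a \<cdot> d" and b1: "b1 \<in> Hom C (Dom C d) X" "f \<cdot> b1 = b \<cdot> d"
      and b2: "b2 \<in> Hom C (Dom C d') X" "f \<cdot> b2 = b \<cdot> d'" and c2: "c2 \<in> Hom C (Dom C d') X" "f \<cdot> c2 = c \<cdot> d'"
      and r1: "related C S a1 b1" and r2: "related C S b2 c2"
      unfolding ri[OF a b] ri[OF b c] by blast
    \<comment> \<open>a common refinement \<open>W\<close> of the two covers\<close>
    obtain w v where w: "regepi w" "Cod C w = Dom C d" "v \<in> Hom C (Dom C w) (Dom C d')" "d' \<cdot> v = d \<cdot> w"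
      by (rule cover_lift[OF d'(1), of d]) (use d d' in simp_all)
    define W where "W = Dom C w"
    have wv: "w \<in> Hom C W (Dom C d)" "v \<in> Hom C W (Dom C d')" and W: "W \<in> Obj C"
      using w W_def by simp_all
    have dw: "d \<cdot> w \<in> Hom C W Z" "regepi (d \<cdot> w)"
      using wv d regepi_comp[OF w(1) d(1) w(2)] by simp_all
    have ty: "a1 \<cdot> w \<in> Hom C W X" "b1 \<cdot> w \<in> Hom C W X" "b2 \<cdot> v \<in> Hom C W X" "c2 \<cdot> v \<in> Hom C W X"
      using a1(1) b1(1) b2(1) c2(1) wv by simp_all
    have e: "f \<cdot> (a1 \<cdot> w) = a \<cdot> (d \<cdot> w)" "f \<cdot> (b1 \<cdot> w) = b \<cdot> (d \<cdot> w)"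
      using Comp_left[OF a1(2), of w] Comp_left[OF b1(2), of w] a1(1) b1(1) wv(1) fa a b d by simp_all
    have e': "f \<cdot> (b2 \<cdot> v) = b \<cdot> (d \<cdot> w)" "f \<cdot> (c2 \<cdot> v) = c \<cdot> (d \<cdot> w)"
      unfolding w(4)[symmetric]
      using Comp_left[OF b2(2), of v] Comp_left[OF c2(2), of v] b2(1) c2(1) wv(2) fa b c d' by simp_all
    have r: "related C S (a1 \<cdot> w) (b1 \<cdot> w)" "related C S (b2 \<cdot> v) (c2 \<cdot> v)"
      by (rule related_precomp[OF Sr r1 a1(1) b1(1) wv(1)], rule related_precomp[OF Sr r2 b2(1) c2(1) wv(2)])
    have compI: "related C (comp_rel C X P Q) x z"
      if "P \<in> relations C X" "Q \<in> relations C X" "x \<in> Hom C W X" "y \<in> Hom C W X" "z \<in> Hom C W X"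
        "related C Q x y" "related C P y z" for P Q x y z
    proof -
      have "x \<cdot> Ide C W = x" "z \<cdot> Ide C W = z" "Dom C (Ide C W) = W" "Cod C (Ide C W) = W"
        using that W by simp_all
      then show ?thesis
        unfolding related_composite[OF X that(1,2,3,5)] using that(4,6,7) regepi_Ide[OF W] by metis
    qed
    have "related C ?R (b1 \<cdot> w) (b2 \<cdot> v)"
      unfolding rk[OF ty(2,3)] e e' ..
    then have "related C (comp_rel C X ?R S) (a1 \<cdot> w) (b2 \<cdot> v)"
      using r(1) by (intro compI[OF R Sr ty(1,2,3)])
    then have "related C (comp_rel C X S (comp_rel C X ?R S)) (a1 \<cdot> w) (c2 \<cdot> v)"
      using r(2) by (intro compI[OF Sr RS ty(1,3,4)])
    then have "related C (comp_rel C X ?R (comp_rel C X S ?R)) (a1 \<cdot> w) (c2 \<cdot> v)"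
      unfolding perm .
    then obtain u z where u: "regepi u" "Cod C u = W" and z: "z \<in> Hom C (Dom C u) X"
      and r3: "related C (comp_rel C X S ?R) ((a1 \<cdot> w) \<cdot> u) z" "related C ?R z ((c2 \<cdot> v) \<cdot> u)"
      unfolding related_composite[OF X R SR ty(1,4)] by blast
    have tu: "(a1 \<cdot> w) \<cdot> u \<in> Hom C (Dom C u) X" "(c2 \<cdot> v) \<cdot> u \<in> Hom C (Dom C u) X"
      using ty u by simp_all
    obtain t y where t: "regepi t" "Cod C t = Dom C u" and y: "y \<in> Hom C (Dom C t) X"
      and r4: "related C ?R (((a1 \<cdot> w) \<cdot> u) \<cdot> t) y" "related C S y (z \<cdot> t)"
      using r3(1) unfolding related_composite[OF X Sr R tu(1) z] by blast
    have ut: "u \<cdot> t \<in> Hom C (Dom C t) W" using u t by simp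
    have cov: "(d \<cdot> w) \<cdot> (u \<cdot> t) \<in> Hom C (Dom C t) Z" "regepi ((d \<cdot> w) \<cdot> (u \<cdot> t))"
      using ut dw regepi_comp[OF regepi_comp[OF t(1) u(1) t(2)] dw(2)] by simp_all
    have tz: "((a1 \<cdot> w) \<cdot> u) \<cdot> t \<in> Hom C (Dom C t) X" "z \<cdot> t \<in> Hom C (Dom C t) X"
      using tu z t by simp_all
    have "f \<cdot> y = f \<cdot> (((a1 \<cdot> w) \<cdot> u) \<cdot> t)"
      using r4(1) unfolding rk[OF tz(1) y] by simp
    also have "\<dots> = (f \<cdot> (a1 \<cdot> w)) \<cdot> (u \<cdot> t)"
      using fa ty(1) u t a1 wv by simp
    also have "\<dots> = a \<cdot> ((d \<cdot> w) \<cdot> (u \<cdot> t))"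
      unfolding e using a dw ut by simp
    finally have fy: "f \<cdot> y = a \<cdot> ((d \<cdot> w) \<cdot> (u \<cdot> t))" .
    have fz: "f \<cdot> z = f \<cdot> ((c2 \<cdot> v) \<cdot> u)"
      using r3(2) unfolding rk[OF z tu(2)] .
    have "f \<cdot> (z \<cdot> t) = (f \<cdot> ((c2 \<cdot> v) \<cdot> u)) \<cdot> t"
      by (rule Comp_left[OF fz]) (use fa z t in simp_all)
    also have "\<dots> = (f \<cdot> (c2 \<cdot> v)) \<cdot> (u \<cdot> t)"
      using fa ty(4) u t c2 wv by simp
    also have "\<dots> = c \<cdot> ((d \<cdot> w) \<cdot> (u \<cdot> t))"
      unfolding e' using c dw ut by simp
    finally have fzt: "f \<cdot> (z \<cdot> t) = c \<cdot> ((d \<cdot> w) \<cdot> (u \<cdot> t))" .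
    have D: "Dom C ((d \<cdot> w) \<cdot> (u \<cdot> t)) = Dom C t" "Cod C ((d \<cdot> w) \<cdot> (u \<cdot> t)) = Z"
      using cov(1) unfolding in_Hom_iff by blast+
    \<comment> \<open>\<open>(y, z \<cdot> t)\<close> lies in \<open>S\<close> and lifts \<open>(a, c)\<close> on the cover that combines all the refinements\<close>
    show "related C (image_rel C f S) a c"
      unfolding ri[OF a c]
      by (intro exI[of _ "(d \<cdot> w) \<cdot> (u \<cdot> t)"] exI[of _ y] exI[of _ "z \<cdot> t"] conjI)
        (unfold D, (fact cov(2) refl y tz(2) r4(2) fy fzt)+)
  qed
qed

end

section \<open>The closure operator of a reflective subcategory\<close>

definition is_least_kernel_pair :: "('o, 'a) precategory \<Rightarrow> 'o set \<Rightarrow> 'o \<Rightarrow> 'a set \<Rightarrow> 'a set \<Rightarrow> bool" where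
  "is_least_kernel_pair C L X S K \<longleftrightarrow>
     (\<exists>f \<in> Arr C. Dom C f = X \<and> Cod C f \<in> L \<and> K = kernel_pair C f) \<and> sub_le C S K \<and>
     (\<forall>g \<in> Arr C. Dom C g = X \<and> Cod C g \<in> L \<and> sub_le C S (kernel_pair C g) \<longrightarrow>
        sub_le C K (kernel_pair C g))"

text \<open>The reflector and the unit of \<open>L\<close> are determined only up to isomorphism. Defining the closure by
  the universal property makes it a function of \<open>L\<close> alone.\<close>

definition reflective_closure :: "('o, 'a) precategory \<Rightarrow> 'o set \<Rightarrow> ('o \<times> 'a set \<Rightarrow> 'a set)" where
  "reflective_closure C L =
     restrict (\<lambda>(X, S). THE K. is_least_kernel_pair C L X S K) (Sigma (Obj C) (equiv_rels C))"

context exact_cat begin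

lemma least_kernel_pair_le:
  assumes "is_least_kernel_pair C L X S K" "g \<in> Arr C" "Dom C g = X" "Cod C g \<in> L"
    "sub_le C S (kernel_pair C g)"
  shows "sub_le C K (kernel_pair C g)"
  using assms unfolding is_least_kernel_pair_def by blast

lemma is_least_kernel_pair_unique:
  assumes "is_least_kernel_pair C L X S K" "is_least_kernel_pair C L X S K'"
  shows "K = K'"
proof -
  obtain f where f: "f \<in> Arr C" "Dom C f = X" "Cod C f \<in> L" "K = kernel_pair C f"
    using assms(1) unfolding is_least_kernel_pair_def by blast
  obtain g where g: "g \<in> Arr C" "Dom C g = X" "Cod C g \<in> L" "K' = kernel_pair C g"
    using assms(2) unfolding is_least_kernel_pair_def by blast
  have X: "X \<in> Obj C" using f(1,2) by auto
  have "sub_le C S K" "sub_le C S K'"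
    using assms unfolding is_least_kernel_pair_def by blast+
  then have "sub_le C K K'" "sub_le C K' K"
    using least_kernel_pair_le[OF assms(1) g(1-3)] least_kernel_pair_le[OF assms(2) f(1-3)]
    unfolding f(4) g(4) by blast+
  then show ?thesis
    unfolding f(4) g(4)
    by (rule sub_le_antisym[OF kernel_pair_relation[OF f(1,2)] kernel_pair_relation[OF g(1,2)] X])
qed

lemma reflective_closure_eqI:
  assumes "X \<in> Obj C" "S \<in> equiv_rels C X" "is_least_kernel_pair C L X S K"
  shows "reflective_closure C L (X, S) = K"
proof -
  have "(THE K. is_least_kernel_pair C L X S K) = K"
    using assms(3) by (rule the_equality) (rule is_least_kernel_pair_unique[OF _ assms(3)])
  then show ?thesis
    using assms(1,2) by (simp add: reflective_closure_def)
qed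

text \<open>An arrow from \<open>X\<close> into \<open>L\<close> whose kernel pair contains \<open>R[q]\<close> factors through \<open>q\<close>, and then
  through the unit at the codomain of \<open>q\<close>.\<close>

lemma reflection_kernel_pair_least:
  assumes refl: "is_reflection C L lo la \<eta>" and q: "regepi q" "Dom C q = X"
  shows "\<eta> (Cod C q) \<cdot> q \<in> Hom C X (lo (Cod C q))" "lo (Cod C q) \<in> L"
    and "is_least_kernel_pair C L X (kernel_pair C q) (kernel_pair C (\<eta> (Cod C q) \<cdot> q))"
proof -
  let ?Q = "Cod C q" and ?e = "\<eta> (Cod C q)"
  have qa: "q \<in> Arr C" "?Q \<in> Obj C" using q(1) by simp_all
  have "?e \<in> Hom C ?Q (lo ?Q)"
    using refl qa(2) unfolding is_reflection_def by blast
  then have e: "?e \<in> Arr C" "Dom C ?e = ?Q" "Cod C ?e = lo ?Q" by simp_all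
  show eq: "?e \<cdot> q \<in> Hom C X (lo ?Q)" using e qa q(2) by simp
  have "lo ?Q \<in> Obj (full_subcategory C L)"
    using refl qa(2) unfolding is_reflection_def is_functor_def by blast
  then show lo: "lo ?Q \<in> L" by (simp add: full_subcategory_def)
  show "is_least_kernel_pair C L X (kernel_pair C q) (kernel_pair C (?e \<cdot> q))"
    unfolding is_least_kernel_pair_def
  proof (intro conjI ballI impI)
    show "\<exists>f\<in>Arr C. Dom C f = X \<and> Cod C f \<in> L \<and> kernel_pair C (?e \<cdot> q) = kernel_pair C f"
      using eq lo by (intro bexI[of _ "?e \<cdot> q"]) simp_all
    show "sub_le C (kernel_pair C q) (kernel_pair C (?e \<cdot> q))"
      by (rule kernel_pair_le_comp) (use qa e in simp_all)
    fix g assume "g \<in> Arr C" and "Dom C g = X \<and> Cod C g \<in> L \<and> sub_le C (kernel_pair C q) (kernel_pair C g)"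
    then have g: "g \<in> Arr C" "Dom C g = X" "Cod C g \<in> L" "sub_le C (kernel_pair C q) (kernel_pair C g)"
      by blast+
    obtain k where k: "k \<in> Arr C" "Dom C k = ?Q" "Cod C k = Cod C g" "k \<cdot> q = g"
      by (rule sub_le_kernel_pairD[OF q(1) g(1) _ g(4)]) (use g(2) q(2) in simp_all)
    have "k \<in> Hom C ?Q (Cod C g)" using k by simp
    then have "\<exists>!h. h \<in> Hom C (lo ?Q) (Cod C g) \<and> h \<cdot> ?e = k"
      using refl qa(2) g(3) unfolding is_reflection_def by blast
    then obtain h where h: "h \<in> Hom C (lo ?Q) (Cod C g)" "h \<cdot> ?e = k" by blast
    have "h \<cdot> (?e \<cdot> q) = k \<cdot> q"
      by (rule Comp_left[OF h(2)]) (use h(1) e qa in simp_all)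
    then have "g = h \<cdot> (?e \<cdot> q)" using k(4) by simp
    then show "sub_le C (kernel_pair C (?e \<cdot> q)) (kernel_pair C g)"
      using kernel_pair_le_comp[of "?e \<cdot> q" h] h(1) eq by simp
  qed
qed

lemma reflective_closure_eq:
  assumes "is_reflection C L lo la \<eta>" "X \<in> Obj C" "S \<in> equiv_rels C X" "is_quotient C X S q"
  shows "reflective_closure C L (X, S) = kernel_pair C (\<eta> (Cod C q) \<cdot> q)"
proof -
  note q = kernel_pair_quotient[OF assms(2-4)]
  show ?thesis
    by (rule reflective_closure_eqI[OF assms(2,3)])
      (use reflection_kernel_pair_least(3)[OF assms(1) q(1,2)] q(3) in simp)
qed

lemma epireflectiveE:
  assumes "L \<in> epireflective_subcategories C"
  obtains lo la \<eta> where "is_reflection C L lo la \<eta>" "\<And>A. A \<in> Obj C \<Longrightarrow> regepi (\<eta> A)" "L \<subseteq> Obj C"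
    "\<And>f. is_iso C f \<Longrightarrow> Dom C f \<in> L \<Longrightarrow> Cod C f \<in> L"
  using assms unfolding epireflective_subcategories_def replete_def by blast

lemma reflective_closure_least:
  assumes "L \<in> epireflective_subcategories C" "X \<in> Obj C" "S \<in> equiv_rels C X"
  obtains e where "regepi e" "Dom C e = X" "Cod C e \<in> L"
    "reflective_closure C L (X, S) = kernel_pair C e"
    "is_least_kernel_pair C L X S (kernel_pair C e)"
proof -
  obtain lo la \<eta> where refl: "is_reflection C L lo la \<eta>" and \<eta>: "\<And>A. A \<in> Obj C \<Longrightarrow> regepi (\<eta> A)"
    using epireflectiveE[OF assms(1)] by metis
  obtain q where q: "regepi q" "Dom C q = X" "S = kernel_pair C q"
    using equiv_rel_quotient[OF assms(2,3)] .
  let ?e = "\<eta> (Cod C q) \<cdot> q"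
  note r = reflection_kernel_pair_least[OF refl q(1,2), folded q(3)]
  have "\<eta> (Cod C q) \<in> Hom C (Cod C q) (lo (Cod C q))"
    using refl q(1) unfolding is_reflection_def by simp
  then have "regepi ?e"
    using q(1) \<eta>[of "Cod C q"] by (intro regepi_comp) simp_all
  then show ?thesis
    using that[of ?e] r reflective_closure_eqI[OF assms(2,3) r(3)] by simp
qed

lemma reflective_closure_is_least:
  assumes "L \<in> epireflective_subcategories C" "X \<in> Obj C" "S \<in> equiv_rels C X"
  shows "is_least_kernel_pair C L X S (reflective_closure C L (X, S))"
    and "reflective_closure C L (X, S) \<in> equiv_rels C X"
    and "sub_le C S (reflective_closure C L (X, S))"
proof -
  obtain e where e: "regepi e" "Dom C e = X" "reflective_closure C L (X, S) = kernel_pair C e"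
    "is_least_kernel_pair C L X S (kernel_pair C e)"
    using reflective_closure_least[OF assms] by metis
  show "is_least_kernel_pair C L X S (reflective_closure C L (X, S))" using e by simp
  then show "sub_le C S (reflective_closure C L (X, S))" unfolding is_least_kernel_pair_def by blast
  show "reflective_closure C L (X, S) \<in> equiv_rels C X"
    unfolding e(3) by (rule kernel_pair_equiv_rel) (use e(1,2) in simp_all)
qed

text \<open>For a regular epimorphism \<open>f\<close>, reflexivity of \<open>S\<close> gives \<open>R[f] \<subseteq> f\<^sup>-\<^sup>1(S)\<close>. Hence every arrow \<open>g\<close>
  with \<open>f\<^sup>-\<^sup>1(S) \<subseteq> R[g]\<close> has the form \<open>k \<cdot> f\<close>, and \<open>S \<subseteq> R[k]\<close>: the arrows into \<open>L\<close> to be considered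
  over \<open>f\<^sup>-\<^sup>1(S)\<close> are those over \<open>S\<close> composed with \<open>f\<close>.\<close>

lemma reflective_closure_inverse_image:
  assumes L: "L \<in> epireflective_subcategories C" and f: "f \<in> Hom C Y X" and S: "S \<in> equiv_rels C X"
  shows "sub_le C (reflective_closure C L (Y, inverse_image_rel C f S))
      (inverse_image_rel C f (reflective_closure C L (X, S)))"
    and "regepi f \<Longrightarrow> reflective_closure C L (Y, inverse_image_rel C f S) =
      inverse_image_rel C f (reflective_closure C L (X, S))"
proof -
  have X: "X \<in> Obj C" and Y: "Y \<in> Obj C" using f by auto
  let ?cl = "reflective_closure C L (X, S)"
  let ?iS = "inverse_image_rel C f S"
  note Sr = equiv_rel_relation[OF S] and iS = inverse_image_equiv_rel[OF f S]
  note least = reflective_closure_is_least[OF L X S]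
  note clr = equiv_rel_relation[OF least(2)]
  obtain e where e: "regepi e" "Dom C e = X" "Cod C e \<in> L" "?cl = kernel_pair C e"
    using reflective_closure_least[OF L X S] by metis
  have ef: "e \<cdot> f \<in> Arr C" "Dom C (e \<cdot> f) = Y" "Cod C (e \<cdot> f) \<in> L"
    using e f by simp_all
  have icl: "inverse_image_rel C f ?cl = kernel_pair C (e \<cdot> f)"
    unfolding e(4) by (rule inverse_image_kernel_pair[OF f]) (use e in simp_all)
  have le: "sub_le C ?iS (inverse_image_rel C f ?cl)"
    by (rule inverse_image_mono[OF f Sr clr least(3)])
  show "sub_le C (reflective_closure C L (Y, ?iS)) (inverse_image_rel C f ?cl)"
    unfolding icl
    by (rule least_kernel_pair_le[OF reflective_closure_is_least(1)[OF L Y iS] ef le[unfolded icl]])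
  show "reflective_closure C L (Y, ?iS) = inverse_image_rel C f ?cl" if rf: "regepi f"
  proof (rule reflective_closure_eqI[OF Y iS])
    show "is_least_kernel_pair C L Y ?iS (inverse_image_rel C f ?cl)"
      unfolding is_least_kernel_pair_def
    proof (intro conjI ballI impI)
      show "\<exists>g\<in>Arr C. Dom C g = Y \<and> Cod C g \<in> L \<and> inverse_image_rel C f ?cl = kernel_pair C g"
        using ef icl by blast
      show "sub_le C ?iS (inverse_image_rel C f ?cl)" by (rule le)
      fix g assume "g \<in> Arr C" and "Dom C g = Y \<and> Cod C g \<in> L \<and> sub_le C ?iS (kernel_pair C g)"
      then have g: "g \<in> Arr C" "Dom C g = Y" "Cod C g \<in> L" "sub_le C ?iS (kernel_pair C g)"
        by blast+
      have fY: "f \<in> Arr C" "Dom C f = Y" "Cod C f = X" using f by simp_all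
      have kf: "sub_le C (kernel_pair C f) ?iS"
        unfolding inverse_image_discrete[OF f, symmetric]
        by (rule inverse_image_mono[OF f discrete_relation[OF X] Sr discrete_le_equiv_rel[OF S]])
      have kfg: "sub_le C (kernel_pair C f) (kernel_pair C g)"
        by (rule sub_le_trans[OF kf g(4) kernel_pair_relation[OF fY(1,2)] equiv_rel_relation[OF iS]
            kernel_pair_relation[OF g(1,2)] Y])
      obtain k where k: "k \<in> Arr C" "Dom C k = Cod C f" "Cod C k = Cod C g" "k \<cdot> f = g"
        by (rule sub_le_kernel_pairD[OF rf g(1) _ kfg]) (use g(2) fY(2) in simp_all)
      have kX: "Dom C k = X" "Cod C k \<in> L" using k fY(3) g(3) by simp_all
      have ik: "inverse_image_rel C f (kernel_pair C k) = kernel_pair C g"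
        using inverse_image_kernel_pair[OF f k(1) kX(1)] k(4) by simp
      have "sub_le C S (kernel_pair C k)"
        by (rule inverse_image_reflects_le[OF f rf Sr kernel_pair_relation[OF k(1) kX(1)]])
          (use g(4) ik in simp)
      then have "sub_le C ?cl (kernel_pair C k)"
        by (rule least_kernel_pair_le[OF least(1) k(1) kX])
      then show "sub_le C (inverse_image_rel C f ?cl) (kernel_pair C g)"
        using inverse_image_mono[OF f clr kernel_pair_relation[OF k(1) kX(1)]] ik by simp
    qed
  qed
qed

lemma reflective_closure_effective:
  assumes L: "L \<in> epireflective_subcategories C"
  shows "reflective_closure C L \<in> effective_closure_operators C"
proof -
  note least = reflective_closure_is_least[OF L]
  have mono: "sub_le C (reflective_closure C L (X, S)) (reflective_closure C L (X, T))"
    if X: "X \<in> Obj C" and S: "S \<in> equiv_rels C X" and T: "T \<in> equiv_rels C X" and le: "sub_le C S T" for X S T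
  proof -
    obtain e where e: "regepi e" "Dom C e = X" "Cod C e \<in> L" "reflective_closure C L (X, T) = kernel_pair C e"
      using reflective_closure_least[OF L X T] by metis
    show ?thesis
      unfolding e(4)
    proof (rule least_kernel_pair_le[OF least(1)[OF X S]])
      show "sub_le C S (kernel_pair C e)"
        using sub_le_trans[OF le least(3)[OF X T] equiv_rel_relation[OF S] equiv_rel_relation[OF T]
          equiv_rel_relation[OF least(2)[OF X T]] X] e(4) by simp
    qed (use e in simp_all)
  qed
  have idem: "reflective_closure C L (X, reflective_closure C L (X, S)) = reflective_closure C L (X, S)"
    if X: "X \<in> Obj C" and S: "S \<in> equiv_rels C X" for X S
  proof (rule reflective_closure_eqI[OF X least(2)[OF X S]])
    show "is_least_kernel_pair C L X (reflective_closure C L (X, S)) (reflective_closure C L (X, S))"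
      using least(1)[OF X S] sub_le_refl[OF equiv_rel_relation[OF least(2)[OF X S]] X]
      unfolding is_least_kernel_pair_def by blast
  qed
  have "reflective_closure C L \<in> extensional (Sigma (Obj C) (equiv_rels C))"
    unfolding reflective_closure_def by (rule restrict_extensional)
  then show ?thesis
    unfolding effective_closure_operators_def mem_Collect_eq
    using least(2,3) mono reflective_closure_inverse_image[OF L] idem
    by (intro conjI ballI impI) blast+
qed

text \<open>The closure of the diagonal of \<open>X\<close> is the kernel pair of the unit at \<open>X\<close>. It is discrete exactly
  if the unit is monic, hence invertible, and then repleteness puts \<open>X\<close> into \<open>L\<close>.\<close>

lemma separated_reflective_closure:
  assumes L: "L \<in> epireflective_subcategories C"
  shows "separated_objects C (reflective_closure C L) = L"
proof (intro equalityI subsetI)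
  obtain lo la \<eta> where refl: "is_reflection C L lo la \<eta>" and \<eta>: "\<And>A. A \<in> Obj C \<Longrightarrow> regepi (\<eta> A)"
    and LO: "L \<subseteq> Obj C" and iso: "\<And>f. is_iso C f \<Longrightarrow> Dom C f \<in> L \<Longrightarrow> Cod C f \<in> L"
    using epireflectiveE[OF L] by metis
  fix X
  {
    assume "X \<in> L"
    then have X: "X \<in> Obj C" using LO by blast
    note d = discrete_equiv_rel[OF X]
    have "is_least_kernel_pair C L X (discrete_rel C X) (discrete_rel C X)"
      unfolding is_least_kernel_pair_def
    proof (intro conjI)
      show "\<exists>f\<in>Arr C. Dom C f = X \<and> Cod C f \<in> L \<and> discrete_rel C X = kernel_pair C f"
        using \<open>X \<in> L\<close> X discrete_eq_kernel_pair[OF X] by (intro bexI[of _ "Ide C X"]) simp_all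
      show "sub_le C (discrete_rel C X) (discrete_rel C X)"
        by (rule discrete_le_equiv_rel[OF d])
    qed blast
    then show "X \<in> separated_objects C (reflective_closure C L)"
      using X reflective_closure_eqI[OF X d] by (simp add: separated_objects_def)
  next
    assume "X \<in> separated_objects C (reflective_closure C L)"
    then have X: "X \<in> Obj C" and sep: "reflective_closure C L (X, discrete_rel C X) = discrete_rel C X"
      by (simp_all add: separated_objects_def)
    note d = discrete_equiv_rel[OF X]
    have e: "\<eta> X \<in> Arr C" "Dom C (\<eta> X) = X" "Cod C (\<eta> X) = lo X"
      using refl X unfolding is_reflection_def by simp_all
    have I: "Dom C (Ide C X) = X" "Cod C (Ide C X) = X" using X by simp_all
    note r = reflection_kernel_pair_least[OF refl regepi_Ide[OF X] I(1), unfolded I(2),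
        folded discrete_eq_kernel_pair[OF X]]
    have "\<eta> X \<cdot> Ide C X = \<eta> X" using e by simp
    then have k: "kernel_pair C (\<eta> X) = discrete_rel C X"
      using reflective_closure_eqI[OF X d r(3)] sep by simp
    have "a = b" if ab: "a \<in> Hom C Z X" "b \<in> Hom C Z X" "\<eta> X \<cdot> a = \<eta> X \<cdot> b" for a b Z
      using related_kernel_pair[OF e(1,2) ab(1,2)] ab(3) related_discrete[OF X ab(1,2)] k by simp
    then have "monic (\<eta> X)" unfolding is_mono_def e(2) using e(1) by blast
    then have "is_iso C (\<eta> X)" using \<eta>[OF X] by (intro regepi_mono_iso)
    then obtain g where g: "g \<in> Hom C (Cod C (\<eta> X)) (Dom C (\<eta> X))"
      "g \<cdot> \<eta> X = Ide C (Dom C (\<eta> X))" "\<eta> X \<cdot> g = Ide C (Cod C (\<eta> X))"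
      unfolding is_iso_def by blast
    have g': "g \<in> Arr C" "Dom C g = lo X" "Cod C g = X"
      using g(1) e by simp_all
    have "is_iso C g"
      unfolding is_iso_def g'(2,3) using g(2,3) g'(1) e by (intro conjI bexI[of _ "\<eta> X"]) simp_all
    then show "X \<in> L" using iso[of g] g' r(2) by simp
  }
qed

section \<open>The subcategory of separated objects\<close>

lemma effective_closureD:
  assumes "cl \<in> effective_closure_operators C" "X \<in> Obj C" "S \<in> equiv_rels C X"
  shows "cl (X, S) \<in> equiv_rels C X" "sub_le C S (cl (X, S))" "cl (X, cl (X, S)) = cl (X, S)"
    "\<And>T. T \<in> equiv_rels C X \<Longrightarrow> sub_le C S T \<Longrightarrow> sub_le C (cl (X, S)) (cl (X, T))"
    "\<And>f Y. f \<in> Hom C Y X \<Longrightarrow>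
      sub_le C (cl (Y, inverse_image_rel C f S)) (inverse_image_rel C f (cl (X, S)))"
    "\<And>f Y. f \<in> Hom C Y X \<Longrightarrow> regepi f \<Longrightarrow>
      cl (Y, inverse_image_rel C f S) = inverse_image_rel C f (cl (X, S))"
proof -
  note cl = assms(1)[unfolded effective_closure_operators_def mem_Collect_eq]
  show "cl (X, S) \<in> equiv_rels C X" using cl assms(2,3) by blast
  show "sub_le C S (cl (X, S))" using cl assms(2,3) by blast
  show "cl (X, cl (X, S)) = cl (X, S)" using cl assms(2,3) by blast
  show "sub_le C (cl (X, S)) (cl (X, T))" if "T \<in> equiv_rels C X" "sub_le C S T" for T
    using cl assms(2,3) that by blast
  show "sub_le C (cl (Y, inverse_image_rel C f S)) (inverse_image_rel C f (cl (X, S)))"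
    if "f \<in> Hom C Y X" for f Y
  proof -
    have "Y \<in> Obj C" using that by auto
    then show ?thesis using cl assms(2,3) that by blast
  qed
  show "cl (Y, inverse_image_rel C f S) = inverse_image_rel C f (cl (X, S))"
    if "f \<in> Hom C Y X" "regepi f" for f Y
  proof -
    have "Y \<in> Obj C" using that by auto
    then show ?thesis using cl assms(2,3) that by blast
  qed
qed

text \<open>Kernel pairs are inverse images of the diagonal, so continuity of the operator transports
  closedness of the diagonal.\<close>

lemma closed_kernel_pair_of_separated:
  assumes cl: "cl \<in> effective_closure_operators C" and f: "f \<in> Arr C" "Dom C f = X"
    and sep: "Cod C f \<in> separated_objects C cl"
  shows "cl (X, kernel_pair C f) = kernel_pair C f"
proof -
  let ?B = "Cod C f"
  have fH: "f \<in> Hom C X ?B" and X: "X \<in> Obj C" and B: "?B \<in> Obj C" using f by auto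
  note k = kernel_pair_equiv_rel[OF f]
  note ck = effective_closureD[OF cl X k]
  have cd: "cl (?B, discrete_rel C ?B) = discrete_rel C ?B"
    using sep unfolding separated_objects_def by blast
  have "sub_le C (cl (X, kernel_pair C f)) (kernel_pair C f)"
    using effective_closureD(5)[OF cl B discrete_equiv_rel[OF B] fH]
    unfolding cd inverse_image_discrete[OF fH] .
  then show ?thesis
    by (intro sub_le_antisym[OF equiv_rel_relation[OF ck(1)] equiv_rel_relation[OF k] X] ck(2))
qed

text \<open>Along a regular epimorphism the closure commutes with inverse images and the inverse image is
  injective, so closedness also descends to the diagonal of the codomain.\<close>

lemma separated_of_closed_kernel_pair:
  assumes cl: "cl \<in> effective_closure_operators C" and q: "regepi q" "Dom C q = X"
    and closed: "cl (X, kernel_pair C q) = kernel_pair C q"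
  shows "Cod C q \<in> separated_objects C cl"
proof -
  let ?Q = "Cod C q"
  have qH: "q \<in> Hom C X ?Q" and Q: "?Q \<in> Obj C" using q by auto
  note d = discrete_equiv_rel[OF Q]
  note cd = effective_closureD[OF cl Q d]
  have eq: "inverse_image_rel C q (cl (?Q, discrete_rel C ?Q)) = inverse_image_rel C q (discrete_rel C ?Q)"
    using cd(6)[OF qH q(1)] closed unfolding inverse_image_discrete[OF qH] by simp
  note dr = equiv_rel_relation[OF d] and cr = equiv_rel_relation[OF cd(1)]
  have "sub_le C (cl (?Q, discrete_rel C ?Q)) (discrete_rel C ?Q)"
    by (rule inverse_image_reflects_le[OF qH q(1) cr dr])
      (use eq sub_le_refl[OF inverse_image_relation[OF qH dr]] qH in auto)
  then have "cl (?Q, discrete_rel C ?Q) = discrete_rel C ?Q"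
    by (intro sub_le_antisym[OF cr dr Q] cd(2))
  then show ?thesis using Q by (simp add: separated_objects_def)
qed

text \<open>The closure of \<open>S\<close> is closed, so its quotient \<open>e\<close> is separated. If \<open>g\<close> has separated codomain and
  \<open>R[g]\<close> contains \<open>S\<close>, then \<open>R[g]\<close> is closed and contains the closure of \<open>S\<close> by monotonicity.\<close>

lemma closure_is_least_separated:
  assumes cl: "cl \<in> effective_closure_operators C" and X: "X \<in> Obj C" and S: "S \<in> equiv_rels C X"
  obtains e where "regepi e" "Dom C e = X" "Cod C e \<in> separated_objects C cl" "cl (X, S) = kernel_pair C e"
    "is_least_kernel_pair C (separated_objects C cl) X S (kernel_pair C e)"
proof -
  note cS = effective_closureD[OF cl X S]
  obtain e where e: "regepi e" "Dom C e = X" "cl (X, S) = kernel_pair C e"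
    using equiv_rel_quotient[OF X cS(1)] .
  have sep: "Cod C e \<in> separated_objects C cl"
    by (rule separated_of_closed_kernel_pair[OF cl e(1,2)]) (use cS(3) e(3) in simp)
  have "is_least_kernel_pair C (separated_objects C cl) X S (kernel_pair C e)"
    unfolding is_least_kernel_pair_def
  proof (intro conjI ballI impI)
    show "\<exists>f\<in>Arr C. Dom C f = X \<and> Cod C f \<in> separated_objects C cl \<and> kernel_pair C e = kernel_pair C f"
      using e sep by (intro bexI[of _ e]) simp_all
    show "sub_le C S (kernel_pair C e)" using cS(2) e(3) by simp
    fix g assume "g \<in> Arr C" and
      "Dom C g = X \<and> Cod C g \<in> separated_objects C cl \<and> sub_le C S (kernel_pair C g)"
    then have g: "g \<in> Arr C" "Dom C g = X" "Cod C g \<in> separated_objects C cl" "sub_le C S (kernel_pair C g)"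
      by blast+
    show "sub_le C (kernel_pair C e) (kernel_pair C g)"
      using cS(4)[OF kernel_pair_equiv_rel[OF g(1,2)] g(4)] e(3)
        closed_kernel_pair_of_separated[OF cl g(1,2,3)] by simp
  qed
  then show ?thesis using that[OF e(1,2) sep e(3)] by blast
qed

lemma reflective_closure_separated:
  assumes cl: "cl \<in> effective_closure_operators C"
  shows "reflective_closure C (separated_objects C cl) = cl"
proof (rule extensionalityI[of _ "Sigma (Obj C) (equiv_rels C)"])
  show "reflective_closure C (separated_objects C cl) \<in> extensional (Sigma (Obj C) (equiv_rels C))"
    unfolding reflective_closure_def by (rule restrict_extensional)
  show "cl \<in> extensional (Sigma (Obj C) (equiv_rels C))"
    using cl unfolding effective_closure_operators_def by blast
  fix z assume "z \<in> Sigma (Obj C) (equiv_rels C)"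
  then obtain X S where z: "z = (X, S)" and X: "X \<in> Obj C" and S: "S \<in> equiv_rels C X" by blast
  obtain e where "cl (X, S) = kernel_pair C e"
    "is_least_kernel_pair C (separated_objects C cl) X S (kernel_pair C e)"
    using closure_is_least_separated[OF cl X S] by metis
  then show "reflective_closure C (separated_objects C cl) z = cl z"
    unfolding z using reflective_closure_eqI[OF X S] by simp
qed

text \<open>The kernel pair of an isomorphism is the diagonal of its domain, and it is closed if that domain
  is separated.\<close>

lemma separated_replete:
  assumes cl: "cl \<in> effective_closure_operators C"
  shows "replete C (separated_objects C cl)"
  unfolding replete_def
proof (intro conjI allI impI)
  show "separated_objects C cl \<subseteq> Obj C" by (auto simp: separated_objects_def)
  fix f assume "is_iso C f \<and> Dom C f \<in> separated_objects C cl"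
  then have iso: "is_iso C f" and sep: "Dom C f \<in> separated_objects C cl" by blast+
  let ?X = "Dom C f"
  have f: "f \<in> Arr C" using iso by (simp add: is_iso_def)
  then have X: "?X \<in> Obj C" by simp
  have r: "regepi f"
    using iso_comp_regepi[OF regepi_Ide[OF X] iso] X f by simp
  obtain g where g: "g \<in> Hom C (Cod C f) ?X" "g \<cdot> f = Ide C ?X"
    using iso unfolding is_iso_def by blast
  have "kernel_pair C f = discrete_rel C ?X"
  proof (rule sub_le_antisym[OF kernel_pair_relation[OF f refl] discrete_relation[OF X] X])
    show "sub_le C (kernel_pair C f) (discrete_rel C ?X)"
      unfolding discrete_eq_kernel_pair[OF X] g(2)[symmetric]
      by (rule kernel_pair_le_comp) (use f g(1) in simp_all)
    show "sub_le C (discrete_rel C ?X) (kernel_pair C f)"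
      by (rule discrete_le_equiv_rel[OF kernel_pair_equiv_rel[OF f refl]])
  qed
  then show "Cod C f \<in> separated_objects C cl"
    using sep by (intro separated_of_closed_kernel_pair[OF cl r refl]) (simp add: separated_objects_def)
qed

text \<open>A universal arrow out of every object determines the whole adjunction.\<close>

lemma reflection_of_universal_arrows:
  assumes LO: "L \<subseteq> Obj C" and \<eta>: "\<And>A. A \<in> Obj C \<Longrightarrow> \<eta> A \<in> Hom C A (lo A) \<and> lo A \<in> L"
    and univ: "\<And>A B f. A \<in> Obj C \<Longrightarrow> B \<in> L \<Longrightarrow> f \<in> Hom C A B \<Longrightarrow>
      \<exists>!g. g \<in> Hom C (lo A) B \<and> g \<cdot> \<eta> A = f"
  shows "\<exists>la. is_reflection C L lo la \<eta>"
proof -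
  have e: "\<eta> A \<in> Arr C" "Dom C (\<eta> A) = A" "Cod C (\<eta> A) = lo A" "lo A \<in> L" "lo A \<in> Obj C" if "A \<in> Obj C" for A
    using \<eta>[OF that] LO by auto
  define la where "la f = (THE g. g \<in> Hom C (lo (Dom C f)) (lo (Cod C f)) \<and>
    g \<cdot> \<eta> (Dom C f) = \<eta> (Cod C f) \<cdot> f)" for f
  have ex: "\<exists>!g. g \<in> Hom C (lo (Dom C f)) (lo (Cod C f)) \<and> g \<cdot> \<eta> (Dom C f) = \<eta> (Cod C f) \<cdot> f"
    if f: "f \<in> Arr C" for f
    by (rule univ) (use f e[of "Dom C f"] e[of "Cod C f"] in simp_all)
  have la: "la f \<in> Hom C (lo (Dom C f)) (lo (Cod C f))" "la f \<cdot> \<eta> (Dom C f) = \<eta> (Cod C f) \<cdot> f"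
    if f: "f \<in> Arr C" for f
    using theI'[OF ex[OF f]] unfolding la_def by blast+
  have la_eq: "la f = g"
    if f: "f \<in> Arr C" and g: "g \<in> Hom C (lo (Dom C f)) (lo (Cod C f))" "g \<cdot> \<eta> (Dom C f) = \<eta> (Cod C f) \<cdot> f" for f g
    unfolding la_def using ex[OF f] g by (intro the1_equality) blast+
  have "is_functor C (full_subcategory C L) lo la"
    unfolding is_functor_def
  proof (intro conjI ballI impI)
    fix X assume X: "X \<in> Obj C"
    show "lo X \<in> Obj (full_subcategory C L)" using e[OF X] by (simp add: full_subcategory_def)
    have "la (Ide C X) = Ide C (lo X)"
      by (rule la_eq) (use e[OF X] X in simp_all)
    then show "la (Ide C X) = Ide (full_subcategory C L) (lo X)" by (simp add: full_subcategory_def)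
  next
    fix f assume f: "f \<in> Arr C"
    show "la f \<in> Hom (full_subcategory C L) (lo (Dom C f)) (lo (Cod C f))"
      using la(1)[OF f] e[of "Dom C f"] e[of "Cod C f"] f by (simp add: full_subcategory_def)
  next
    fix f g assume f: "f \<in> Arr C" and g: "g \<in> Arr C" and fg: "Cod C f = Dom C g"
    note lf = la[OF f] and lg = la[OF g]
    have ty: "la f \<in> Arr C" "Dom C (la f) = lo (Dom C f)" "Cod C (la f) = lo (Dom C g)"
      "la g \<in> Arr C" "Dom C (la g) = lo (Dom C g)" "Cod C (la g) = lo (Cod C g)"
      using lf(1) lg(1) fg by simp_all
    note ef = e[of "Dom C f"] and eg = e[of "Dom C g"] and eg' = e[of "Cod C g"]
    have "la (g \<cdot> f) = la g \<cdot> la f"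
    proof (rule la_eq)
      have "(la g \<cdot> la f) \<cdot> \<eta> (Dom C f) = la g \<cdot> (la f \<cdot> \<eta> (Dom C f))"
        using ty ef f by simp
      also have "\<dots> = (la g \<cdot> \<eta> (Dom C g)) \<cdot> f"
        unfolding lf(2) fg using ty eg f g fg by simp
      also have "\<dots> = \<eta> (Cod C g) \<cdot> (g \<cdot> f)"
        unfolding lg(2) using eg' f g fg by simp
      finally show "(la g \<cdot> la f) \<cdot> \<eta> (Dom C (g \<cdot> f)) = \<eta> (Cod C (g \<cdot> f)) \<cdot> (g \<cdot> f)"
        using f g fg by simp
    qed (use ty f g fg in simp_all)
    then show "la (g \<cdot> f) = la g \<cdot>\<^bsub>full_subcategory C L\<^esub> la f" by (simp add: full_subcategory_def)
  qed
  then have "is_reflection C L lo la \<eta>"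
    unfolding is_reflection_def using \<eta> la(2) univ by blast
  then show ?thesis by blast
qed

lemma separated_epireflective:
  assumes cl: "cl \<in> effective_closure_operators C"
  shows "separated_objects C cl \<in> epireflective_subcategories C"
proof -
  let ?L = "separated_objects C cl"
  have "\<exists>e. regepi e \<and> Dom C e = A \<and> Cod C e \<in> ?L \<and>
      is_least_kernel_pair C ?L A (discrete_rel C A) (kernel_pair C e)" if A: "A \<in> Obj C" for A
    using closure_is_least_separated[OF cl A discrete_equiv_rel[OF A]] by metis
  then obtain \<eta> where \<eta>: "\<And>A. A \<in> Obj C \<Longrightarrow> regepi (\<eta> A) \<and> Dom C (\<eta> A) = A \<and> Cod C (\<eta> A) \<in> ?L \<and>
      is_least_kernel_pair C ?L A (discrete_rel C A) (kernel_pair C (\<eta> A))"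
    by metis
  have "\<exists>la. is_reflection C ?L (\<lambda>A. Cod C (\<eta> A)) la \<eta>"
  proof (rule reflection_of_universal_arrows)
    show "?L \<subseteq> Obj C" by (auto simp: separated_objects_def)
    show "\<eta> A \<in> Hom C A (Cod C (\<eta> A)) \<and> Cod C (\<eta> A) \<in> ?L" if "A \<in> Obj C" for A
      using \<eta>[OF that] by simp
    fix A B f assume A: "A \<in> Obj C" and B: "B \<in> ?L" and f: "f \<in> Hom C A B"
    have fa: "f \<in> Arr C" "Dom C f = A" "Cod C f \<in> ?L" using f B by simp_all
    have e: "regepi (\<eta> A)" "Dom C (\<eta> A) = A"
      "is_least_kernel_pair C ?L A (discrete_rel C A) (kernel_pair C (\<eta> A))"
      using \<eta>[OF A] by blast+
    have "sub_le C (kernel_pair C (\<eta> A)) (kernel_pair C f)"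
      by (rule least_kernel_pair_le[OF e(3) fa discrete_le_equiv_rel[OF kernel_pair_equiv_rel[OF fa(1,2)]]])
    then obtain k where k: "k \<in> Arr C" "Dom C k = Cod C (\<eta> A)" "Cod C k = Cod C f" "k \<cdot> \<eta> A = f"
      using sub_le_kernel_pairD[OF e(1) fa(1)] e(2) fa(2) by metis
    show "\<exists>!g. g \<in> Hom C (Cod C (\<eta> A)) B \<and> g \<cdot> \<eta> A = f"
    proof (rule ex1I)
      show "k \<in> Hom C (Cod C (\<eta> A)) B \<and> k \<cdot> \<eta> A = f" using k f by simp
      fix g assume g: "g \<in> Hom C (Cod C (\<eta> A)) B \<and> g \<cdot> \<eta> A = f"
      then have "g \<cdot> \<eta> A = k \<cdot> \<eta> A" using k(4) by simp
      then show "g = k"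
        by (rule regepi_cancel[OF e(1), rotated -1]) (use g k in simp_all)
    qed
  qed
  then show ?thesis
    unfolding epireflective_subcategories_def using separated_replete[OF cl] \<eta> by blast
qed

section \<open>Birkhoff subcategories\<close>

text \<open>The image of the closure of \<open>S\<close> is a kernel pair of an arrow into \<open>L\<close>, by closure under
  quotients; the Galois connection shows that it is the least one that contains \<open>f(S)\<close>.\<close>

lemma birkhoff_closure_of_birkhoff_subcategory:
  assumes goursat: "exact_goursat_category C" and L: "L \<in> birkhoff_subcategories C"
  shows "reflective_closure C L \<in> birkhoff_closure_operators C"
proof -
  have Le: "L \<in> epireflective_subcategories C"
    and quot: "\<And>f. regepi f \<Longrightarrow> Dom C f \<in> L \<Longrightarrow> Cod C f \<in> L"
    using L unfolding birkhoff_subcategories_def by blast+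
  have "reflective_closure C L (Y, image_rel C f S) = image_rel C f (reflective_closure C L (X, S))"
    if f: "f \<in> Hom C X Y" and rf: "regepi f" and S: "S \<in> equiv_rels C X" for X Y f S
  proof -
    have X: "X \<in> Obj C" and Y: "Y \<in> Obj C" and fa: "f \<in> Arr C" "Dom C f = X" "Cod C f = Y"
      using f by auto
    let ?cl = "reflective_closure C L (X, S)"
    note least = reflective_closure_is_least[OF Le X S]
    note Sr = equiv_rel_relation[OF S] and clr = equiv_rel_relation[OF least(2)]
    note fS = image_equiv_rel[OF goursat f rf S] and fcl = image_equiv_rel[OF goursat f rf least(2)]
    note fSr = equiv_rel_relation[OF fS] and fclr = equiv_rel_relation[OF fcl]
    obtain e where e: "regepi e" "Dom C e = X" "Cod C e \<in> L" "?cl = kernel_pair C e"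
      using reflective_closure_least[OF Le X S] by metis
    obtain h where h: "regepi h" "Dom C h = Y" "image_rel C f ?cl = kernel_pair C h"
      using equiv_rel_quotient[OF Y fcl] .
    have ha: "h \<in> Arr C" using h(1) by simp
    have hf: "h \<cdot> f \<in> Arr C" "Dom C (h \<cdot> f) = X" "Cod C (h \<cdot> f) = Cod C h"
      using fa ha h(2) by simp_all
    have unit: "sub_le C ?cl (inverse_image_rel C f (image_rel C f ?cl))"
      using image_le_iff[OF f clr fclr] sub_le_refl[OF fclr Y] by blast
    have "inverse_image_rel C f (image_rel C f ?cl) = kernel_pair C (h \<cdot> f)"
      unfolding h(3) by (rule inverse_image_kernel_pair[OF f ha h(2)])
    with unit have "sub_le C (kernel_pair C e) (kernel_pair C (h \<cdot> f))"
      unfolding e(4) by (rule back_subst)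
    then obtain k where k: "k \<in> Arr C" "Dom C k = Cod C e" "Cod C k = Cod C (h \<cdot> f)" "k \<cdot> e = h \<cdot> f"
      using sub_le_kernel_pairD[OF e(1) hf(1)] e(2) hf(2) by metis
    \<comment> \<open>the codomain of \<open>h\<close> is a regular quotient of that of \<open>e\<close>\<close>
    have "regepi (k \<cdot> e)"
      unfolding k(4) by (rule regepi_comp[OF rf h(1)]) (use fa h(2) in simp)
    then have "regepi k"
      by (rule regepi_right_factor) (use k e(1) in simp_all)
    then have hL: "Cod C h \<in> L"
      using quot[of k] k(2,3) e(3) hf(3) by simp
    have "is_least_kernel_pair C L Y (image_rel C f S) (image_rel C f ?cl)"
      unfolding is_least_kernel_pair_def
    proof (intro conjI ballI impI)
      show "\<exists>g\<in>Arr C. Dom C g = Y \<and> Cod C g \<in> L \<and> image_rel C f ?cl = kernel_pair C g"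
        using ha h hL by blast
      have "sub_le C S (inverse_image_rel C f (image_rel C f ?cl))"
        by (rule sub_le_trans[OF least(3) unit Sr clr inverse_image_relation[OF f fclr] X])
      then show "sub_le C (image_rel C f S) (image_rel C f ?cl)"
        unfolding image_le_iff[OF f Sr fclr] .
      fix g assume "g \<in> Arr C" and
        "Dom C g = Y \<and> Cod C g \<in> L \<and> sub_le C (image_rel C f S) (kernel_pair C g)"
      then have g: "g \<in> Arr C" "Dom C g = Y" "Cod C g \<in> L" "sub_le C (image_rel C f S) (kernel_pair C g)"
        by blast+
      note gr = kernel_pair_relation[OF g(1,2)]
      have gf: "g \<cdot> f \<in> Arr C" "Dom C (g \<cdot> f) = X" "Cod C (g \<cdot> f) \<in> L"
        using fa g by simp_all
      have "sub_le C S (kernel_pair C (g \<cdot> f))"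
        using g(4) unfolding image_le_iff[OF f Sr gr] inverse_image_kernel_pair[OF f g(1,2)] .
      then have "sub_le C ?cl (kernel_pair C (g \<cdot> f))"
        by (rule least_kernel_pair_le[OF least(1) gf])
      then show "sub_le C (image_rel C f ?cl) (kernel_pair C g)"
        unfolding image_le_iff[OF f clr gr] inverse_image_kernel_pair[OF f g(1,2)] .
    qed
    then show ?thesis by (rule reflective_closure_eqI[OF Y fS])
  qed
  then show ?thesis
    unfolding birkhoff_closure_operators_def using reflective_closure_effective[OF Le] by blast
qed

text \<open>The image of the diagonal along a regular epimorphism is the diagonal, so commutation with
  images carries closedness of the diagonal from domain to codomain.\<close>

lemma birkhoff_subcategory_of_birkhoff_closure:
  assumes cl: "cl \<in> birkhoff_closure_operators C"
  shows "separated_objects C cl \<in> birkhoff_subcategories C"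
proof -
  have ce: "cl \<in> effective_closure_operators C"
    using cl unfolding birkhoff_closure_operators_def by blast
  have "Cod C f \<in> separated_objects C cl" if f: "regepi f" "Dom C f \<in> separated_objects C cl" for f
  proof -
    let ?X = "Dom C f" and ?Y = "Cod C f"
    have fH: "f \<in> Hom C ?X ?Y" and X: "?X \<in> Obj C" and Y: "?Y \<in> Obj C" using f(1) by simp_all
    have "cl (?Y, image_rel C f (discrete_rel C ?X)) = image_rel C f (cl (?X, discrete_rel C ?X))"
      using cl X Y fH f(1) discrete_equiv_rel[OF X] unfolding birkhoff_closure_operators_def by blast
    moreover have "cl (?X, discrete_rel C ?X) = discrete_rel C ?X"
      using f(2) unfolding separated_objects_def by blast
    ultimately have "cl (?Y, discrete_rel C ?Y) = discrete_rel C ?Y"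
      using image_discrete[OF fH f(1)] by simp
    then show ?thesis using Y by (simp add: separated_objects_def)
  qed
  then show ?thesis
    unfolding birkhoff_subcategories_def using separated_epireflective[OF ce] by blast
qed

end

theorem proposition3p6:
  fixes C :: "('o, 'a) precategory"
  assumes "exact_goursat_category C"
  shows "\<exists>\<Phi> :: 'o set \<Rightarrow> ('o \<times> 'a set \<Rightarrow> 'a set).
    bij_betw \<Phi> (epireflective_subcategories C) (effective_closure_operators C) \<and>
    (\<forall>L \<in> epireflective_subcategories C. \<forall>lo la \<eta>. is_reflection C L lo la \<eta> \<longrightarrow>
       (\<forall>X \<in> Obj C. \<forall>S \<in> equiv_rels C X. \<forall>q. is_quotient C X S q \<longrightarrow>
          \<Phi> L (X, S) = kernel_pair C (\<eta> (Cod C q) \<cdot>\<^bsub>C\<^esub> q))) \<and>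
    (\<forall>cl \<in> effective_closure_operators C.
       inv_into (epireflective_subcategories C) \<Phi> cl = separated_objects C cl) \<and>
    bij_betw \<Phi> (birkhoff_subcategories C) (birkhoff_closure_operators C)"
proof -
  interpret exact_cat C
    using assms by unfold_locales (simp add: exact_goursat_category_def)
  let ?\<Phi> = "reflective_closure C" and ?\<Psi> = "separated_objects C"
  let ?E = "epireflective_subcategories C" and ?K = "effective_closure_operators C"
  have sub: "birkhoff_subcategories C \<subseteq> ?E" "birkhoff_closure_operators C \<subseteq> ?K"
    by (auto simp: birkhoff_subcategories_def birkhoff_closure_operators_def)
  have bij: "bij_betw ?\<Phi> ?E ?K"
    by (rule bij_betw_byWitness[where f' = ?\<Psi>])
      (use separated_reflective_closure reflective_closure_separated reflective_closure_effective
        separated_epireflective in blast)+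
  moreover have "bij_betw ?\<Phi> (birkhoff_subcategories C) (birkhoff_closure_operators C)"
  proof (rule bij_betw_byWitness[where f' = ?\<Psi>])
    show "\<forall>L\<in>birkhoff_subcategories C. ?\<Psi> (?\<Phi> L) = L"
      using separated_reflective_closure sub(1) by blast
    show "\<forall>cl\<in>birkhoff_closure_operators C. ?\<Phi> (?\<Psi> cl) = cl"
      using reflective_closure_separated sub(2) by blast
    show "?\<Phi> ` birkhoff_subcategories C \<subseteq> birkhoff_closure_operators C"
      using birkhoff_closure_of_birkhoff_subcategory[OF assms] by blast
    show "?\<Psi> ` birkhoff_closure_operators C \<subseteq> birkhoff_subcategories C"
      using birkhoff_subcategory_of_birkhoff_closure by blast
  qed
  moreover have "inv_into ?E ?\<Phi> cl = ?\<Psi> cl" if "cl \<in> ?K" for cl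
    by (rule inv_into_f_eq[OF bij_betw_imp_inj_on[OF bij] separated_epireflective[OF that]
        reflective_closure_separated[OF that]])
  ultimately show ?thesis
    using reflective_closure_eq by (intro exI[of _ ?\<Phi>]) blast
qed

end
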